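(* Let $M$ be an $n$-dimensional $\mathbb{Q}$-vector space, let $\{v_1,\ldots,v_n\}$ be a basis of $M^\ast$, let $\mathcal{Q}=\{q_0,\ldots,q_{r+1}\}\subset\mathbb{Q}[v_1,\ldots,v_n]$ be a realizable family of $n$-algebraic forms with $d=\deg(q_0)\geq 2$, and let $k$ be any integer satisfying $\deg(q_{r+1})<2k+(d-1)$. Let $\mathcal{M}_{(\mathcal{Q},k)}$ be the associated minimal Sullivan algebra (defined in the context). Then the group of self-homotopy equivalences $\mathcal{E}(\mathcal{M}_{(\mathcal{Q},k)})$ is isomorphic to the orthogonal group $\mathrm{O}(\mathcal{Q})$.
   Context: Here $n\ge 1$ and $r\ge 0$. $\mathbb{Q}[M]=\mathbb{Q}[v_1,\ldots,v_n]$ is the ring of polynomial functions on $M$. An $n$-algebraic form of degree $d$ is a homogeneous polynomial function $q(v_1,\ldots,v_n)$ of degree $d$. The orthogonal group of a family is $\mathrm{O}(\mathcal{Q})=\{f\in\mathrm{GL}(M)\mid q_i\circ f=q_i\text{ for every } i\}$. A family of $n$-algebraic forms $\mathcal{Q}=\{q_0,\ldots,q_{r+1}\}\subset\mathbb{Q}[v_1,\ldots,v_n]$ is realizable if: (1) $q_{r+1}=q_0^s$ for some $s\geq\max\{n,\lceil\deg(q_r)/\deg(q_0)\rceil+1\}$; (2) $\deg(q_{i+1})-\deg(q_i)>1$ for $i=0,\ldots,r$; (3) $q_0=\lambda_1v_1^d+\cdots+\lambda_nv_n^d$ for some integer $d>1$, with $\lambda_i\in\mathbb{Q}$, $\lambda_i\neq0$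 for $i=1,\ldots,n$. For a graded rational vector space $W$, $\Lambda W$ denotes the free commutative graded algebra on $W$. The minimal Sullivan algebra $\mathcal{M}_{(\mathcal{Q},k)}=(\Lambda(x_1,x_2,y_1,y_2,y_3,z,v_j\mid j=1,\ldots,n),\mathrm{d})$ over $\mathbb{Q}$ has generators of degrees $|x_1|=8$, $|x_2|=10$, $|y_1|=33$, $|y_2|=35$, $|y_3|=37$, $|v_j|=40$ for all $j$, $|z|=80k+40d-41$, and differential $$\mathrm{d}(x_1)=\mathrm{d}(x_2)=\mathrm{d}(v_j)=0,\quad \mathrm{d}(y_1)=x_1^3x_2,\quad \mathrm{d}(y_2)=x_1^2x_2^2,\quad \mathrm{d}(y_3)=x_1x_2^3,$$ $$\mathrm{d}(z)=\sum_{i=1}^{r+1}q_i\,x_1^{10k+5(d-1)-5\deg(q_i)}+q_0\,(x_1^{10k-5}+x_2^{8k-4})+x_1^{10k+5(d-4)}\,(y_1y_2x_1^4x_2^2-y_1y_3x_1^5x_2+y_2y_3x_1^6)+x_1^{10k+5(d-1)}+x_2^{8k+4(d-1)},$$ where each $q_i$ is viewed as a polynomial in the generators $v_1,\ldots,v_n$. $\mathcal{E}(\mathcal{M})$ denotes the group of homotopy classes of self-homotopy equivalences of a minimal Sullivan algebra $\mathcal{M}$, i.e. the group of differential graded algebra automorphisms of $\mathcal{M}$ modulo homotopy. *)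

theory Defs
  imports
    Complex_Main
    "HOL-Library.Poly_Mapping"
    "HOL-Library.Cardinality"
    "HOL-Library.Option_ord"
    "HOL-Library.Function_Algebras"
    "HOL-Algebra.Group"
begin

section \<open>Rational polynomials in several variables\<close>

type_synonym 'v qpoly = "('v \<Rightarrow>\<^sub>0 nat) \<Rightarrow>\<^sub>0 rat"

definition qconst :: "rat \<Rightarrow> 'v qpoly"
  where "qconst c = Poly_Mapping.single 0 c"

definition qvar :: "'v \<Rightarrow> 'v qpoly"
  where "qvar v = Poly_Mapping.single (Poly_Mapping.single v 1) 1"

definition mdeg :: "('v \<Rightarrow>\<^sub>0 nat) \<Rightarrow> nat"
  where "mdeg m = (\<Sum>v\<in>Poly_Mapping.keys m. Poly_Mapping.lookup m v)"

definition tdeg :: "'v qpoly \<Rightarrow> nat"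
  where "tdeg p = Max (insert 0 (mdeg ` Poly_Mapping.keys p))"

definition algebraic_form :: "nat \<Rightarrow> 'v qpoly \<Rightarrow> bool"
  where "algebraic_form d p \<longleftrightarrow> (\<forall>m\<in>Poly_Mapping.keys p. mdeg m = d)"

definition indets :: "'v qpoly \<Rightarrow> 'v set"
  where "indets p = (\<Union>m\<in>Poly_Mapping.keys p. Poly_Mapping.keys m)"

text \<open>The value of \<open>p\<close> in a \<open>\<rat>\<close>-algebra with structure map \<open>c\<close>,
  the variable \<open>v\<close> being replaced by \<open>g v\<close>.\<close>

definition subst :: "(rat \<Rightarrow> 'a::comm_ring_1) \<Rightarrow> ('v \<Rightarrow> 'a) \<Rightarrow> 'v qpoly \<Rightarrow> 'a"
  where "subst c g p = (\<Sum>m\<in>Poly_Mapping.keys p. c (Poly_Mapping.lookup p m) * (\<Prod>v\<in>Poly_Mapping.keys m. g v ^ Poly_Mapping.lookup m v))"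

lift_definition pdiff :: "'v \<Rightarrow> 'v qpoly \<Rightarrow> 'v qpoly"
  is "\<lambda>v p m. of_nat (Poly_Mapping.lookup m v + 1) * p (m + Poly_Mapping.single v 1)"
proof -
  fix v :: 'v and p :: "('v \<Rightarrow>\<^sub>0 nat) \<Rightarrow> rat"
  assume "finite {m. p m \<noteq> 0}"
  then have "finite ((\<lambda>m. m + Poly_Mapping.single v 1) -` {m. p m \<noteq> 0})"
    by (rule finite_vimageI) (auto intro: injI)
  then show "finite {m. of_nat (Poly_Mapping.lookup m v + 1) * p (m + Poly_Mapping.single v 1) \<noteq> 0}"
    by (rule rev_finite_subset) auto
qed


section \<open>Free commutative graded algebras\<close>

text \<open>\<open>\<Lambda>W\<close> is the symmetric algebra on the even part of \<open>W\<close> tensored with the exterior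
  algebra on the odd part. For a basis of \<open>W\<close> consisting of even generators \<open>'e\<close> and
  finitely many odd generators \<open>'o\<close>, an element is stored as the family of its polynomial
  coefficients with respect to the products \<open>y\<^sub>S = y\<^sub>1 \<cdots> y\<^sub>p\<close>, where
  \<open>S = {y\<^sub>1 < \<dots> < y\<^sub>p}\<close> is a set of odd generators.\<close>

typedef ('e, 'o) cga = "UNIV :: ('o set \<Rightarrow> 'e qpoly) set"
  morphisms cf Cga by simp

setup_lifting type_definition_cga

text \<open>\<open>y\<^sub>S y\<^sub>T = koszul S T \<cdot> y\<^bsub>S \<union> T\<^esub>\<close> for disjoint \<open>S\<close> and \<open>T\<close>.\<close>

definition koszul :: "'o::linorder set \<Rightarrow> 'o set \<Rightarrow> 'a::comm_ring_1"
  where "koszul S T = (- 1) ^ card {(s, t) \<in> S \<times> T. t < s}"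

lemma koszul_empty [simp]: "koszul {} T = 1" "koszul S {} = 1"
  by (simp_all add: koszul_def)

lemma koszul_Un_left:
  fixes S T U :: "'o::{finite,linorder} set"
  assumes "S \<inter> T = {}"
  shows "koszul (S \<union> T) U = koszul S U * koszul T U"
proof -
  have "{(s, t) \<in> (S \<union> T) \<times> U. t < s} = {(s, t) \<in> S \<times> U. t < s} \<union> {(s, t) \<in> T \<times> U. t < s}"
    by auto
  moreover have "{(s, t) \<in> S \<times> U. t < s} \<inter> {(s, t) \<in> T \<times> U. t < s} = {}"
    using assms by auto
  ultimately show ?thesis
    by (simp add: koszul_def card_Un_disjoint power_add)
qed

lemma koszul_Un_right:
  fixes S T U :: "'o::{finite,linorder} set"
  assumes "T \<inter> U = {}"
  shows "koszul S (T \<union> U) = koszul S T * koszul S U"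
proof -
  have "{(s, t) \<in> S \<times> (T \<union> U). t < s} = {(s, t) \<in> S \<times> T. t < s} \<union> {(s, t) \<in> S \<times> U. t < s}"
    by auto
  moreover have "{(s, t) \<in> S \<times> T. t < s} \<inter> {(s, t) \<in> S \<times> U. t < s} = {}"
    using assms by auto
  ultimately show ?thesis
    by (simp add: koszul_def card_Un_disjoint power_add)
qed

instantiation cga :: (type, "{finite, linorder}") ring_1
begin

lift_definition zero_cga :: "('a, 'b) cga" is "\<lambda>S. 0" .
lift_definition one_cga :: "('a, 'b) cga" is "\<lambda>S. if S = {} then 1 else 0" .
lift_definition plus_cga :: "('a, 'b) cga \<Rightarrow> ('a, 'b) cga \<Rightarrow> ('a, 'b) cga"
  is "\<lambda>f g S. f S + g S" .
lift_definition minus_cga :: "('a, 'b) cga \<Rightarrow> ('a, 'b) cga \<Rightarrow> ('a, 'b) cga"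
  is "\<lambda>f g S. f S - g S" .
lift_definition uminus_cga :: "('a, 'b) cga \<Rightarrow> ('a, 'b) cga"
  is "\<lambda>f S. - f S" .
lift_definition times_cga :: "('a, 'b) cga \<Rightarrow> ('a, 'b) cga \<Rightarrow> ('a, 'b) cga"
  is "\<lambda>f g U. \<Sum>S\<in>Pow U. koszul S (U - S) * f S * g (U - S)" .

instance
proof
  fix a b c :: "('a, 'b) cga"
  show "a + b + c = a + (b + c)" by transfer (simp add: add.assoc)
  show "a + b = b + a" by transfer (simp add: add.commute)
  show "0 + a = a" by transfer simp
  show "- a + a = 0" by transfer simp
  show "a - b = a + - b" by transfer simp
  show "(0::('a, 'b) cga) \<noteq> 1" by transfer (metis zero_neq_one)
  show "(a + b) * c = a * c + b * c"
    by transfer (simp add: algebra_simps sum.distrib)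
  show "a * (b + c) = a * b + a * c"
    by transfer (simp add: algebra_simps sum.distrib)
  show "1 * a = a"
  proof (transfer, rule ext)
    fix f :: "'b set \<Rightarrow> 'a qpoly" and U
    have "(\<Sum>S\<in>Pow U. koszul S (U - S) * (if S = {} then 1 else 0) * f (U - S))
        = (\<Sum>S\<in>Pow U. if S = {} then f U else 0)"
      by (rule sum.cong) auto
    then show "(\<Sum>S\<in>Pow U. koszul S (U - S) * (if S = {} then 1 else 0) * f (U - S)) = f U"
      by (simp add: sum.delta)
  qed
  show "a * 1 = a"
  proof (transfer, rule ext)
    fix f :: "'b set \<Rightarrow> 'a qpoly" and U
    have "(\<Sum>S\<in>Pow U. koszul S (U - S) * f S * (if U - S = {} then 1 else 0))
        = (\<Sum>S\<in>Pow U. if S = U then f U else 0)"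
      by (rule sum.cong) auto
    then show "(\<Sum>S\<in>Pow U. koszul S (U - S) * f S * (if U - S = {} then 1 else 0)) = f U"
      by (simp add: sum.delta)
  qed
  show "a * b * c = a * (b * c)"
  proof (transfer, rule ext)
    fix f g h :: "'b set \<Rightarrow> 'a qpoly" and U :: "'b set"
    have "(\<Sum>R\<in>Pow U. koszul R (U - R) * (\<Sum>S\<in>Pow R. koszul S (R - S) * f S * g (R - S)) * h (U - R))
        = (\<Sum>(R, S)\<in>Sigma (Pow U) Pow.
             koszul R (U - R) * koszul S (R - S) * (f S * g (R - S) * h (U - R)))"
      by (simp add: sum.Sigma[symmetric] sum_distrib_left sum_distrib_right mult_ac)
    also have "\<dots> = (\<Sum>(S, T)\<in>Sigma (Pow U) (\<lambda>S. Pow (U - S)).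
             koszul S (U - S) * koszul T (U - S - T) * (f S * g T * h (U - S - T)))"
    proof (rule sum.reindex_bij_witness[where i = "\<lambda>(S, T). (S \<union> T, S)" and j = "\<lambda>(R, S). (S, R - S)"];
        clarsimp)
      fix R S :: "'b set"
      assume "R \<subseteq> U" "S \<subseteq> R"
      define T where "T = R - S"
      define V where "V = U - R"
      have R: "R = S \<union> T" and US: "U - S = T \<union> V" and V: "U - S - (R - S) = V"
        and dis: "S \<inter> T = {}" "T \<inter> V = {}"
        using \<open>R \<subseteq> U\<close> \<open>S \<subseteq> R\<close> by (auto simp: T_def V_def)
      have "koszul S (U - S) * koszul T V = (koszul R V * koszul S T :: 'a qpoly)"
        unfolding R US using dis by (simp add: koszul_Un_left koszul_Un_right mult_ac)
      then show "koszul S (U - S) * koszul (R - S) (U - S - (R - S))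
            * (f S * g (R - S) * h (U - S - (R - S)))
          = koszul R (U - R) * koszul S (R - S) * (f S * g (R - S) * h (U - R))"
        unfolding V by (simp add: T_def V_def)
    qed auto
    also have "\<dots> = (\<Sum>S\<in>Pow U. koszul S (U - S) * f S
        * (\<Sum>T\<in>Pow (U - S). koszul T (U - S - T) * g T * h (U - S - T)))"
      by (simp add: sum.Sigma[symmetric] sum_distrib_left sum_distrib_right mult_ac)
    finally show "(\<Sum>R\<in>Pow U. koszul R (U - R) * (\<Sum>S\<in>Pow R. koszul S (R - S) * f S * g (R - S)) * h (U - R))
        = (\<Sum>S\<in>Pow U. koszul S (U - S) * f S
        * (\<Sum>T\<in>Pow (U - S). koszul T (U - S - T) * g T * h (U - S - T)))" .
  qed
qed

end

definition even_emb :: "'e qpoly \<Rightarrow> ('e, 'o) cga"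
  where "even_emb p = Cga (\<lambda>S. if S = {} then p else 0)"

definition odd_prod :: "'o set \<Rightarrow> ('e, 'o) cga"
  where "odd_prod S = Cga (\<lambda>T. if T = S then 1 else 0)"

definition evar :: "'e \<Rightarrow> ('e, 'o) cga"
  where "evar e = even_emb (qvar e)"

definition ovar :: "'o \<Rightarrow> ('e, 'o) cga"
  where "ovar y = odd_prod {y}"

definition scal :: "rat \<Rightarrow> ('e, 'o) cga \<Rightarrow> ('e, 'o) cga"
  where "scal c a = Cga (\<lambda>S. qconst c * cf a S)"


section \<open>Free commutative differential graded algebras and homotopy\<close>

text \<open>A free cdga \<open>(\<Lambda>W, d)\<close> is given by the degrees of the generators and by the values
  of \<open>d\<close> on them. It is understood that \<open>edeg\<close> takes even and \<open>odeg\<close> odd values: the signs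
  in the product depend only on the sorts \<open>'e\<close> and \<open>'o\<close> of the generators.\<close>

record ('e, 'o) free_cdga =
  edeg :: "'e \<Rightarrow> int"
  odeg :: "'o \<Rightarrow> int"
  ediff :: "'e \<Rightarrow> ('e, 'o) cga"
  odiff :: "'o \<Rightarrow> ('e, 'o) cga"

definition homogeneous :: "('e, 'o) free_cdga \<Rightarrow> int \<Rightarrow> ('e, 'o) cga \<Rightarrow> bool"
  where "homogeneous A i a \<longleftrightarrow>
    (\<forall>S. \<forall>m\<in>Poly_Mapping.keys (cf a S).
       (\<Sum>e\<in>Poly_Mapping.keys m. int (Poly_Mapping.lookup m e) * edeg A e) + (\<Sum>y\<in>S. odeg A y) = i)"

text \<open>The derivation of \<open>\<Lambda>W\<close> extending the given values:
  \<open>d(p y\<^sub>S) = (\<Sum>\<^sub>e \<partial>p/\<partial>e \<cdot> d(e)) y\<^sub>S + p \<Sum>\<^sub>y \<plusminus> y\<^bsub>S,<y\<^esub> d(y) y\<^bsub>S,>y\<^esub>\<close>,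
  the sign counting the odd generators which \<open>d\<close> has to pass.\<close>

definition cdiff ::
  "('e, 'o::{finite,linorder}) free_cdga \<Rightarrow> ('e, 'o) cga \<Rightarrow> ('e, 'o) cga"
  where "cdiff A a = (\<Sum>S\<in>UNIV.
     (\<Sum>e\<in>indets (cf a S). even_emb (pdiff e (cf a S)) * ediff A e) * odd_prod S
     + even_emb (cf a S) * (\<Sum>y\<in>S. (- 1) ^ card {s \<in> S. s < y} *
         (odd_prod {s \<in> S. s < y} * odiff A y * odd_prod {s \<in> S. y < s})))"

definition cdga_hom ::
  "('e, 'o::{finite,linorder}) free_cdga \<Rightarrow> ('f, 'p::{finite,linorder}) free_cdga
    \<Rightarrow> (('e, 'o) cga \<Rightarrow> ('f, 'p) cga) \<Rightarrow> bool"
  where "cdga_hom A B \<phi> \<longleftrightarrow>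
    (\<forall>a b. \<phi> (a + b) = \<phi> a + \<phi> b) \<and> (\<forall>c a. \<phi> (scal c a) = scal c (\<phi> a)) \<and>
    (\<forall>a b. \<phi> (a * b) = \<phi> a * \<phi> b) \<and> \<phi> 1 = 1 \<and>
    (\<forall>i a. homogeneous A i a \<longrightarrow> homogeneous B i (\<phi> a)) \<and>
    (\<forall>a. \<phi> (cdiff A a) = cdiff B (\<phi> a))"

text \<open>\<open>(\<Lambda>W, d) \<otimes> \<Lambda>(t, dt)\<close> is the free cdga on the generators of \<open>W\<close> (tagged with
  \<open>Some\<close>) together with \<open>t\<close> (even, \<open>None\<close>) and \<open>dt\<close> (odd, \<open>None\<close>).\<close>

definition cyl_emb :: "('e, 'o) cga \<Rightarrow> ('e option, 'o option) cga"
  where "cyl_emb a = Cga (\<lambda>S. if None \<in> S then 0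
     else subst qconst (\<lambda>e. qvar (Some e)) (cf a {y. Some y \<in> S}))"

definition cyl ::
  "('e, 'o::{finite,linorder}) free_cdga \<Rightarrow> ('e option, 'o option) free_cdga"
  where "cyl A = \<lparr>
     edeg = (\<lambda>e. case e of None \<Rightarrow> 0 | Some e' \<Rightarrow> edeg A e'),
     odeg = (\<lambda>y. case y of None \<Rightarrow> 1 | Some y' \<Rightarrow> odeg A y'),
     ediff = (\<lambda>e. case e of None \<Rightarrow> ovar None | Some e' \<Rightarrow> cyl_emb (ediff A e')),
     odiff = (\<lambda>y. case y of None \<Rightarrow> 0 | Some y' \<Rightarrow> cyl_emb (odiff A y'))\<rparr>"

text \<open>The augmentation \<open>t \<mapsto> c\<close>, \<open>dt \<mapsto> 0\<close>.\<close>

definition cyl_at :: "rat \<Rightarrow> ('e option, 'o option) cga \<Rightarrow> ('e, 'o) cga"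
  where "cyl_at c a = Cga (\<lambda>S.
     subst qconst (\<lambda>e. case e of None \<Rightarrow> qconst c | Some e' \<Rightarrow> qvar e') (cf a (Some ` S)))"

definition homotopic ::
  "('e, 'o::{finite,linorder}) free_cdga \<Rightarrow> (('e, 'o) cga \<Rightarrow> ('e, 'o) cga)
    \<Rightarrow> (('e, 'o) cga \<Rightarrow> ('e, 'o) cga) \<Rightarrow> bool"
  where "homotopic A \<phi> \<psi> \<longleftrightarrow>
    (\<exists>H. cdga_hom A (cyl A) H \<and> cyl_at 0 \<circ> H = \<phi> \<and> cyl_at 1 \<circ> H = \<psi>)"

definition cdga_aut ::
  "('e, 'o::{finite,linorder}) free_cdga \<Rightarrow> (('e, 'o) cga \<Rightarrow> ('e, 'o) cga) set"
  where "cdga_aut A = {\<phi>. cdga_hom A A \<phi> \<and> bij \<phi>}"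

definition homotopy_rel ::
  "('e, 'o::{finite,linorder}) free_cdga \<Rightarrow> (('e, 'o) cga \<Rightarrow> ('e, 'o) cga) rel"
  where "homotopy_rel A =
    {(\<phi>, \<psi>). \<phi> \<in> cdga_aut A \<and> \<psi> \<in> cdga_aut A \<and> homotopic A \<phi> \<psi>}"

definition self_equivalences ::
  "('e, 'o::{finite,linorder}) free_cdga \<Rightarrow> (('e, 'o) cga \<Rightarrow> ('e, 'o) cga) set monoid"
  where "self_equivalences A = \<lparr>
     carrier = cdga_aut A // homotopy_rel A,
     mult = (\<lambda>C D. \<Union>\<phi>\<in>C. \<Union>\<psi>\<in>D. homotopy_rel A `` {\<phi> \<circ> \<psi>}),
     one = homotopy_rel A `` {id}\<rparr>"


section \<open>Realizable families and their orthogonal groups\<close>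

text \<open>A family \<open>q\<^sub>0, \<dots>, q\<^bsub>r+1\<^esub>\<close> is the restriction of \<open>q\<close> to the indices \<open>\<le> r + 1\<close>;
  the number \<open>n\<close> of variables is \<open>CARD('n)\<close>.\<close>

definition realizable :: "nat \<Rightarrow> (nat \<Rightarrow> 'n::finite qpoly) \<Rightarrow> bool"
  where "realizable r q \<longleftrightarrow>
    (\<forall>i\<le>r + 1. algebraic_form (tdeg (q i)) (q i)) \<and>
    (\<exists>s. int s \<ge> max (int CARD('n)) (\<lceil>(of_nat (tdeg (q r)) / of_nat (tdeg (q 0)) :: rat)\<rceil> + 1)
       \<and> q (r + 1) = q 0 ^ s) \<and>
    (\<forall>i\<le>r. int (tdeg (q (i + 1))) - int (tdeg (q i)) > 1) \<and>
    (\<exists>d>1. \<exists>l. (\<forall>j. l j \<noteq> 0) \<and> q 0 = (\<Sum>j\<in>UNIV. qconst (l j) * qvar j ^ d))"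

definition dual_space :: "(rat \<Rightarrow> 'm::ab_group_add \<Rightarrow> 'm) \<Rightarrow> ('m \<Rightarrow> rat) set"
  where "dual_space scale = {f. Vector_Spaces.linear scale (*) f}"

definition dual_basis ::
  "(rat \<Rightarrow> 'm::ab_group_add \<Rightarrow> 'm) \<Rightarrow> ('n \<Rightarrow> 'm \<Rightarrow> rat) \<Rightarrow> bool"
  where "dual_basis scale v \<longleftrightarrow> inj v \<and>
    \<not> module.dependent (\<lambda>c f x. c * f x) (range v) \<and>
    module.span (\<lambda>c f x. c * f x) (range v) = dual_space scale"

text \<open>The polynomial function on \<open>M\<close> given by \<open>p\<close> in the coordinates \<open>v\<close>.\<close>

definition poly_fun :: "('n \<Rightarrow> 'm \<Rightarrow> rat) \<Rightarrow> 'n qpoly \<Rightarrow> 'm \<Rightarrow> rat"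
  where "poly_fun v p x = subst id (\<lambda>j. v j x) p"

definition orthogonal_group ::
  "(rat \<Rightarrow> 'm::ab_group_add \<Rightarrow> 'm) \<Rightarrow> ('n \<Rightarrow> 'm \<Rightarrow> rat) \<Rightarrow> nat \<Rightarrow> (nat \<Rightarrow> 'n qpoly)
    \<Rightarrow> ('m \<Rightarrow> 'm) monoid"
  where "orthogonal_group scale v r q = \<lparr>
     carrier = {f. Vector_Spaces.linear scale scale f \<and> bij f \<and>
       (\<forall>i\<le>r + 1. poly_fun v (q i) \<circ> f = poly_fun v (q i))},
     mult = (\<circ>), one = id\<rparr>"


section \<open>The algebra associated with a family of forms\<close>

datatype 'n even_gen = X1 | X2 | V 'n

datatype odd_gen = Y1 | Y2 | Y3 | Z

instance odd_gen :: finite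
proof
  have eq: "(UNIV :: odd_gen set) = {Y1, Y2, Y3, Z}"
    using odd_gen.exhaust by blast
  show "finite (UNIV :: odd_gen set)"
    unfolding eq by (intro finite.intros)
qed

instantiation odd_gen :: linorder
begin

definition odd_gen_index :: "odd_gen \<Rightarrow> nat"
  where "odd_gen_index y = (case y of Y1 \<Rightarrow> 1 | Y2 \<Rightarrow> 2 | Y3 \<Rightarrow> 3 | Z \<Rightarrow> 4)"

definition less_eq_odd_gen :: "odd_gen \<Rightarrow> odd_gen \<Rightarrow> bool"
  where "y \<le> y' \<longleftrightarrow> odd_gen_index y \<le> odd_gen_index y'"

definition less_odd_gen :: "odd_gen \<Rightarrow> odd_gen \<Rightarrow> bool"
  where "y < y' \<longleftrightarrow> odd_gen_index y < odd_gen_index y'"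

instance
  by standard
    (auto simp: less_eq_odd_gen_def less_odd_gen_def odd_gen_index_def split: odd_gen.splits)

end

text \<open>Exponents are computed in \<open>\<int>\<close>; under the hypothesis \<open>deg q\<^bsub>r+1\<^esub> < 2k + (d - 1)\<close> on
  a realizable family they are all nonnegative.\<close>

definition model_dz ::
  "nat \<Rightarrow> (nat \<Rightarrow> 'n qpoly) \<Rightarrow> int \<Rightarrow> ('n even_gen, odd_gen) cga"
  where "model_dz r q k =
    (let d = int (tdeg (q 0));
         Q = (\<lambda>i. even_emb (subst qconst (\<lambda>j. qvar (V j)) (q i)));
         x1 = evar X1; x2 = evar X2; y1 = ovar Y1; y2 = ovar Y2; y3 = ovar Y3
     in (\<Sum>i=1..r + 1. Q i * x1 ^ nat (10 * k + 5 * (d - 1) - 5 * int (tdeg (q i))))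
        + Q 0 * (x1 ^ nat (10 * k - 5) + x2 ^ nat (8 * k - 4))
        + x1 ^ nat (10 * k + 5 * (d - 4)) *
            (y1 * y2 * x1 ^ 4 * x2 ^ 2 - y1 * y3 * x1 ^ 5 * x2 + y2 * y3 * x1 ^ 6)
        + x1 ^ nat (10 * k + 5 * (d - 1)) + x2 ^ nat (8 * k + 4 * (d - 1)))"

definition model :: "nat \<Rightarrow> (nat \<Rightarrow> 'n qpoly) \<Rightarrow> int \<Rightarrow> ('n even_gen, odd_gen) free_cdga"
  where "model r q k = \<lparr>
     edeg = (\<lambda>e. case e of X1 \<Rightarrow> 8 | X2 \<Rightarrow> 10 | V j \<Rightarrow> 40),
     odeg = (\<lambda>y. case y of Y1 \<Rightarrow> 33 | Y2 \<Rightarrow> 35 | Y3 \<Rightarrow> 37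
       | Z \<Rightarrow> 80 * k + 40 * int (tdeg (q 0)) - 41),
     ediff = (\<lambda>e. 0),
     odiff = (\<lambda>y. case y of
         Y1 \<Rightarrow> evar X1 ^ 3 * evar X2
       | Y2 \<Rightarrow> evar X1 ^ 2 * evar X2 ^ 2
       | Y3 \<Rightarrow> evar X1 * evar X2 ^ 3
       | Z \<Rightarrow> model_dz r q k)\<rparr>"

end

theory Submission
  imports Defs "HOL-Computational_Algebra.Polynomial"
begin

text \<open>
  Write \<open>A\<close> for the model and \<open>L\<close> for the matrix of the action of an automorphism \<open>\<phi>\<close> on the
  generators \<open>v\<^sub>j\<close>, modulo powers of \<open>x\<^sub>1\<close> and \<open>x\<^sub>2\<close>. The theorem says that \<open>\<phi> \<mapsto> L\<close> loses
  nothing but homotopies, and that the matrices which occur are those that preserve all forms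
  \<open>q\<^sub>i\<close>.

  Degrees leave little room: \<open>\<phi>\<close> multiplies \<open>x\<^sub>1\<close>, \<open>x\<^sub>2\<close> and the \<open>y\<^sub>i\<close> by scalars, maps
  \<open>v\<^sub>j\<close> to \<open>(L v)\<^sub>j + b\<^sub>j x\<^sub>1\<^sup>5 + c\<^sub>j x\<^sub>2\<^sup>4\<close>, and maps \<open>z\<close> to a multiple of \<open>z\<close> plus terms in the
  other generators. All further information is in the equation \<open>\<phi> (d z) = d (\<phi> z)\<close>. Its
  coefficient at \<open>y\<^sub>2 y\<^sub>3\<close> determines the multiple of \<open>z\<close> from the scalars of \<open>x\<^sub>1\<close> and
  \<open>x\<^sub>2\<close>. Its part without odd generators, restricted to \<open>x\<^sub>2 = 0\<close> and to \<open>x\<^sub>1 = 0\<close>, where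
  \<open>d y\<^sub>1\<close>, \<open>d y\<^sub>2\<close>, \<open>d y\<^sub>3\<close> vanish, gives two identities between sums of the forms \<open>q\<^sub>i\<close>
  before and after the substitution. Because the degrees of the forms have gaps and the top
  form is a power of the diagonal form \<open>q\<^sub>0\<close>, such an identity forces the translations \<open>b\<close>
  and \<open>c\<close> to vanish and can be compared degree by degree (\<open>compare_forms\<close>). The resulting
  equations between powers of the scalars have only the solution 1 over the rationals
  (\<open>rigid_scalars\<close>). So \<open>\<phi>\<close> fixes \<open>x\<^sub>i\<close> and \<open>y\<^sub>i\<close>, acts on the \<open>v\<^sub>j\<close> by a matrix that
  preserves the forms, and differs from the identity on \<open>z\<close> only by other generators
  (\<open>automorphism_normal_form\<close>).

  Two automorphisms with the same matrix differ on \<open>z\<close> by a cocycle, and in that degree every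
  cocycle not involving \<open>z\<close> is a coboundary (\<open>zdeg_exact\<close>); a primitive gives a homotopy
  (\<open>homotopic_if_mat_eq\<close>). Conversely, along a homotopy the images of the \<open>v\<^sub>j\<close> cannot move
  (\<open>mat_eq_if_homotopic\<close>). A matrix preserving the forms acts on \<open>A\<close> by substitution
  (\<open>lin_hom\<close>). Hence homotopy classes of automorphisms are the fibres of a surjective
  multiplicative map onto the orthogonal group, which is the claim
  (\<open>quotient_by_kernel\<close>).

  All of this rests on the calculus of free commutative graded algebras: the Leibniz rule for
  the differential (\<open>cdiff_mult\<close>) and the construction of homomorphisms from their values on
  generators (\<open>cdga_hom_ext_hom\<close>).
\<close>

abbreviation lookup :: "('a \<Rightarrow>\<^sub>0 'b::zero) \<Rightarrow> 'a \<Rightarrow> 'b"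
  where "lookup \<equiv> Poly_Mapping.lookup"

abbreviation keys :: "('a \<Rightarrow>\<^sub>0 'b::zero) \<Rightarrow> 'a set"
  where "keys \<equiv> Poly_Mapping.keys"

abbreviation single :: "'a \<Rightarrow> 'b \<Rightarrow> ('a \<Rightarrow>\<^sub>0 'b::zero)"
  where "single \<equiv> Poly_Mapping.single"

section \<open>Polynomials\<close>

lemma qpoly_sum_single: "p = (\<Sum>m\<in>keys p. single m (lookup p m))" for p :: "'v qpoly"
proof (rule poly_mapping_eqI)
  fix n
  have "lookup (\<Sum>m\<in>keys p. single m (lookup p m)) n = (\<Sum>m\<in>keys p. if m = n then lookup p m else 0)"
    by (simp add: lookup_sum lookup_single when_def)
  then show "lookup p n = lookup (\<Sum>m\<in>keys p. single m (lookup p m)) n"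
    by (simp add: in_keys_iff)
qed

lemma qpoly_single_induct [case_names single add]:
  fixes p :: "'v qpoly"
  assumes "\<And>m a. P (single m a)" and "\<And>p q. P p \<Longrightarrow> P q \<Longrightarrow> P (p + q)"
  shows "P p"
proof -
  have "P (\<Sum>m\<in>F. single m (lookup p m))" if "finite F" for F
    using that
  proof induction
    case empty
    show ?case using assms(1)[of 0 0] by simp
  qed (simp add: assms)
  from this[of "keys p"] show ?thesis
    by (simp flip: qpoly_sum_single)
qed

lemma qconst_simps [simp]:
  "qconst 0 = 0" "qconst 1 = 1" "qconst (a + b) = qconst a + qconst b"
  "qconst (a * b) = qconst a * qconst b" "qconst (- a) = - qconst a"
  "qconst (a - b) = qconst a - qconst b"
  by (simp_all add: qconst_def single_add mult_single single_uminus single_diff)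

lemma qconst_power [simp]: "qconst (a ^ n) = qconst a ^ n"
  by (induction n) simp_all

lemma monomial_induct [case_names zero var]:
  fixes m :: "'v \<Rightarrow>\<^sub>0 nat"
  assumes zero: "P 0" and var: "\<And>v m. P m \<Longrightarrow> P (single v 1 + m)"
  shows "P m"
proof (induction "\<Sum>v\<in>keys m. lookup m v" arbitrary: m rule: less_induct)
  case less
  show ?case
  proof (cases "m = 0")
    case False
    then obtain v where v: "lookup m v \<noteq> 0"
      by (metis lookup_zero poly_mapping_eqI)
    define m' where "m' = m - single v 1"
    have m: "m = single v 1 + m'"
      using v by (intro poly_mapping_eqI)
        (auto simp: m'_def lookup_add lookup_minus lookup_single when_def)
    have "keys m' \<subseteq> keys m"
      by (auto simp: in_keys_iff m lookup_add)
    then have "(\<Sum>w\<in>keys m'. lookup m' w) = (\<Sum>w\<in>keys m. lookup m' w)"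
      by (intro sum.mono_neutral_left) (auto simp: in_keys_iff)
    also have "\<dots> < (\<Sum>w\<in>keys m. lookup m w)"
      using v by (intro sum_strict_mono_ex1)
        (auto simp: m lookup_add in_keys_iff lookup_single when_def intro!: bexI[of _ v])
    finally show ?thesis
      using less m var by metis
  qed (simp add: zero)
qed

text \<open>Ring homomorphisms and derivations are compared by this induction.\<close>

lemma qpoly_induct [case_names const add var]:
  fixes p :: "'v qpoly"
  assumes const: "\<And>c. P (qconst c)" and add: "\<And>p q. P p \<Longrightarrow> P q \<Longrightarrow> P (p + q)"
    and var: "\<And>v p. P p \<Longrightarrow> P (qvar v * p)"
  shows "P p"
proof (induction p rule: qpoly_single_induct)
  case (single m a)
  show ?case
  proof (induction m rule: monomial_induct)
    case zero
    show ?case using const[of a] by (simp add: qconst_def)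
  next
    case (var v m)
    have "single (single v 1 + m) a = qvar v * single m a"
      by (simp add: qvar_def mult_single)
    then show ?case using assms(3)[OF var] by simp
  qed
qed (rule add)

lemma lookup_single_mult:
  fixes p :: "'v qpoly"
  shows "lookup (single m c * p) (m + n) = c * lookup p n"
proof (induction p rule: qpoly_single_induct)
  case (single k d)
  show ?case by (simp add: mult_single lookup_single when_def)
qed (simp add: algebra_simps lookup_add)

lemma lookup_single_mult_0:
  fixes p :: "'v qpoly"
  assumes "\<And>n'. n \<noteq> m + n'"
  shows "lookup (single m c * p) n = 0"
proof (induction p rule: qpoly_single_induct)
  case (single k d)
  show ?case using assms[of k] by (auto simp add: mult_single lookup_single when_def)
qed (simp add: algebra_simps lookup_add)

lemma single_mult_cancel:
  fixes p q :: "'v qpoly"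
  assumes "single m 1 * p = single m 1 * q"
  shows "p = q"
  by (rule poly_mapping_eqI) (metis assms lookup_single_mult mult_1)

lemma lookup_qconst_mult: "lookup (qconst c * p) n = c * lookup p n"
  using lookup_single_mult[of 0 c p n] by (simp add: qconst_def)

lemma qvar_power: "qvar v ^ n = single (single v n) 1"
  by (induction n) (simp_all add: qvar_def mult_single flip: single_add)

subsection \<open>Partial derivatives\<close>

lemma lookup_pdiff: "lookup (pdiff v p) m = of_nat (lookup m v + 1) * lookup p (m + single v 1)"
  by transfer simp

lemma pdiff_add [simp]: "pdiff v (p + q) = pdiff v p + pdiff v q"
  by (rule poly_mapping_eqI) (simp add: lookup_pdiff lookup_add algebra_simps)

lemma pdiff_qconst_mult [simp]: "pdiff v (qconst c * p) = qconst c * pdiff v p"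
  by (rule poly_mapping_eqI) (simp add: lookup_pdiff lookup_qconst_mult)

lemma pdiff_0 [simp]: "pdiff v 0 = 0"
  using pdiff_qconst_mult[of v 0 0] by simp

lemma pdiff_1 [simp]: "pdiff v 1 = 0"
proof (rule poly_mapping_eqI)
  fix m :: "'a \<Rightarrow>\<^sub>0 nat"
  have "m + single v 1 \<noteq> 0"
    by (metis add_is_0 lookup_add lookup_single_eq lookup_zero zero_neq_one)
  then show "lookup (pdiff v 1) m = lookup 0 m"
    by (simp add: lookup_pdiff lookup_one when_def)
qed

lemma pdiff_qconst [simp]: "pdiff v (qconst c) = 0"
  using pdiff_qconst_mult[of v c 1] by simp

text \<open>The case of a variable suffices for the product rule, which then follows by
  induction.\<close>

lemma pdiff_qvar_mult: "pdiff v (qvar w * p) = (if v = w then p else 0) + qvar w * pdiff v p"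
proof (rule poly_mapping_eqI)
  fix n :: "'a \<Rightarrow>\<^sub>0 nat"
  show "lookup (pdiff v (qvar w * p)) n = lookup ((if v = w then p else 0) + qvar w * pdiff v p) n"
  proof (cases "\<exists>n'. n = single w 1 + n'")
    case True
    then obtain n' where n: "n = single w 1 + n'" by blast
    show ?thesis
      unfolding n lookup_add lookup_pdiff qvar_def lookup_single_mult add.assoc
      by (simp add: lookup_pdiff lookup_single lookup_add when_def add.commute add.left_commute distrib_right)
  next
    case False
    have nw: "lookup n w = 0"
    proof (rule ccontr)
      assume "lookup n w \<noteq> 0"
      then have "n = single w 1 + (n - single w 1)"
        by (intro poly_mapping_eqI) (auto simp: lookup_add lookup_minus lookup_single when_def)
      with False show False by blast
    qed
    have 1: "lookup (qvar w * pdiff v p) n = 0"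
      unfolding qvar_def by (rule lookup_single_mult_0) (use False in auto)
    show ?thesis
    proof (cases "v = w")
      case True
      then show ?thesis
        using nw lookup_single_mult[of "single w 1" 1 p n] 1
        by (simp add: lookup_add lookup_pdiff qvar_def add.commute)
    next
      case vw: False
      have "lookup (qvar w * p) (n + single v 1) = 0"
        unfolding qvar_def
      proof (rule lookup_single_mult_0)
        fix n'
        have "lookup (n + single v 1) w = 0"
          using nw vw by (simp add: lookup_add lookup_single)
        then show "n + single v 1 \<noteq> single w 1 + n'"
          by (metis add_is_0 lookup_add lookup_single_eq zero_neq_one)
      qed
      then show ?thesis using vw by (simp add: lookup_add lookup_pdiff 1)
    qed
  qed
qed

lemma pdiff_qvar [simp]: "pdiff v (qvar w) = (if v = w then 1 else 0)"
  using pdiff_qvar_mult[of v w 1] by simp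

lemma pdiff_mult: "pdiff v (p * q) = pdiff v p * q + p * pdiff v q"
proof (induction p rule: qpoly_induct)
  case (var w p)
  have "pdiff v (qvar w * p * q) = (if v = w then p * q else 0) + qvar w * pdiff v (p * q)"
    by (simp add: pdiff_qvar_mult mult.assoc)
  also have "\<dots> = pdiff v (qvar w * p) * q + qvar w * p * pdiff v q"
    unfolding var pdiff_qvar_mult[of v w p] by (simp add: algebra_simps)
  finally show ?case .
qed (simp_all add: distrib_left distrib_right)

lemma pdiff_eq_0_keys:
  assumes "pdiff v p = 0" and "m \<in> keys p"
  shows "lookup m v = 0"
proof (rule ccontr)
  assume "lookup m v \<noteq> 0"
  then have "m = (m - single v 1) + single v 1"
    by (intro poly_mapping_eqI) (auto simp: lookup_add lookup_minus lookup_single when_def)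
  then have "lookup p m = 0"
    using assms(1) lookup_pdiff[of v p "m - single v 1"] by simp
  with assms(2) show False by (simp add: in_keys_iff)
qed

lemma pdiff_notin_indets: "v \<notin> indets p \<Longrightarrow> pdiff v p = 0"
proof (rule poly_mapping_eqI)
  fix m :: "'a \<Rightarrow>\<^sub>0 nat"
  assume "v \<notin> indets p"
  moreover have "v \<in> keys (m + single v 1)"
    by (simp add: in_keys_iff lookup_add)
  ultimately have "m + single v 1 \<notin> keys p"
    unfolding indets_def by blast
  then show "lookup (pdiff v p) m = lookup 0 m"
    by (simp add: lookup_pdiff in_keys_iff)
qed

subsection \<open>Substitution\<close>

definition monom_val :: "('v \<Rightarrow> 'a::comm_ring_1) \<Rightarrow> ('v \<Rightarrow>\<^sub>0 nat) \<Rightarrow> 'a"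
  where "monom_val g m = (\<Prod>v\<in>keys m. g v ^ lookup m v)"

lemma monom_val_superset:
  assumes "finite F" "keys m \<subseteq> F"
  shows "monom_val g m = (\<Prod>v\<in>F. g v ^ lookup m v)"
  unfolding monom_val_def
  by (rule prod.mono_neutral_left) (use assms in \<open>auto simp: in_keys_iff\<close>)

lemma monom_val_add: "monom_val g (m + n) = monom_val g m * monom_val g n"
proof -
  have "keys (m + n) \<subseteq> keys m \<union> keys n" by (rule keys_add)
  then have "monom_val g (m + n) = (\<Prod>v\<in>keys m \<union> keys n. g v ^ lookup (m + n) v)"
    by (intro monom_val_superset) auto
  also have "\<dots> = (\<Prod>v\<in>keys m \<union> keys n. g v ^ lookup m v) * (\<Prod>v\<in>keys m \<union> keys n. g v ^ lookup n v)"
    by (simp add: lookup_add power_add prod.distrib)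
  finally show ?thesis
    by (simp add: monom_val_superset[of "keys m \<union> keys n"])
qed

lemma monom_val_0 [simp]: "monom_val g 0 = 1"
  by (simp add: monom_val_def)

lemma monom_val_single [simp]: "monom_val g (single v n) = g v ^ n"
  by (cases n) (simp_all add: monom_val_def)

text \<open>\<open>subst c g\<close> is a ring homomorphism only if \<open>c\<close> is one. The instances needed are
  evaluation at rational points, substitution of polynomials, and restriction to a line.\<close>

locale coeff_hom =
  fixes c :: "rat \<Rightarrow> 'a::comm_ring_1"
  assumes one [simp]: "c 1 = 1"
    and add [simp]: "c (x + y) = c x + c y"
    and mult [simp]: "c (x * y) = c x * c y"
begin

lemma zero [simp]: "c 0 = 0"
  using add[of 0 0] by simp

lemma subst_superset:
  assumes "finite F" "keys p \<subseteq> F"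
  shows "subst c g p = (\<Sum>m\<in>F. c (lookup p m) * monom_val g m)"
  unfolding subst_def monom_val_def[symmetric]
  by (rule sum.mono_neutral_left) (use assms in \<open>auto simp: in_keys_iff\<close>)

lemma subst_0 [simp]: "subst c g 0 = 0"
  by (simp add: subst_def)

lemma subst_add [simp]: "subst c g (p + q) = subst c g p + subst c g q"
proof -
  have "keys (p + q) \<subseteq> keys p \<union> keys q" by (rule keys_add)
  then have "subst c g (p + q) = (\<Sum>m\<in>keys p \<union> keys q. c (lookup (p + q) m) * monom_val g m)"
    by (intro subst_superset) auto
  then show ?thesis
    by (simp add: subst_superset[of "keys p \<union> keys q"] lookup_add algebra_simps sum.distrib)
qed

lemma subst_sum: "subst c g (\<Sum>i\<in>I. f i) = (\<Sum>i\<in>I. subst c g (f i))"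
  by (induction I rule: infinite_finite_induct) simp_all

lemma subst_single: "subst c g (single m a) = c a * monom_val g m"
  by (subst subst_superset[of "{m}"]) simp_all

lemma subst_qconst [simp]: "subst c g (qconst a) = c a"
  by (simp add: qconst_def subst_single)

lemma subst_1 [simp]: "subst c g 1 = 1"
  using subst_qconst[of g 1] by (simp del: subst_qconst)

lemma subst_qvar [simp]: "subst c g (qvar v) = g v"
  unfolding qvar_def subst_single by simp

lemma subst_mult [simp]: "subst c g (p * q) = subst c g p * subst c g q"
proof (induction p rule: qpoly_single_induct)
  case (single m a)
  show ?case
  proof (induction q rule: qpoly_single_induct)
    case (single n b)
    show ?case by (simp add: mult_single subst_single monom_val_add mult_ac)
  qed (simp add: distrib_left)
qed (simp add: distrib_right)

lemma subst_power [simp]: "subst c g (p ^ n) = subst c g p ^ n"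
  by (induction n) simp_all

lemma subst_uminus [simp]: "subst c g (- p) = - subst c g p"
proof -
  have "subst c g (- p) + subst c g p = 0"
    by (simp flip: subst_add)
  then show ?thesis by (simp add: eq_neg_iff_add_eq_0)
qed

lemma subst_diff [simp]: "subst c g (p - q) = subst c g p - subst c g q"
  unfolding diff_conv_add_uminus subst_add subst_uminus ..

end

interpretation qconst: coeff_hom qconst
  by unfold_locales simp_all

interpretation rat_id: coeff_hom id
  by unfold_locales simp_all

lemma (in coeff_hom) subst_subst:
  "subst c g (subst qconst h p) = subst c (\<lambda>v. subst c g (h v)) p"
  by (induction p rule: qpoly_induct) simp_all

lemma subst_cong_indets:
  assumes "\<And>v. v \<in> indets p \<Longrightarrow> g v = h v"
  shows "subst c g p = subst c h p"
proof -
  have "monom_val g m = monom_val h m" if "m \<in> keys p" for m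
    unfolding monom_val_def
  proof (rule prod.cong)
    fix v assume "v \<in> keys m"
    then have "v \<in> indets p" using that by (auto simp: indets_def)
    then show "g v ^ lookup m v = h v ^ lookup m v" by (simp add: assms)
  qed simp
  then show ?thesis
    unfolding subst_def monom_val_def by (intro sum.cong) auto
qed

section \<open>Calculus in free commutative graded algebras\<close>

lemma cga_eqI: "(\<And>S. cf a S = cf b S) \<Longrightarrow> a = b"
  by (metis cf_inverse ext)

lemma cf_Cga [simp]: "cf (Cga f) = f"
  by (simp add: Cga_inverse)

lemma cf_0 [simp]: "cf 0 S = 0" and cf_1: "cf 1 S = (if S = {} then 1 else 0)"
  and cf_add [simp]: "cf (a + b) S = cf a S + cf b S"
  and cf_uminus [simp]: "cf (- a) S = - cf a S"
  and cf_diff [simp]: "cf (a - b) S = cf a S - cf b S"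
  and cf_mult: "cf (a * b) U = (\<Sum>S\<in>Pow U. koszul S (U - S) * cf a S * cf b (U - S))"
  by (transfer; simp)+

lemma cf_sum [simp]: "cf (\<Sum>i\<in>I. f i) S = (\<Sum>i\<in>I. cf (f i) S)"
  by (induction I rule: infinite_finite_induct) simp_all

lemma cf_even_emb: "cf (even_emb p) S = (if S = {} then p else 0)"
  and cf_odd_prod: "cf (odd_prod T) S = (if S = T then 1 else 0)"
  and cf_scal [simp]: "cf (scal c a) S = qconst c * cf a S"
  by (simp_all add: even_emb_def odd_prod_def scal_def)

lemma cf_even_emb_mult [simp]: "cf (even_emb p * a) S = p * cf a S"
proof -
  have "cf (even_emb p * a) S = (\<Sum>T\<in>Pow S. if T = {} then p * cf a S else 0)"
    unfolding cf_mult by (rule sum.cong) (auto simp: cf_even_emb)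
  then show ?thesis by (simp add: sum.delta)
qed

lemma cf_mult_even_emb [simp]: "cf (a * even_emb p) S = p * cf a S"
proof -
  have "cf (a * even_emb p) S = (\<Sum>T\<in>Pow S. if T = S then p * cf a S else 0)"
    unfolding cf_mult by (rule sum.cong) (auto simp: cf_even_emb)
  then show ?thesis by (simp add: sum.delta)
qed

lemma cf_mult_empty [simp]: "cf (a * b) {} = cf a {} * cf b {}"
  by (simp add: cf_mult)

lemma even_emb_commute: "a * even_emb p = even_emb p * a"
  by (rule cga_eqI) simp

lemma even_emb_hom [simp]:
  "even_emb 0 = 0" "even_emb 1 = 1" "even_emb (p + q) = even_emb p + even_emb q"
  "even_emb (p * q) = even_emb p * even_emb q" "even_emb (- p) = - even_emb p"
  "even_emb (p - q) = even_emb p - even_emb q"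
  by (rule cga_eqI; simp add: cf_even_emb cf_1)+

lemma even_emb_power [simp]: "even_emb (p ^ n) = even_emb p ^ n"
  by (induction n) simp_all

lemma even_emb_sum: "even_emb (\<Sum>i\<in>I. f i) = (\<Sum>i\<in>I. even_emb (f i))"
  by (induction I rule: infinite_finite_induct) simp_all

lemma even_emb_inject [simp]: "even_emb p = even_emb q \<longleftrightarrow> p = q"
  by (metis cf_even_emb)

lemma scal_even_emb: "scal c a = even_emb (qconst c) * a"
  by (rule cga_eqI) simp

lemma odd_prod_empty [simp]: "odd_prod {} = 1"
  by (rule cga_eqI) (simp add: cf_odd_prod cf_1)

text \<open>This reduces additive statements to terms \<open>p y\<^sub>S\<close>.\<close>

lemma cga_expand: "a = (\<Sum>S\<in>UNIV. even_emb (cf a S) * odd_prod S)"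
  for a :: "('e, 'o::{finite, linorder}) cga"
  by (rule cga_eqI) (simp add: cf_odd_prod if_distrib cong: if_cong)

lemma koszul_sing_left: "koszul {y} T = (- 1) ^ card {t \<in> T. t < y}"
proof -
  have "{(s, t) \<in> {y} \<times> T. t < s} = Pair y ` {t \<in> T. t < y}"
    by auto
  then show ?thesis
    by (simp add: koszul_def card_image inj_on_def)
qed

lemma odd_prod_mult:
  fixes S T :: "'o::{finite, linorder} set"
  shows "odd_prod S * odd_prod T =
    (if S \<inter> T = {} then even_emb (koszul S T) * odd_prod (S \<union> T) else 0 :: ('e, 'o) cga)"
proof (rule cga_eqI)
  fix U
  have "cf (odd_prod S * odd_prod T :: ('e, 'o) cga) U
      = (\<Sum>R\<in>Pow U. if R = S then (if U - S = T then koszul S T else 0) else 0)"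
    unfolding cf_mult by (rule sum.cong) (auto simp: cf_odd_prod)
  also have "\<dots> = (if S \<subseteq> U \<and> U - S = T then koszul S T else 0)"
    by (simp add: sum.delta)
  also have "S \<subseteq> U \<and> U - S = T \<longleftrightarrow> S \<inter> T = {} \<and> U = S \<union> T"
    by auto
  finally show "cf (odd_prod S * odd_prod T :: ('e, 'o) cga) U =
      cf (if S \<inter> T = {} then even_emb (koszul S T) * odd_prod (S \<union> T) else 0) U"
    by (simp add: cf_odd_prod)
qed

lemma ovar_odd_prod:
  fixes y :: "'o::{finite, linorder}"
  shows "ovar y * odd_prod S =
    (if y \<in> S then 0 else (- 1) ^ card {t \<in> S. t < y} * odd_prod (insert y S))"
  unfolding ovar_def odd_prod_mult koszul_sing_left by simp

lemma neg1_power_cancel: "(- 1) ^ n * ((- 1) ^ n * a) = (a :: 'a::ring_1)"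
  by (simp flip: mult.assoc power_add)

text \<open>\<open>\<Lambda>W\<close> is spanned by products of generators. Statements about products, such as the
  Leibniz rule, are thereby reduced to multiplication by one generator from the left.\<close>

lemma cga_induct [case_names const add evar ovar]:
  fixes a :: "('e, 'o::{finite, linorder}) cga"
  assumes const: "\<And>c. P (even_emb (qconst c))"
    and add: "\<And>a b. P a \<Longrightarrow> P b \<Longrightarrow> P (a + b)"
    and evar: "\<And>e a. P a \<Longrightarrow> P (evar e * a)"
    and ovar: "\<And>y a. P a \<Longrightarrow> P (ovar y * a)"
  shows "P a"
proof -
  have emb: "P (even_emb p)" for p
    by (induction p rule: qpoly_induct) (use const add evar in \<open>auto simp: evar_def\<close>)
  have prod: "P (even_emb p * odd_prod S)" for p S
    using finite[of S]
  proof (induction S arbitrary: p rule: finite_induct)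
    case (insert y S)
    let ?n = "card {t \<in> S. t < y}"
    have "ovar y * (even_emb ((- 1) ^ ?n * p) * odd_prod S)
        = even_emb ((- 1) ^ ?n * p) * (ovar y * odd_prod S)"
      by (simp only: even_emb_commute[of "ovar y"] flip: mult.assoc)
    also have "\<dots> = even_emb ((- 1) ^ ?n * p) * (even_emb ((- 1) ^ ?n) * odd_prod (insert y S))"
      using insert.hyps by (simp add: ovar_odd_prod)
    also have "\<dots> = even_emb ((- 1) ^ ?n * ((- 1) ^ ?n * p)) * odd_prod (insert y S)"
      by (subst mult.assoc[symmetric], subst even_emb_hom(4)[symmetric], simp only: mult_ac)
    also have "\<dots> = even_emb p * odd_prod (insert y S)"
      by (simp only: neg1_power_cancel)
    finally have "even_emb p * odd_prod (insert y S) = ovar y * (even_emb ((- 1) ^ ?n * p) * odd_prod S)" ..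
    with insert.IH show ?case by (simp add: ovar del: even_emb_hom)
  qed (simp add: emb)
  have "P (\<Sum>S\<in>F. even_emb (cf a S) * odd_prod S)" if "finite F" for F
    using that by induction (use const[of 0] add prod in simp_all)
  from this[of UNIV] show ?thesis
    by (simp flip: cga_expand)
qed

subsection \<open>Parity\<close>

text \<open>Parity counts odd generators and does not refer to degrees, so that it is available
  before any grading is chosen.\<close>

definition evenp :: "('e, 'o) cga \<Rightarrow> bool"
  where "evenp a \<longleftrightarrow> (\<forall>S. odd (card S) \<longrightarrow> cf a S = 0)"

definition oddp :: "('e, 'o) cga \<Rightarrow> bool"
  where "oddp a \<longleftrightarrow> (\<forall>S. even (card S) \<longrightarrow> cf a S = 0)"

text \<open>The parity involution \<open>a \<mapsto> (- 1)\<^bsup>|a|\<^esup> a\<close>, which is the sign in the graded Leibniz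
  rule.\<close>

definition invol :: "('e, 'o) cga \<Rightarrow> ('e, 'o) cga"
  where "invol a = Cga (\<lambda>S. (- 1) ^ card S * cf a S)"

text \<open>For disjoint \<open>S\<close> and \<open>T\<close> each pair is an inversion in exactly one of the two
  orders.\<close>

lemma koszul_swap:
  fixes S T :: "'o::{finite, linorder} set"
  assumes "S \<inter> T = {}"
  shows "koszul T S = (- 1) ^ (card S * card T) * (koszul S T :: 'a::comm_ring_1)"
proof -
  let ?A = "{(s, t) \<in> S \<times> T. t < s}" and ?B = "{(s, t) \<in> S \<times> T. s < t}"
  have ne: "s \<noteq> t" if "s \<in> S" "t \<in> T" for s t
    using assms that by blast
  have un: "S \<times> T = ?A \<union> ?B"
    using ne by (fastforce simp: neq_iff)
  have dis: "?A \<inter> ?B = {}"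
    by auto
  have "card (S \<times> T) = card ?A + card ?B"
    by (subst un, rule card_Un_disjoint[OF finite finite dis])
  then have 1: "card S * card T = card ?A + card ?B"
    by (simp only: card_cartesian_product)
  have "{(t, s) \<in> T \<times> S. s < t} = prod.swap ` ?B"
    by auto
  then have 2: "card {(t, s) \<in> T \<times> S. s < t} = card ?B"
    by (simp add: card_image)
  have "(- 1) ^ (card S * card T) * (koszul S T :: 'a) = (- 1) ^ (card ?A + card ?A + card ?B)"
    unfolding koszul_def 1 by (simp only: power_add mult_ac)
  also have "\<dots> = (- 1) ^ card ?B"
    by (simp add: power_add flip: mult_2 power_mult_distrib)
  finally show ?thesis
    unfolding koszul_def 2 ..
qed

lemma cf_mult_swap:
  fixes a b :: "('e, 'o::{finite, linorder}) cga"
  shows "cf (b * a) U =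
    (\<Sum>S\<in>Pow U. (- 1) ^ (card S * card (U - S)) * (koszul S (U - S) * cf a S * cf b (U - S)))"
proof -
  have "cf (b * a) U = (\<Sum>S\<in>Pow U. koszul (U - S) S * cf b (U - S) * cf a S)"
    unfolding cf_mult
    by (rule sum.reindex_bij_witness[where i = "\<lambda>S. U - S" and j = "\<lambda>S. U - S"])
      (auto simp: double_diff)
  also have "\<dots> = (\<Sum>S\<in>Pow U. (- 1) ^ (card S * card (U - S)) * (koszul S (U - S) * cf a S * cf b (U - S)))"
    by (rule sum.cong) (auto simp: koszul_swap[of _ "U - _"] mult_ac Int_Diff)
  finally show ?thesis .
qed

lemma evenp_commute:
  fixes a b :: "('e, 'o::{finite, linorder}) cga"
  assumes "evenp a"
  shows "b * a = a * b"
proof (rule cga_eqI)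
  fix U
  show "cf (b * a) U = cf (a * b) U"
    unfolding cf_mult_swap[of b a] cf_mult[of a b]
  proof (rule sum.cong)
    fix S assume "S \<in> Pow U"
    show "(- 1) ^ (card S * card (U - S)) * (koszul S (U - S) * cf a S * cf b (U - S)) =
        koszul S (U - S) * cf a S * cf b (U - S)"
      using assms by (cases "even (card S)") (auto simp: evenp_def)
  qed simp
qed

lemma oddp_anticommute:
  fixes a b :: "('e, 'o::{finite, linorder}) cga"
  assumes "oddp a" "oddp b"
  shows "b * a = - (a * b)"
proof (rule cga_eqI)
  fix U
  show "cf (b * a) U = cf (- (a * b)) U"
    unfolding cf_uminus cf_mult_swap[of b a] cf_mult[of a b] sum_negf[symmetric]
  proof (rule sum.cong)
    fix S assume "S \<in> Pow U"
    show "(- 1) ^ (card S * card (U - S)) * (koszul S (U - S) * cf a S * cf b (U - S)) =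
        - (koszul S (U - S) * cf a S * cf b (U - S))"
      using assms
      by (cases "even (card S)"; cases "even (card (U - S))") (auto simp: oddp_def)
  qed simp
qed

text \<open>Anticommutativity gives \<open>2 a\<^sup>2 = 0\<close>, and there is no torsion over the rationals.\<close>

lemma oddp_square:
  fixes a :: "('e, 'o::{finite, linorder}) cga"
  assumes "oddp a"
  shows "a * a = 0"
proof (rule cga_eqI, rule poly_mapping_eqI)
  fix S m
  have "cf (a * a) S = - cf (a * a) S"
    using oddp_anticommute[OF assms assms] by (metis cf_uminus)
  then have "lookup (cf (a * a) S) m = - lookup (cf (a * a) S) m"
    by (metis lookup_uminus)
  then show "lookup (cf (a * a) S) m = lookup (cf 0 S) m" by simp
qed

lemma oddp_0 [simp]: "oddp 0" and evenp_0 [simp]: "evenp 0"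
  and oddp_even_emb_mult: "oddp a \<Longrightarrow> oddp (even_emb p * a)"
  by (simp_all add: oddp_def evenp_def)

lemma evenp_even_emb [simp]: "evenp (even_emb p)"
  by (auto simp: evenp_def cf_even_emb)

lemma oddp_ovar [simp]: "oddp (ovar y)"
  by (auto simp: oddp_def ovar_def cf_odd_prod)

lemma oddp_sum: "(\<And>i. i \<in> I \<Longrightarrow> oddp (f i)) \<Longrightarrow> oddp (\<Sum>i\<in>I. f i)"
  by (simp add: oddp_def)

lemma card_Diff_Pow: "S \<in> Pow U \<Longrightarrow> card (U :: 'o::finite set) = card S + card (U - S)"
  by (metis Pow_iff card_Diff_subset card_mono finite le_add_diff_inverse)

lemma cf_invol [simp]: "cf (invol a) S = (- 1) ^ card S * cf a S"
  by (simp add: invol_def)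

lemma invol_add: "invol (a + b) = invol a + invol b"
  by (rule cga_eqI) (simp add: algebra_simps)

lemma invol_even_emb_mult: "invol (even_emb p * a) = even_emb p * invol a"
  by (rule cga_eqI) (simp add: mult_ac)

lemma invol_evenp: "evenp a \<Longrightarrow> invol a = a"
proof (rule cga_eqI)
  fix S assume "evenp a"
  then show "cf (invol a) S = cf a S"
    by (cases "even (card S)") (auto simp: evenp_def)
qed

lemma invol_oddp: "oddp a \<Longrightarrow> invol a = - a"
proof (rule cga_eqI)
  fix S assume "oddp a"
  then show "cf (invol a) S = cf (- a) S"
    by (cases "even (card S)") (auto simp: oddp_def)
qed

lemma invol_mult_oddp:
  fixes a b :: "('e, 'o::{finite, linorder}) cga"
  assumes "oddp a"
  shows "invol (a * b) = - (a * invol b)"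
proof (rule cga_eqI)
  fix U
  have "(- 1) ^ card U * (koszul S (U - S) * cf a S * cf b (U - S))
      = - (koszul S (U - S) * cf a S * ((- 1) ^ card (U - S) * cf b (U - S)))"
    if "S \<in> Pow U" for S
    using assms unfolding card_Diff_Pow[OF that] oddp_def
    by (cases "even (card S)"; cases "even (card (U - S))") auto
  then show "cf (invol (a * b)) U = cf (- (a * invol b)) U"
    unfolding cf_invol cf_uminus cf_mult sum_distrib_left sum_negf[symmetric]
    by (intro sum.cong refl)
qed

section \<open>The differential is a derivation\<close>

text \<open>For the Leibniz rule the values of \<open>d\<close> on the generators only need the right parity.\<close>

locale parity_cdga =
  fixes A :: "('e::finite, 'o::{finite, linorder}) free_cdga"
  assumes oddp_ediff: "oddp (ediff A e)" and evenp_odiff: "evenp (odiff A y)"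
begin

definition dpoly :: "'e qpoly \<Rightarrow> ('e, 'o) cga"
  where "dpoly p = (\<Sum>e\<in>UNIV. even_emb (pdiff e p) * ediff A e)"

definition dodd :: "'o set \<Rightarrow> ('e, 'o) cga"
  where "dodd S = (\<Sum>y\<in>S. (- 1) ^ card {s \<in> S. s < y} * (odiff A y * odd_prod (S - {y})))"

lemma dpoly_0 [simp]: "dpoly 0 = 0" and dpoly_1 [simp]: "dpoly 1 = 0"
  and dpoly_qconst [simp]: "dpoly (qconst c) = 0"
  and dpoly_add: "dpoly (p + q) = dpoly p + dpoly q"
  by (simp_all add: dpoly_def distrib_right sum.distrib)

lemma dpoly_mult: "dpoly (p * q) = dpoly p * even_emb q + even_emb p * dpoly q"
proof -
  have "even_emb (pdiff e (p * q)) * ediff A e =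
      even_emb (pdiff e p) * ediff A e * even_emb q + even_emb p * (even_emb (pdiff e q) * ediff A e)" for e
    by (rule cga_eqI) (simp add: pdiff_mult algebra_simps)
  then show ?thesis
    by (simp add: dpoly_def sum.distrib sum_distrib_left sum_distrib_right)
qed

lemma oddp_dpoly: "oddp (dpoly p)"
  unfolding dpoly_def by (intro oddp_sum oddp_even_emb_mult oddp_ediff)

text \<open>An even \<open>d(y)\<close> is central and can be moved to the front.\<close>

lemma dodd_term:
  assumes "y \<in> S"
  shows "odd_prod {s \<in> S. s < y} * odiff A y * odd_prod {s \<in> S. y < s} = odiff A y * odd_prod (S - {y})"
proof -
  let ?L = "{s \<in> S. s < y}" and ?R = "{s \<in> S. y < s}"
  have e: "{(s, t) \<in> ?L \<times> ?R. t < s} = {}" by auto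
  have "koszul ?L ?R = (1 :: 'e qpoly)"
    unfolding koszul_def e by simp
  moreover have "?L \<inter> ?R = {}" by auto
  moreover have "?L \<union> ?R = S - {y}" by auto
  ultimately have "odd_prod ?L * odd_prod ?R = (odd_prod (S - {y}) :: ('e, 'o) cga)"
    by (simp add: odd_prod_mult)
  then show ?thesis
    by (simp add: evenp_commute[OF evenp_odiff] mult.assoc)
qed

lemma cdiff_expand:
  "cdiff A a = (\<Sum>S\<in>UNIV. dpoly (cf a S) * odd_prod S + even_emb (cf a S) * dodd S)"
proof -
  have "(\<Sum>e\<in>indets p. even_emb (pdiff e p) * ediff A e) = dpoly p" for p
    unfolding dpoly_def
    by (rule sum.mono_neutral_left) (auto simp: pdiff_notin_indets)
  moreover have "(\<Sum>y\<in>S. (- 1) ^ card {s \<in> S. s < y} *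
      (odd_prod {s \<in> S. s < y} * odiff A y * odd_prod {s \<in> S. y < s})) = dodd S" for S
    unfolding dodd_def by (rule sum.cong) (simp_all add: dodd_term)
  ultimately show ?thesis
    by (simp add: cdiff_def)
qed

lemma cdiff_add: "cdiff A (a + b) = cdiff A a + cdiff A b"
  unfolding cdiff_expand sum.distrib[symmetric]
  by (rule sum.cong) (simp_all add: dpoly_add algebra_simps)

lemma cdiff_0 [simp]: "cdiff A 0 = 0"
  unfolding cdiff_expand by simp

lemma cdiff_uminus: "cdiff A (- a) = - cdiff A a"
  using cdiff_add[of "- a" a] by (simp add: eq_neg_iff_add_eq_0)

lemma cdiff_diff: "cdiff A (a - b) = cdiff A a - cdiff A b"
  using cdiff_add[of a "- b"] by (simp add: cdiff_uminus)

lemma cdiff_sum: "cdiff A (\<Sum>i\<in>I. f i) = (\<Sum>i\<in>I. cdiff A (f i))"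
  by (induction I rule: infinite_finite_induct) (simp_all add: cdiff_add)

lemma cdiff_even_emb: "cdiff A (even_emb p) = dpoly p"
proof -
  have "cdiff A (even_emb p) = (\<Sum>S\<in>(UNIV :: 'o set set). if S = {} then dpoly p else 0)"
    unfolding cdiff_expand by (rule sum.cong) (simp_all add: cf_even_emb dodd_def)
  then show ?thesis by simp
qed

lemma cdiff_odd_prod: "cdiff A (odd_prod S) = dodd S"
proof -
  have "cdiff A (odd_prod S) = (\<Sum>T\<in>UNIV. if T = S then dodd S else 0)"
    unfolding cdiff_expand by (rule sum.cong) (auto simp add: cf_odd_prod)
  then show ?thesis by simp
qed

lemma cdiff_evar: "cdiff A (evar e) = ediff A e"
proof -
  have "cdiff A (evar e) = (\<Sum>e'\<in>UNIV. if e' = e then ediff A e else 0)"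
    unfolding evar_def cdiff_even_emb dpoly_def by (rule sum.cong) auto
  then show ?thesis by simp
qed

lemma cdiff_ovar: "cdiff A (ovar y) = odiff A y"
proof -
  have e: "{s. s = y \<and> s < y} = {}" by auto
  show ?thesis
    by (simp add: ovar_def cdiff_odd_prod dodd_def e)
qed

lemma cdiff_even_emb_mult: "cdiff A (even_emb p * a) = dpoly p * a + even_emb p * cdiff A a"
proof -
  have "cdiff A (even_emb p * a) = (\<Sum>S\<in>UNIV. dpoly p * (even_emb (cf a S) * odd_prod S)
      + even_emb p * (dpoly (cf a S) * odd_prod S + even_emb (cf a S) * dodd S))"
    unfolding cdiff_expand
    by (rule sum.cong) (simp_all add: dpoly_mult algebra_simps)
  also have "\<dots> = dpoly p * (\<Sum>S\<in>UNIV. even_emb (cf a S) * odd_prod S) + even_emb p * cdiff A a"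
    unfolding cdiff_expand[of a] sum_distrib_left by (rule sum.distrib)
  finally show ?thesis
    by (simp flip: cga_expand)
qed

lemma card_less_insert:
  fixes y s :: 'o
  assumes "y \<notin> S"
  shows "card {t \<in> insert y S. t < s} = card {t \<in> S. t < s} + (if y < s then 1 else 0)"
proof -
  have "{t \<in> insert y S. t < s} = (if y < s then insert y {t \<in> S. t < s} else {t \<in> S. t < s})"
    by auto
  then show ?thesis using assms by simp
qed

text \<open>If \<open>y \<in> S\<close>, the left side is \<open>d 0\<close>, and on the right only the summand that
  differentiates \<open>y\<close> survives multiplication by \<open>y\<close>; it cancels against \<open>d(y) y\<^sub>S\<close>. If
  \<open>y \<notin> S\<close>, inserting \<open>y\<close> changes, for each \<open>s \<in> S\<close>, exactly one of two sign exponents: the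
  number of generators before \<open>s\<close> if \<open>y < s\<close>, and the number of generators before \<open>y\<close> that
  remain after removing \<open>s\<close> if \<open>s < y\<close>.\<close>

lemma cdiff_ovar_odd_prod:
  "cdiff A (ovar y * odd_prod S) = odiff A y * odd_prod S - ovar y * dodd S"
proof -
  have swap: "ovar y * ((- 1) ^ n * (odiff A s * x)) = (- 1) ^ n * (odiff A s * (ovar y * x))" for n s x
  proof -
    have "ovar y * (odiff A s * x) = odiff A s * (ovar y * x)"
      by (metis evenp_commute evenp_odiff mult.assoc)
    then show ?thesis by (cases "even n") simp_all
  qed
  have "ovar y * dodd S = (\<Sum>s\<in>S. ovar y * ((- 1) ^ card {t \<in> S. t < s} * (odiff A s * odd_prod (S - {s}))))"
    by (simp only: dodd_def sum_distrib_left)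
  also have "\<dots> = (\<Sum>s\<in>S. (- 1) ^ card {t \<in> S. t < s} * (odiff A s * (ovar y * odd_prod (S - {s}))))"
    by (simp only: swap)
  finally have right: "ovar y * dodd S =
      (\<Sum>s\<in>S. (- 1) ^ card {t \<in> S. t < s} * (odiff A s * (ovar y * odd_prod (S - {s}))))" .
  show ?thesis
  proof (cases "y \<in> S")
    case True
    have "(- 1) ^ card {t \<in> S. t < s} * (odiff A s * (ovar y * odd_prod (S - {s})))
        = (if s = y then odiff A y * odd_prod S else 0)" if "s \<in> S" for s
    proof (cases "s = y")
      case sy: True
      have "{t \<in> S - {y}. t < y} = {t \<in> S. t < y}" by auto
      then show ?thesis
        using that sy by (simp add: ovar_odd_prod insert_absorb minus_one_power_iff)
    next
      case False
      then show ?thesis using True by (simp add: ovar_odd_prod)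
    qed
    then have "ovar y * dodd S = (\<Sum>s\<in>S. if s = y then odiff A y * odd_prod S else 0)"
      unfolding right by (rule sum.cong[OF refl])
    then have "ovar y * dodd S = odiff A y * odd_prod S"
      using True by simp
    then show ?thesis using True by (simp add: ovar_odd_prod)
  next
    case False
    let ?n = "card {t \<in> S. t < y}"
    have fy: "{t \<in> insert y S. t < y} = {t \<in> S. t < y}" by auto
    have summand: "(- 1) ^ ?n * ((- 1) ^ card {t \<in> insert y S. t < s} * (odiff A s * odd_prod (insert y S - {s})))
        = - ((- 1) ^ card {t \<in> S. t < s} * (odiff A s * (ovar y * odd_prod (S - {s}))))"
      if s: "s \<in> S" for s
    proof -
      have sy: "s \<noteq> y" using s False by auto
      have ins: "insert y S - {s} = insert y (S - {s})" using sy by auto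
      have "card {t \<in> insert s (S - {s}). t < y} = card {t \<in> S - {s}. t < y} + (if s < y then 1 else 0)"
        by (rule card_less_insert) simp
      then have n: "?n = card {t \<in> S - {s}. t < y} + (if s < y then 1 else 0)"
        using s by (simp add: insert_absorb)
      show ?thesis
        unfolding ins card_less_insert[OF False] n
        using False sy by (auto simp: ovar_odd_prod minus_one_power_iff)
    qed
    have "cdiff A (ovar y * odd_prod S) = (- 1) ^ ?n * dodd (insert y S)"
      using False by (simp add: ovar_odd_prod minus_one_power_iff cdiff_uminus cdiff_odd_prod)
    also have "dodd (insert y S) = (- 1) ^ ?n * (odiff A y * odd_prod S)
        + (\<Sum>s\<in>S. (- 1) ^ card {t \<in> insert y S. t < s} * (odiff A s * odd_prod (insert y S - {s})))"
      unfolding dodd_def by (subst sum.insert) (use False fy in auto)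
    also have "(- 1) ^ ?n * \<dots> = odiff A y * odd_prod S +
       (\<Sum>s\<in>S. (- 1) ^ ?n * ((- 1) ^ card {t \<in> insert y S. t < s} * (odiff A s * odd_prod (insert y S - {s}))))"
      by (simp only: distrib_left sum_distrib_left neg1_power_cancel)
    also have "\<dots> = odiff A y * odd_prod S - ovar y * dodd S"
      unfolding right diff_conv_add_uminus sum_negf[symmetric]
      by (intro arg_cong2[where f = "(+)"] sum.cong summand refl)
    finally show ?thesis .
  qed
qed

lemma cdiff_ovar_mult: "cdiff A (ovar y * a) = odiff A y * a - ovar y * cdiff A a"
proof -
  have one: "cdiff A (ovar y * (even_emb p * odd_prod S)) =
      odiff A y * (even_emb p * odd_prod S) - ovar y * cdiff A (even_emb p * odd_prod S)" for p S
  proof -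
    have c: "x * (even_emb p * z) = even_emb p * (x * z)" for x z :: "('e, 'o) cga"
      by (simp only: even_emb_commute flip: mult.assoc)
    have "dpoly p * ovar y = - (ovar y * dpoly p)"
      by (rule oddp_anticommute[OF oddp_ovar oddp_dpoly])
    then have "dpoly p * (ovar y * odd_prod S) = - (ovar y * (dpoly p * odd_prod S))"
      by (simp flip: mult.assoc)
    then show ?thesis
      unfolding c cdiff_even_emb_mult cdiff_ovar_odd_prod cdiff_odd_prod
      by (simp add: right_diff_distrib distrib_left c)
  qed
  have "cdiff A (ovar y * (\<Sum>S\<in>UNIV. even_emb (cf a S) * odd_prod S)) =
      odiff A y * (\<Sum>S\<in>UNIV. even_emb (cf a S) * odd_prod S)
      - ovar y * cdiff A (\<Sum>S\<in>UNIV. even_emb (cf a S) * odd_prod S)"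
    by (simp only: sum_distrib_left cdiff_sum one sum_subtractf)
  then show ?thesis
    by (simp flip: cga_expand)
qed

theorem cdiff_mult: "cdiff A (a * b) = cdiff A a * b + invol a * cdiff A b"
proof (induction a rule: cga_induct)
  case (const c)
  show ?case by (simp add: cdiff_even_emb_mult cdiff_even_emb invol_evenp)
next
  case (add a a')
  then show ?case by (simp add: cdiff_add invol_add algebra_simps)
next
  case (evar e a)
  then show ?case
    by (simp add: evar_def mult.assoc cdiff_even_emb_mult invol_even_emb_mult distrib_left distrib_right add.assoc)
next
  case (ovar y a)
  have "cdiff A (ovar y * a * b) = odiff A y * (a * b) - ovar y * (cdiff A a * b + invol a * cdiff A b)"
    by (simp add: mult.assoc cdiff_ovar_mult ovar)
  also have "\<dots> = (odiff A y * a - ovar y * cdiff A a) * b + (- (ovar y * invol a)) * cdiff A b"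
    by (simp add: algebra_simps)
  also have "\<dots> = cdiff A (ovar y * a) * b + invol (ovar y * a) * cdiff A b"
    by (simp add: cdiff_ovar_mult invol_mult_oddp)
  finally show ?case .
qed

end

section \<open>Homomorphisms of free algebras\<close>

text \<open>Homomorphisms of graded algebras, leaving aside degrees and differentials.\<close>

locale alg_hom =
  fixes \<phi> :: "('e, 'o::{finite, linorder}) cga \<Rightarrow> ('f, 'p::{finite, linorder}) cga"
  assumes add: "\<phi> (a + b) = \<phi> a + \<phi> b"
    and scal: "\<phi> (scal c a) = scal c (\<phi> a)"
    and mult: "\<phi> (a * b) = \<phi> a * \<phi> b"
    and one: "\<phi> 1 = 1"
begin

lemma zero: "\<phi> 0 = 0"
  using add[of 0 0] by simp

lemma uminus: "\<phi> (- a) = - \<phi> a"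
  using add[of "- a" a] by (simp add: eq_neg_iff_add_eq_0 zero)

lemma diff: "\<phi> (a - b) = \<phi> a - \<phi> b"
  using add[of a "- b"] by (simp add: uminus)

lemma power: "\<phi> (a ^ n) = \<phi> a ^ n"
  by (induction n) (simp_all add: one mult)

lemma sum: "\<phi> (\<Sum>i\<in>I. f i) = (\<Sum>i\<in>I. \<phi> (f i))"
  by (induction I rule: infinite_finite_induct) (simp_all add: zero add)

lemma const: "\<phi> (even_emb (qconst c)) = even_emb (qconst c)"
  using scal[of c 1] by (simp add: scal_even_emb one)

lemma even_emb:
  assumes "\<And>e. \<phi> (evar e) = even_emb (g e)"
  shows "\<phi> (even_emb p) = even_emb (subst qconst g p)"
  by (induction p rule: qpoly_induct)
    (simp_all add: const add mult assms flip: evar_def)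

lemmas hom = zero uminus diff power sum one add mult

end

lemma cdga_hom_iff:
  "cdga_hom A B \<phi> \<longleftrightarrow> alg_hom \<phi> \<and> (\<forall>i a. homogeneous A i a \<longrightarrow> homogeneous B i (\<phi> a)) \<and>
    (\<forall>a. \<phi> (cdiff A a) = cdiff B (\<phi> a))"
  unfolding cdga_hom_def alg_hom_def by auto

lemma alg_hom_comp: "alg_hom \<phi> \<Longrightarrow> alg_hom \<psi> \<Longrightarrow> alg_hom (\<psi> \<circ> \<phi>)"
  unfolding alg_hom_def by simp

lemma alg_hom_eqI:
  assumes "alg_hom \<phi>" "alg_hom \<psi>"
    and "\<And>e. \<phi> (evar e) = \<psi> (evar e)" and "\<And>y. \<phi> (ovar y) = \<psi> (ovar y)"
  shows "\<phi> = \<psi>"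
proof
  interpret \<phi>: alg_hom \<phi> by fact
  interpret \<psi>: alg_hom \<psi> by fact
  show "\<phi> a = \<psi> a" for a
    by (induction a rule: cga_induct)
      (simp_all add: \<phi>.const \<psi>.const \<phi>.add \<psi>.add \<phi>.mult \<psi>.mult assms)
qed

lemma alg_hom_chainI:
  assumes A: "parity_cdga A" and B: "parity_cdga B" and \<phi>: "alg_hom \<phi>"
    and even: "\<And>e. evenp (\<phi> (evar e))" and odd: "\<And>y. oddp (\<phi> (ovar y))"
    and de: "\<And>e. \<phi> (ediff A e) = cdiff B (\<phi> (evar e))"
    and dy: "\<And>y. \<phi> (odiff A y) = cdiff B (\<phi> (ovar y))"
  shows "\<phi> (cdiff A a) = cdiff B (\<phi> a)"
proof -
  interpret A: parity_cdga A by fact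
  interpret B: parity_cdga B by fact
  interpret \<phi>: alg_hom \<phi> by fact
  show ?thesis
  proof (induction a rule: cga_induct)
    case (const c)
    show ?case by (simp add: A.cdiff_even_emb B.cdiff_even_emb \<phi>.const \<phi>.zero)
  next
    case (add a b)
    then show ?case by (simp add: A.cdiff_add B.cdiff_add \<phi>.add)
  next
    case (evar e a)
    then show ?case
      by (simp add: A.cdiff_mult B.cdiff_mult \<phi>.add \<phi>.mult A.cdiff_evar de
          invol_evenp even evar_def[of e, symmetric])
        (simp add: evar_def invol_evenp \<phi>.mult)
  next
    case (ovar y a)
    then show ?case
      by (simp add: A.cdiff_mult B.cdiff_mult \<phi>.add \<phi>.mult \<phi>.diff A.cdiff_ovar dy invol_oddp odd)
  qed
qed

subsection \<open>The universal property\<close>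

text \<open>The images of the even generators are taken to be polynomials, that is, free of odd
  generators, so that the coefficients can be substituted inside a commutative ring. The images of
  the odd generators are odd and anticommute, so the product over a set of generators is taken in
  increasing order.\<close>

definition oprod :: "('o::linorder \<Rightarrow> 'a::monoid_mult) \<Rightarrow> 'o set \<Rightarrow> 'a"
  where "oprod h S = prod_list (map h (sorted_list_of_set S))"

definition ext_hom ::
  "('e \<Rightarrow> 'f qpoly) \<Rightarrow> ('o \<Rightarrow> ('f, 'p) cga) \<Rightarrow> ('e, 'o::{finite, linorder}) cga \<Rightarrow> ('f, 'p::{finite, linorder}) cga"
  where "ext_hom g h a = (\<Sum>S\<in>UNIV. even_emb (subst qconst g (cf a S)) * oprod h S)"

text \<open>Each exchange in the insertion of \<open>y\<close> contributes a sign, so the insertion produces the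
  sign of \<open>ovar_odd_prod\<close>.\<close>

lemma oddp_mult_insort:
  fixes h :: "'o::linorder \<Rightarrow> ('f, 'p::{finite, linorder}) cga"
  assumes h: "\<And>y. oddp (h y)" and "sorted xs"
  shows "h y * prod_list (map h xs) =
    (if y \<in> set xs then 0 else (- 1) ^ length (filter (\<lambda>t. t < y) xs) * prod_list (map h (insort y xs)))"
  using assms(2)
proof (induction xs)
  case (Cons x xs)
  have anti: "h y * (h x * P) = - (h x * (h y * P))" for P
    using oddp_anticommute[OF h[of x] h[of y]] by (simp flip: mult.assoc)
  have sq: "h x * (h x * P) = 0" for P
    using oddp_square[OF h[of x]] by (simp flip: mult.assoc)
  consider "y = x" | "y < x" | "x < y" by (rule linorder_cases)
  then show ?case
  proof cases
    case 2
    then have "\<forall>t\<in>set (x # xs). y < t" using Cons.prems by auto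
    then have "y \<notin> set (x # xs)" "filter (\<lambda>t. t < y) (x # xs) = []"
      by (auto simp: filter_empty_conv)
    then show ?thesis using 2 by (simp add: less_imp_le)
  next
    case 3
    then show ?thesis
      using Cons by (auto simp: anti minus_one_power_iff)
  qed (simp add: sq)
qed simp

lemma ovar_oprod:
  fixes h :: "'o::{finite, linorder} \<Rightarrow> ('f, 'p::{finite, linorder}) cga"
  assumes h: "\<And>y. oddp (h y)"
  shows "h y * oprod h S = (if y \<in> S then 0 else (- 1) ^ card {t \<in> S. t < y} * oprod h (insert y S))"
proof -
  have "length (filter (\<lambda>t. t < y) (sorted_list_of_set S)) = card {t \<in> S. t < y}"
    using distinct_card[of "filter (\<lambda>t. t < y) (sorted_list_of_set S)"] by simp
  then show ?thesis
    using oddp_mult_insort[where h = h and y = y and xs = "sorted_list_of_set S"] h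
    by (simp add: oprod_def)
qed

context
  fixes g :: "'e \<Rightarrow> 'f qpoly" and h :: "'o::{finite, linorder} \<Rightarrow> ('f, 'p::{finite, linorder}) cga"
  assumes h: "\<And>y. oddp (h y)"
begin

lemma ext_hom_add: "ext_hom g h (a + b) = ext_hom g h a + ext_hom g h b"
  by (simp add: ext_hom_def algebra_simps sum.distrib)

lemma ext_hom_sum: "ext_hom g h (\<Sum>i\<in>I. f i) = (\<Sum>i\<in>I. ext_hom g h (f i))"
proof (induction I rule: infinite_finite_induct)
  case (insert i I)
  then show ?case by (simp add: ext_hom_add)
qed (simp_all add: ext_hom_def)

lemma ext_hom_even_emb_mult: "ext_hom g h (even_emb p * a) = even_emb (subst qconst g p) * ext_hom g h a"
  by (simp add: ext_hom_def sum_distrib_left mult.assoc)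

lemma ext_hom_odd_prod: "ext_hom g h (odd_prod S) = oprod h S"
proof -
  have "ext_hom g h (odd_prod S) = (\<Sum>T\<in>UNIV. if T = S then oprod h S else 0)"
    unfolding ext_hom_def by (rule sum.cong) (auto simp: cf_odd_prod)
  then show ?thesis by simp
qed

lemma ext_hom_one: "ext_hom g h 1 = 1"
  using ext_hom_odd_prod[of "{}"] by (simp add: oprod_def)

lemma ext_hom_even_emb: "ext_hom g h (even_emb p) = even_emb (subst qconst g p)"
  using ext_hom_even_emb_mult[of p 1] by (simp add: ext_hom_one)

lemma ext_hom_evar: "ext_hom g h (evar e) = even_emb (g e)"
  by (simp add: evar_def ext_hom_even_emb)

lemma ext_hom_ovar: "ext_hom g h (ovar y) = h y"
  by (simp add: ovar_def ext_hom_odd_prod oprod_def)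

lemma ext_hom_ovar_mult: "ext_hom g h (ovar y * a) = h y * ext_hom g h a"
proof -
  have one: "ext_hom g h (ovar y * (even_emb p * odd_prod S)) = h y * ext_hom g h (even_emb p * odd_prod S)" for p S
  proof -
    have "ext_hom g h (ovar y * odd_prod S) = h y * oprod h S"
      unfolding ovar_odd_prod ovar_oprod[where h = h, OF h]
      using ext_hom_even_emb_mult[of "(- 1) ^ card {t \<in> S. t < y}" "odd_prod (insert y S)"]
        ext_hom_sum[of "\<lambda>_. 0" "{}"]
      by (simp add: ext_hom_odd_prod)
    moreover have "ovar y * (even_emb p * odd_prod S) = even_emb p * (ovar y * odd_prod S)"
      by (simp only: even_emb_commute flip: mult.assoc)
    moreover have "h y * (even_emb (subst qconst g p) * oprod h S) = even_emb (subst qconst g p) * (h y * oprod h S)"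
      by (simp only: even_emb_commute flip: mult.assoc)
    ultimately show ?thesis
      by (simp add: ext_hom_even_emb_mult ext_hom_odd_prod)
  qed
  have "ext_hom g h (ovar y * (\<Sum>S\<in>UNIV. even_emb (cf a S) * odd_prod S))
      = h y * ext_hom g h (\<Sum>S\<in>UNIV. even_emb (cf a S) * odd_prod S)"
    by (simp only: sum_distrib_left ext_hom_sum one)
  then show ?thesis by (simp flip: cga_expand)
qed

lemma alg_hom_ext_hom: "alg_hom (ext_hom g h)"
proof
  show "ext_hom g h (a * b) = ext_hom g h a * ext_hom g h b" for a b
    by (induction a rule: cga_induct)
      (simp_all add: ext_hom_even_emb_mult ext_hom_even_emb distrib_right ext_hom_add
        evar_def mult.assoc ext_hom_ovar_mult)
qed (simp_all add: ext_hom_add ext_hom_one scal_even_emb ext_hom_even_emb_mult)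

end

section \<open>Degrees\<close>

definition mon_deg :: "('e, 'o) free_cdga \<Rightarrow> ('e \<Rightarrow>\<^sub>0 nat) \<Rightarrow> int"
  where "mon_deg A m = (\<Sum>e\<in>keys m. int (lookup m e) * edeg A e)"

definition odd_deg :: "('e, 'o) free_cdga \<Rightarrow> 'o set \<Rightarrow> int"
  where "odd_deg A S = (\<Sum>y\<in>S. odeg A y)"

lemma homogeneous_iff:
  "homogeneous A i a \<longleftrightarrow> (\<forall>S. \<forall>m\<in>keys (cf a S). mon_deg A m + odd_deg A S = i)"
  by (simp add: homogeneous_def mon_deg_def odd_deg_def)

lemma mon_deg_superset:
  assumes "finite F" "keys m \<subseteq> F"
  shows "mon_deg A m = (\<Sum>e\<in>F. int (lookup m e) * edeg A e)"
  unfolding mon_deg_def by (rule sum.mono_neutral_left) (use assms in \<open>auto simp: in_keys_iff\<close>)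

lemma mon_deg_add: "mon_deg A (m + n) = mon_deg A m + mon_deg A n"
proof -
  have "keys (m + n) \<subseteq> keys m \<union> keys n" by (rule keys_add)
  then have "mon_deg A (m + n) = (\<Sum>e\<in>keys m \<union> keys n. int (lookup (m + n) e) * edeg A e)"
    by (intro mon_deg_superset) auto
  then show ?thesis
    by (simp add: mon_deg_superset[of "keys m \<union> keys n"] lookup_add algebra_simps sum.distrib)
qed

lemma mon_deg_0 [simp]: "mon_deg A 0 = 0"
  by (simp add: mon_deg_def)

lemma mon_deg_single [simp]: "mon_deg A (single e n) = int n * edeg A e"
  by (cases n) (simp_all add: mon_deg_def)

lemma homogeneous_0 [simp]: "homogeneous A i 0"
  by (simp add: homogeneous_iff)

lemma homogeneous_add:
  assumes "homogeneous A i a" "homogeneous A i b"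
  shows "homogeneous A i (a + b)"
  using assms Poly_Mapping.keys_add[of "cf a _" "cf b _"] unfolding homogeneous_iff cf_add by blast

lemma homogeneous_sum:
  "(\<And>j. j \<in> I \<Longrightarrow> homogeneous A i (f j)) \<Longrightarrow> homogeneous A i (\<Sum>j\<in>I. f j)"
  by (induction I rule: infinite_finite_induct) (simp_all add: homogeneous_add)

lemma homogeneous_uminus: "homogeneous A i a \<Longrightarrow> homogeneous A i (- a)"
  by (simp add: homogeneous_iff)

lemma homogeneous_diff:
  "homogeneous A i a \<Longrightarrow> homogeneous A i b \<Longrightarrow> homogeneous A i (a - b)"
  unfolding diff_conv_add_uminus by (intro homogeneous_add homogeneous_uminus)

lemma homogeneous_mult:
  fixes a b :: "('e, 'o::{finite, linorder}) cga"
  assumes "homogeneous A i a" "homogeneous A j b"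
  shows "homogeneous A (i + j) (a * b)"
  unfolding homogeneous_iff
proof (intro allI ballI)
  fix U m
  assume "m \<in> keys (cf (a * b) U)"
  then obtain S where S: "S \<subseteq> U" "m \<in> keys (koszul S (U - S) * cf a S * cf b (U - S))"
    using keys_sum[of "\<lambda>S. koszul S (U - S) * cf a S * cf b (U - S)" "Pow U"] unfolding cf_mult by blast
  have "keys (koszul S (U - S) * cf a S * cf b (U - S)) = keys (cf a S * cf b (U - S))"
    by (simp add: koszul_def minus_one_power_iff)
  then obtain m1 m2 where m: "m = m1 + m2" "m1 \<in> keys (cf a S)" "m2 \<in> keys (cf b (U - S))"
    using S(2) keys_mult[of "cf a S" "cf b (U - S)"] by auto
  have "odd_deg A U = odd_deg A S + odd_deg A (U - S)"
    unfolding odd_deg_def using sum.subset_diff[OF S(1) finite, of "odeg A"] by simp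
  then show "mon_deg A m + odd_deg A U = i + j"
    using assms m unfolding homogeneous_iff by (force simp: mon_deg_add)
qed

lemma homogeneous_even_emb:
  "homogeneous A i (even_emb p) \<longleftrightarrow> (\<forall>m\<in>keys p. mon_deg A m = i)"
  by (auto simp: homogeneous_iff cf_even_emb odd_deg_def)

lemma homogeneous_1 [simp]: "homogeneous A 0 1"
  using homogeneous_even_emb[of A 0 1] by simp

lemma homogeneous_qconst [simp]: "homogeneous A 0 (even_emb (qconst c))"
  by (simp add: homogeneous_even_emb qconst_def)

lemma homogeneous_even_emb_qconst_mult:
  fixes a :: "('e, 'o::{finite, linorder}) cga"
  shows "homogeneous A i a \<Longrightarrow> homogeneous A i (even_emb (qconst c) * a)"
  using homogeneous_mult[OF homogeneous_qconst, of A i a c] by simp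

lemma homogeneous_evar: "homogeneous A (edeg A e) (evar e)"
  by (simp add: evar_def homogeneous_even_emb qvar_def)

lemma homogeneous_ovar: "homogeneous A (odeg A y) (ovar y)"
  by (simp add: ovar_def homogeneous_iff cf_odd_prod odd_deg_def)

lemma homogeneous_power:
  fixes a :: "('e, 'o::{finite, linorder}) cga"
  shows "homogeneous A i a \<Longrightarrow> homogeneous A (int n * i) (a ^ n)"
proof (induction n)
  case (Suc n)
  then show ?case
    using homogeneous_mult[of A i a "int n * i" "a ^ n"] by (simp add: algebra_simps)
qed simp

lemma homogeneous_monom_val:
  fixes B :: "('f, 'p::{finite, linorder}) free_cdga"
  assumes g: "\<And>e. homogeneous B (edeg A e) (even_emb (g e))"
  shows "homogeneous B (mon_deg A m) (even_emb (monom_val g m))"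
proof (induction m rule: monomial_induct)
  case (var e m)
  then show ?case
    using homogeneous_mult[OF g[of e] var] by (simp add: monom_val_add mon_deg_add)
qed simp

lemma homogeneous_subst:
  fixes B :: "('f, 'p::{finite, linorder}) free_cdga"
  assumes g: "\<And>e. homogeneous B (edeg A e) (even_emb (g e))"
    and p: "\<And>m. m \<in> keys p \<Longrightarrow> mon_deg A m = i"
  shows "homogeneous B i (even_emb (subst qconst g p))"
  unfolding subst_def monom_val_def[symmetric] even_emb_sum even_emb_hom
  by (intro homogeneous_sum homogeneous_even_emb_qconst_mult)
    (use homogeneous_monom_val[of B A g, OF g] p in metis)

lemma homogeneous_oprod:
  fixes A :: "('e, 'o::{finite, linorder}) free_cdga" and B :: "('f, 'p::{finite, linorder}) free_cdga"
  assumes h: "\<And>y. homogeneous B (odeg A y) (h y)"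
  shows "homogeneous B (odd_deg A S) (oprod h S)"
proof -
  have "homogeneous B (sum_list (map (odeg A) xs)) (prod_list (map h xs))" for xs
    by (induction xs) (simp_all add: homogeneous_mult h)
  from this[of "sorted_list_of_set S"] show ?thesis
    by (simp add: oprod_def odd_deg_def sum_list_distinct_conv_sum_set)
qed

lemma homogeneous_ext_hom:
  fixes A :: "('e, 'o::{finite, linorder}) free_cdga" and B :: "('f, 'p::{finite, linorder}) free_cdga"
  assumes g: "\<And>e. homogeneous B (edeg A e) (even_emb (g e))"
    and h: "\<And>y. homogeneous B (odeg A y) (h y)"
    and a: "homogeneous A i a"
  shows "homogeneous B i (ext_hom g h a)"
  unfolding ext_hom_def
proof (rule homogeneous_sum)
  fix S :: "'o set"
  have "homogeneous B (i - odd_deg A S) (even_emb (subst qconst g (cf a S)))"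
    by (rule homogeneous_subst[of B A, OF g]) (use a in \<open>force simp: homogeneous_iff\<close>)
  from homogeneous_mult[OF this homogeneous_oprod[of B A h S, OF h]]
  show "homogeneous B i (even_emb (subst qconst g (cf a S)) * oprod h S)" by simp
qed

text \<open>The sign conventions of the underlying algebra presuppose that the sorts of the generators
  agree with the parities of their degrees.\<close>

locale graded_cdga =
  fixes A :: "('e::finite, 'o::{finite, linorder}) free_cdga"
  assumes even_edeg: "even (edeg A e)" and odd_odeg: "odd (odeg A y)"
    and homogeneous_ediff: "homogeneous A (edeg A e + 1) (ediff A e)"
    and homogeneous_odiff: "homogeneous A (odeg A y + 1) (odiff A y)"
begin

lemma even_mon_deg: "even (mon_deg A m)"
  unfolding mon_deg_def by (intro dvd_sum) (simp add: even_edeg)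

lemma even_odd_deg: "even (odd_deg A S) \<longleftrightarrow> even (card S)"
  using finite[of S] by induction (simp_all add: odd_deg_def odd_odeg)

lemma parity_component:
  assumes "homogeneous A i a" "even i \<longleftrightarrow> odd (card S)"
  shows "cf a S = 0"
proof (rule ccontr)
  assume "cf a S \<noteq> 0"
  then obtain m where "m \<in> keys (cf a S)"
    by (metis poly_mapping_eqI lookup_zero in_keys_iff)
  then have "i = mon_deg A m + odd_deg A S"
    using assms(1) by (simp add: homogeneous_iff)
  then show False
    using assms(2) even_mon_deg[of m] even_odd_deg[of S] by auto
qed

lemma homogeneous_evenp: "homogeneous A i a \<Longrightarrow> even i \<Longrightarrow> evenp a"
  using parity_component[of i a] by (simp add: evenp_def)

lemma homogeneous_oddp: "homogeneous A i a \<Longrightarrow> odd i \<Longrightarrow> oddp a"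
  using parity_component[of i a] by (simp add: oddp_def)

sublocale parity_cdga A
proof
  show "oddp (ediff A e)" for e
    using homogeneous_oddp[OF homogeneous_ediff] even_edeg by simp
  show "evenp (odiff A y)" for y
    using homogeneous_evenp[OF homogeneous_odiff] odd_odeg by simp
qed

end

text \<open>The universal property of a free cdga: compatibility with degrees and with the differential
  has to be checked on generators only.\<close>

theorem cdga_hom_ext_hom:
  assumes A: "graded_cdga A" and B: "graded_cdga B"
    and g: "\<And>e. homogeneous B (edeg A e) (even_emb (g e))"
    and h: "\<And>y. homogeneous B (odeg A y) (h y)"
    and de: "\<And>e. ext_hom g h (ediff A e) = cdiff B (even_emb (g e))"
    and dy: "\<And>y. ext_hom g h (odiff A y) = cdiff B (h y)"
  shows "cdga_hom A B (ext_hom g h)"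
proof -
  interpret A: graded_cdga A by fact
  interpret B: graded_cdga B by fact
  have odd: "oddp (h y)" for y
    using B.homogeneous_oddp[OF h] A.odd_odeg by blast
  show ?thesis
    unfolding cdga_hom_iff
  proof (intro conjI allI impI)
    show hom: "alg_hom (ext_hom g h)"
      by (rule alg_hom_ext_hom) (rule odd)
    show "homogeneous B i (ext_hom g h a)" if "homogeneous A i a" for i a
      using that by (rule homogeneous_ext_hom[of B A, OF g h])
    show "ext_hom g h (cdiff A a) = cdiff B (ext_hom g h a)" for a
      by (rule alg_hom_chainI[OF A.parity_cdga_axioms B.parity_cdga_axioms hom])
        (simp_all add: ext_hom_evar ext_hom_ovar odd de dy)
  qed
qed

section \<open>The cylinder\<close>

lemma koszul_Some: "koszul (Some ` S) (Some ` T) = koszul S T"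
proof -
  have "{(s, t) \<in> Some ` S \<times> Some ` T. t < s} = map_prod Some Some ` {(s, t) \<in> S \<times> T. t < s}"
    by (auto simp: image_iff)
  moreover have "inj_on (map_prod Some Some) {(s, t) \<in> S \<times> T. t < s}"
    by (auto simp: inj_on_def)
  ultimately show ?thesis
    by (simp add: koszul_def card_image)
qed

text \<open>\<open>Some\<close> preserves the order of the odd generators and hence all signs. This is why
  \<open>cyl_emb\<close> and \<open>cyl_at\<close>, which are defined on components, are multiplicative.\<close>

lemma cf_mult_Some:
  "cf (a * b) (Some ` U) = (\<Sum>S\<in>Pow U. koszul S (U - S) * cf a (Some ` S) * cf b (Some ` (U - S)))"
proof -
  have inj: "inj_on ((`) Some) (Pow U)"
    by (simp add: inj_on_image_Pow)
  have "cf (a * b) (Some ` U) =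
      (\<Sum>S\<in>(`) Some ` Pow U. koszul S (Some ` U - S) * cf a S * cf b (Some ` U - S))"
    by (simp add: cf_mult image_Pow_surj)
  also have "\<dots> = (\<Sum>S\<in>Pow U. koszul (Some ` S) (Some ` U - Some ` S) * cf a (Some ` S) * cf b (Some ` U - Some ` S))"
    by (subst sum.reindex[OF inj]) simp
  also have "\<dots> = (\<Sum>S\<in>Pow U. koszul S (U - S) * cf a (Some ` S) * cf b (Some ` (U - S)))"
    by (simp add: koszul_Some flip: image_set_diff[OF inj_Some])
  finally show ?thesis .
qed

lemma (in coeff_hom) subst_koszul [simp]: "subst c g (koszul S T) = koszul S T"
  by (simp add: koszul_def)

lemma Some_vimage:
  assumes "None \<notin> U"
  shows "U = Some ` {y. Some y \<in> U}"
proof -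
  have "x \<in> Some ` {y. Some y \<in> U}" if "x \<in> U" for x
    using assms that by (cases x) auto
  then show ?thesis by blast
qed

lemma cf_cyl_emb_Some: "cf (cyl_emb a) (Some ` S) = subst qconst (\<lambda>e. qvar (Some e)) (cf a S)"
  by (simp add: cyl_emb_def image_iff)

lemma cf_cyl_emb_None: "None \<in> S \<Longrightarrow> cf (cyl_emb a) S = 0"
  by (simp add: cyl_emb_def)

lemma cf_cyl_at: "cf (cyl_at c a) S =
    subst qconst (\<lambda>e. case e of None \<Rightarrow> qconst c | Some e' \<Rightarrow> qvar e') (cf a (Some ` S))"
  by (simp add: cyl_at_def)

lemma cyl_cgaI:
  assumes "\<And>S. cf a (Some ` S) = cf b (Some ` S)" "\<And>S. None \<in> S \<Longrightarrow> cf a S = cf b S"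
  shows "a = b"
  by (rule cga_eqI) (metis assms Some_vimage)

lemma alg_hom_cyl_emb: "alg_hom (cyl_emb :: ('e, 'o::{finite, linorder}) cga \<Rightarrow> _)"
proof
  fix a b :: "('e, 'o) cga" and c
  show "cyl_emb (a + b) = cyl_emb a + cyl_emb b" "cyl_emb (scal c a) = scal c (cyl_emb a)"
    by (rule cyl_cgaI; simp add: cf_cyl_emb_Some cf_cyl_emb_None)+
  show "cyl_emb (1 :: ('e, 'o) cga) = 1"
    by (rule cyl_cgaI) (auto simp: cf_cyl_emb_Some cf_cyl_emb_None cf_1)
  show "cyl_emb (a * b) = cyl_emb a * cyl_emb b"
  proof (rule cyl_cgaI)
    show "cf (cyl_emb (a * b)) (Some ` U) = cf (cyl_emb a * cyl_emb b) (Some ` U)" for U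
      unfolding cf_mult_Some[of "cyl_emb a"] cf_cyl_emb_Some cf_mult[of a b]
      by (simp add: qconst.subst_sum)
    show "cf (cyl_emb (a * b)) U = cf (cyl_emb a * cyl_emb b) U" if "None \<in> U" for U
    proof -
      have "koszul S (U - S) * cf (cyl_emb a) S * cf (cyl_emb b) (U - S) = 0" for S
        using that by (cases "None \<in> S") (simp_all add: cf_cyl_emb_None)
      then show ?thesis
        using that by (simp add: cf_mult cf_cyl_emb_None)
    qed
  qed
qed

lemma cyl_emb_ovar [simp]: "cyl_emb (ovar y) = ovar (Some y)"
  by (rule cyl_cgaI) (auto simp: cf_cyl_emb_Some cf_cyl_emb_None ovar_def cf_odd_prod)

lemma cyl_emb_evar [simp]: "cyl_emb (evar e) = evar (Some e)"
  by (rule cyl_cgaI) (auto simp: cf_cyl_emb_Some cf_cyl_emb_None evar_def cf_even_emb)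

lemma cyl_emb_even_emb: "cyl_emb (even_emb p) = even_emb (subst qconst (\<lambda>e. qvar (Some e)) p)"
  by (rule cyl_cgaI) (auto simp: cf_cyl_emb_Some cf_cyl_emb_None cf_even_emb)

lemma alg_hom_cyl_at: "alg_hom (cyl_at c :: _ \<Rightarrow> ('e, 'o::{finite, linorder}) cga)"
proof
  fix a b :: "('e option, 'o option) cga" and r
  show "cyl_at c (a + b) = cyl_at c a + cyl_at c b" "cyl_at c (scal r a) = scal r (cyl_at c a)"
    "cyl_at c (1 :: ('e option, 'o option) cga) = 1"
    by (rule cga_eqI; simp add: cf_cyl_at cf_1)+
  show "cyl_at c (a * b) = cyl_at c a * cyl_at c b"
    unfolding cf_inject[symmetric] fun_eq_iff cf_cyl_at cf_mult_Some[of a b] cf_mult[of "cyl_at c a"]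
    by (simp add: qconst.subst_sum)
qed

lemma cyl_at_ovar [simp]: "cyl_at c (ovar None) = 0" "cyl_at c (ovar (Some y)) = ovar y"
  by (rule cga_eqI; auto simp: cf_cyl_at ovar_def cf_odd_prod)+

lemma cyl_at_evar [simp]:
  "cyl_at c (evar None) = even_emb (qconst c)" "cyl_at c (evar (Some e)) = evar e"
  by (rule cga_eqI; auto simp: cf_cyl_at evar_def cf_even_emb)+

lemma cyl_at_cyl_emb [simp]: "cyl_at c (cyl_emb a) = a"
  for a :: "('e, 'o::{finite, linorder}) cga"
proof -
  have "cyl_at c \<circ> (cyl_emb :: ('e, 'o) cga \<Rightarrow> _) = id"
  proof (rule alg_hom_eqI)
    show "alg_hom (cyl_at c \<circ> (cyl_emb :: ('e, 'o) cga \<Rightarrow> _))"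
      by (rule alg_hom_comp[OF alg_hom_cyl_emb alg_hom_cyl_at])
    show "alg_hom (id :: ('e, 'o) cga \<Rightarrow> _)" by unfold_locales simp_all
  qed simp_all
  then show ?thesis by (simp add: fun_eq_iff)
qed

lemma homogeneous_cyl_emb:
  fixes A :: "('e, 'o::{finite, linorder}) free_cdga"
  assumes "homogeneous A i a"
  shows "homogeneous (cyl A) i (cyl_emb a)"
proof -
  have "(cyl_emb :: ('e, 'o) cga \<Rightarrow> _) = ext_hom (\<lambda>e. qvar (Some e)) (\<lambda>y::'o. ovar (Some y))"
    by (rule alg_hom_eqI[OF alg_hom_cyl_emb alg_hom_ext_hom])
      (simp_all add: ext_hom_evar ext_hom_ovar evar_def[of "Some _", symmetric])
  moreover have "homogeneous (cyl A) i (ext_hom (\<lambda>e. qvar (Some e)) (\<lambda>y. ovar (Some y)) a)"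
  proof (rule homogeneous_ext_hom[OF _ _ assms])
    show "homogeneous (cyl A) (edeg A e) (even_emb (qvar (Some e)))" for e
      using homogeneous_evar[of "cyl A" "Some e"] by (simp add: evar_def cyl_def)
    show "homogeneous (cyl A) (odeg A y) (ovar (Some y))" for y
      using homogeneous_ovar[of "cyl A" "Some y"] by (simp add: cyl_def)
  qed
  ultimately show ?thesis by simp
qed

lemma graded_cdga_cyl:
  assumes "graded_cdga A"
  shows "graded_cdga (cyl A)"
proof -
  interpret graded_cdga A by fact
  show ?thesis
  proof
    show "even (edeg (cyl A) e)" for e by (cases e) (simp_all add: cyl_def even_edeg)
    show "odd (odeg (cyl A) y)" for y by (cases y) (simp_all add: cyl_def odd_odeg)
    show "homogeneous (cyl A) (edeg (cyl A) e + 1) (ediff (cyl A) e)" for e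
      using homogeneous_ovar[of "cyl A" None] homogeneous_cyl_emb[OF homogeneous_ediff]
      by (cases e) (simp_all add: cyl_def)
    show "homogeneous (cyl A) (odeg (cyl A) y + 1) (odiff (cyl A) y)" for y
      using homogeneous_cyl_emb[OF homogeneous_odiff]
      by (cases y) (simp_all add: cyl_def)
  qed
qed

lemma cyl_emb_cdiff:
  assumes "graded_cdga A"
  shows "cyl_emb (cdiff A a) = cdiff (cyl A) (cyl_emb a)"
proof -
  interpret A: graded_cdga A by fact
  interpret C: graded_cdga "cyl A" by (rule graded_cdga_cyl) fact
  show ?thesis
    by (rule alg_hom_chainI[OF A.parity_cdga_axioms C.parity_cdga_axioms alg_hom_cyl_emb])
      (simp_all add: C.cdiff_evar C.cdiff_ovar, simp_all add: evar_def cyl_def)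
qed

section \<open>Forms as polynomial functions\<close>

definition peval :: "('v \<Rightarrow> rat) \<Rightarrow> 'v qpoly \<Rightarrow> rat"
  where "peval u p = subst id u p"

lemma peval_simps [simp]:
  "peval u 0 = 0" "peval u 1 = 1" "peval u (qconst c) = c" "peval u (qvar v) = u v"
  "peval u (p + q) = peval u p + peval u q" "peval u (p * q) = peval u p * peval u q"
  "peval u (p ^ n) = peval u p ^ n" "peval u (- p) = - peval u p" "peval u (p - q) = peval u p - peval u q"
  by (simp_all only: peval_def rat_id.subst_0 rat_id.subst_1 rat_id.subst_qconst rat_id.subst_qvar
      rat_id.subst_add rat_id.subst_mult rat_id.subst_power rat_id.subst_uminus rat_id.subst_diff id_apply)

lemma peval_sum: "peval u (\<Sum>i\<in>I. f i) = (\<Sum>i\<in>I. peval u (f i))"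
  by (simp only: peval_def rat_id.subst_sum)

lemma peval_subst: "peval u (subst qconst h p) = peval (\<lambda>v. peval u (h v)) p"
  by (simp only: peval_def rat_id.subst_subst)

lemma monom_val_double: "monom_val (u(v := 2 * u v)) m = 2 ^ lookup m v * monom_val u m"
  for u :: "'v \<Rightarrow> rat"
proof (induction m rule: monomial_induct)
  case (var w m)
  then show ?case
    by (cases "v = w") (simp_all add: monom_val_add lookup_add lookup_single power_add)
qed simp

text \<open>This is independence of characters: doubling the variable in which two monomials differ
  scales them differently, so that one of them can be eliminated from a vanishing combination.\<close>

lemma monom_val_independent:
  assumes "finite K" and "\<And>u :: 'v \<Rightarrow> rat. (\<Sum>m\<in>K. a m * monom_val u m) = 0" and "m \<in> K"
  shows "a m = 0"
  using assms
proof (induction K arbitrary: a m rule: finite_induct)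
  case (insert m0 K)
  have K0: "a m = 0" if m: "m \<in> K" for m
  proof -
    have "m \<noteq> m0" using m insert.hyps by auto
    then obtain v where v: "lookup m v \<noteq> lookup m0 v"
      by (metis poly_mapping_eqI)
    have "(\<Sum>m\<in>K. (a m * (2 ^ lookup m0 v - 2 ^ lookup m v)) * monom_val u m) = 0" for u
    proof -
      have "(\<Sum>m\<in>insert m0 K. (a m * (2 ^ lookup m0 v - 2 ^ lookup m v)) * monom_val u m)
          = 2 ^ lookup m0 v * (\<Sum>m\<in>insert m0 K. a m * monom_val u m)
            - (\<Sum>m\<in>insert m0 K. a m * monom_val (u(v := 2 * u v)) m)"
        unfolding sum_distrib_left sum_subtractf[symmetric] monom_val_double
        by (rule sum.cong) (simp_all add: algebra_simps)
      also have "\<dots> = 0" by (simp only: insert.prems(1))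
      finally show ?thesis using insert.hyps by simp
    qed
    from insert.IH[OF this m] have "a m * (2 ^ lookup m0 v - 2 ^ lookup m v) = 0" .
    moreover have "(2 :: rat) ^ lookup m0 v \<noteq> 2 ^ lookup m v"
      using v by simp
    ultimately show ?thesis by simp
  qed
  have "a m0 * monom_val (\<lambda>_. 1) m0 = 0"
    using insert.prems(1)[of "\<lambda>_. 1"] insert.hyps K0 by simp
  then have "a m0 = 0" by (simp add: monom_val_def)
  then show ?case using K0 insert.prems(2) by auto
qed simp

text \<open>The orthogonal group is defined by polynomial functions and the differential by
  polynomials; over the infinite field \<open>\<rat>\<close> the two viewpoints agree.\<close>

lemma qpoly_eqI_peval:
  assumes "\<And>u. peval u p = peval u q"
  shows "p = q"
proof -
  have "(\<Sum>m\<in>keys (p - q). lookup (p - q) m * monom_val u m) = 0" for u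
  proof -
    have "peval u (p - q) = 0" using assms[of u] by simp
    then show ?thesis by (simp add: peval_def subst_def monom_val_def)
  qed
  then have "m \<in> keys (p - q) \<Longrightarrow> lookup (p - q) m = 0" for m
    by (rule monom_val_independent[OF finite_keys])
  then have "p - q = 0"
    by (intro poly_mapping_eqI) (auto simp: in_keys_iff)
  then show ?thesis by simp
qed

subsection \<open>Lines\<close>

interpretation poly_const: coeff_hom "\<lambda>c :: rat. [:c:]"
  by unfold_locales simp_all

abbreviation on_line :: "('v \<Rightarrow> rat) \<Rightarrow> ('v \<Rightarrow> rat) \<Rightarrow> 'v qpoly \<Rightarrow> rat poly"
  where "on_line u w \<equiv> subst (\<lambda>c. [:c:]) (\<lambda>j. [:u j, w j:])"

lemma poly_on_line: "poly (on_line u w p) t = peval (\<lambda>j. u j + t * w j) p"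
  by (induction p rule: qpoly_induct) (simp_all add: algebra_simps)

lemma pderiv_sum: "pderiv (\<Sum>i\<in>I. f i) = (\<Sum>i\<in>I. pderiv (f i))"
  using higher_pderiv_sum[of 1 f I] by simp

lemma coeff_1_conv: "coeff p 1 = poly (pderiv p) 0" for p :: "rat poly"
  by (simp add: poly_0_coeff_0 coeff_pderiv)

definition unit_vec :: "'v \<Rightarrow> 'v \<Rightarrow> rat"
  where "unit_vec j = (\<lambda>i. if i = j then 1 else 0)"

text \<open>The equations to be compared hold for \<open>t = x\<^sub>1\<^sup>5\<close> and \<open>t = x\<^sub>2\<^sup>4\<close> only, which is
  still an infinite set of values.\<close>

lemma poly_eqI_powers:
  assumes "N > 0" and "\<And>s :: rat. s \<noteq> 0 \<Longrightarrow> poly p (s ^ N) = poly q (s ^ N)"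
  shows "p = q"
proof (rule ccontr)
  assume "p \<noteq> q"
  then have "finite {x. poly (p - q) x = 0}"
    by (intro poly_roots_finite) simp
  moreover have "(\<lambda>k. of_nat (Suc k) ^ N) ` (UNIV :: nat set) \<subseteq> {x. poly (p - q) x = 0}"
    using assms(2) by (auto simp del: of_nat_Suc)
  moreover have "inj (\<lambda>k. (of_nat (Suc k) :: rat) ^ N)"
  proof (rule injI)
    fix x y assume "(of_nat (Suc x) :: rat) ^ N = of_nat (Suc y) ^ N"
    then have "(of_nat (Suc x) :: rat) = of_nat (Suc y)"
      by (rule power_eq_imp_eq_base) (use assms(1) in auto)
    then show "x = y" by simp
  qed
  ultimately show False
    using finite_imageD infinite_UNIV_nat finite_subset by blast
qed

definition mat_app :: "('n \<Rightarrow> 'n::finite \<Rightarrow> rat) \<Rightarrow> ('n \<Rightarrow> rat) \<Rightarrow> 'n \<Rightarrow> rat"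
  where "mat_app L u j = (\<Sum>l\<in>UNIV. L j l * u l)"

lemma mat_app_line: "mat_app L (\<lambda>j. u j + t * w j) = (\<lambda>j. mat_app L u j + t * mat_app L w j)"
  by (rule ext) (simp add: mat_app_def algebra_simps sum.distrib sum_distrib_left)

lemma sum_apply: "(\<Sum>i\<in>I. f i) x = (\<Sum>i\<in>I. f i x)"
  by (induction I rule: infinite_finite_induct) simp_all

interpretation coord: vector_space "\<lambda>(c :: rat) (f :: 'n \<Rightarrow> rat) x. c * f x"
  by unfold_locales (auto simp: algebra_simps plus_fun_def)

lemma coord_expand: "f = (\<Sum>j\<in>UNIV. (\<lambda>x. f j * unit_vec j x))" for f :: "'n::finite \<Rightarrow> rat"
  by (rule ext) (simp add: sum_apply unit_vec_def if_distrib[of "(*) _"] cong: if_cong)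

lemma finite_dim_coord:
  "finite_dimensional_vector_space (\<lambda>(c :: rat) (f :: 'n::finite \<Rightarrow> rat) x. c * f x) (range unit_vec)"
proof
  show "finite (range (unit_vec :: 'n \<Rightarrow> _))" by simp
  have inj: "inj (unit_vec :: 'n \<Rightarrow> _)"
    by (rule injI) (metis unit_vec_def zero_neq_one)
  show "coord.independent (range (unit_vec :: 'n \<Rightarrow> _))"
  proof (rule coord.independent_if_scalars_zero)
    fix f x
    assume sum: "(\<Sum>x\<in>range (unit_vec :: 'n \<Rightarrow> _). (\<lambda>i. f x * x i)) = 0" and "x \<in> range (unit_vec :: 'n \<Rightarrow> _)"
    then obtain j where x: "x = unit_vec j" by blast
    have "(\<Sum>l\<in>(UNIV :: 'n set). (\<lambda>i. f (unit_vec l) * unit_vec l i)) = 0"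
      using sum by (simp add: sum.reindex[OF inj])
    from fun_cong[OF this, of j] show "f x = 0"
      by (simp add: sum_apply unit_vec_def x if_distrib[of "(*) _"] cong: if_cong)
  qed simp
  show "coord.span (range (unit_vec :: 'n \<Rightarrow> _)) = UNIV"
  proof -
    have "f \<in> coord.span (range (unit_vec :: 'n \<Rightarrow> _))" for f
      by (subst coord_expand) (intro coord.span_sum coord.span_scale coord.span_base rangeI)
    then show ?thesis by blast
  qed
qed

lemma inj_mat_app_surj:
  fixes L :: "'n::finite \<Rightarrow> 'n \<Rightarrow> rat"
  assumes "\<And>w. mat_app L w = 0 \<Longrightarrow> w = 0"
  shows "\<exists>w. b = mat_app L w"
proof -
  interpret fd: finite_dimensional_vector_space "\<lambda>(c :: rat) (f :: 'n \<Rightarrow> rat) x. c * f x" "range unit_vec"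
    by (rule finite_dim_coord)
  have lin: "Vector_Spaces.linear (\<lambda>(c :: rat) (f :: 'n \<Rightarrow> rat) x. c * f x) (\<lambda>c f x. c * f x) (mat_app L)"
    by unfold_locales (auto simp: mat_app_def algebra_simps sum.distrib sum_distrib_left)
  interpret L: Vector_Spaces.linear "\<lambda>(c :: rat) (f :: 'n \<Rightarrow> rat) x. c * f x" "\<lambda>c f x. c * f x" "mat_app L"
    by (rule lin)
  have "inj (mat_app L)"
    using assms by (simp add: L.inj_iff_eq_0)
  then have "surj (mat_app L)"
    by (rule fd.linear_inj_imp_surj[OF lin])
  then show ?thesis by (metis surjD)
qed

subsection \<open>Rigidity of sums of forms\<close>

definition diag_form :: "('n::finite \<Rightarrow> rat) \<Rightarrow> nat \<Rightarrow> 'n qpoly"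
  where "diag_form l d = (\<Sum>j\<in>UNIV. qconst (l j) * qvar j ^ d)"

text \<open>The derivative of a power of a diagonal form at a unit vector \<open>e\<^sub>j\<close>. Since \<open>d \<ge> 2\<close>, all
  summands but the one of \<open>j\<close> have derivative 0 there, so the derivative in direction \<open>w\<close>
  detects \<open>w\<^sub>j\<close>.\<close>

lemma coeff_1_diag_form_power:
  assumes "d \<ge> 2"
  shows "coeff (on_line (unit_vec j) w (diag_form l d ^ s)) 1 = of_nat s * l j ^ s * of_nat d * w j"
proof -
  define Q where "Q = on_line (unit_vec j) w (diag_form l d)"
  have Q: "Q = (\<Sum>i\<in>UNIV. [:l i:] * [:unit_vec j i, w i:] ^ d)"
    by (simp add: Q_def diag_form_def poly_const.subst_sum)
  have "poly Q 0 = (\<Sum>i\<in>UNIV. if i = j then l j else 0)"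
    unfolding Q poly_sum by (rule sum.cong) (use assms in \<open>auto simp: unit_vec_def power_0_left\<close>)
  then have Q0: "poly Q 0 = l j" by simp
  have "pderiv Q = (\<Sum>i\<in>UNIV. [:l i:] * pderiv ([:unit_vec j i, w i:] ^ d))"
    unfolding Q by (simp add: pderiv_sum pderiv_smult)
  also have "\<dots> = (\<Sum>i\<in>UNIV. [:l i:] * (of_nat d * [:unit_vec j i, w i:] ^ (d - 1) * [:w i:]))"
    by (simp add: pderiv_power pderiv_pCons of_nat_poly mult_ac)
  finally have pQ: "pderiv Q = (\<Sum>i\<in>UNIV. [:l i:] * (of_nat d * [:unit_vec j i, w i:] ^ (d - 1) * [:w i:]))" .
  have "poly (pderiv Q) 0 = (\<Sum>i\<in>UNIV. if i = j then l j * of_nat d * w j else 0)"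
    unfolding pQ poly_sum
    by (rule sum.cong) (use assms in \<open>auto simp: unit_vec_def power_0_left of_nat_poly\<close>)
  then have Q1: "poly (pderiv Q) 0 = l j * of_nat d * w j" by simp
  have "on_line (unit_vec j) w (diag_form l d ^ s) = Q ^ s"
    by (simp add: Q_def)
  moreover have "poly (pderiv (Q ^ s)) 0 = of_nat s * l j ^ (s - 1) * (l j * of_nat d * w j)"
    by (simp add: pderiv_power Q0 Q1 of_nat_poly)
  ultimately show ?thesis
    unfolding coeff_1_conv by (cases s) (simp_all add: mult_ac)
qed

text \<open>The variable \<open>\<sigma> = s\<^sup>N\<close> makes the sum of forms homogeneous. Both sides are polynomials in
  \<open>\<sigma>\<close>. The constant coefficient concerns the top form \<open>q\<^sub>R\<close> alone and says that \<open>L\<close> preserves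
  it up to a factor; as derivatives of \<open>q\<^sub>R\<close> detect every direction, \<open>L\<close> is injective, and
  thus \<open>b = L w\<close> for some \<open>w\<close>. The coefficient of \<open>\<sigma>\<close> also concerns \<open>q\<^sub>R\<close> alone, because
  the degrees have gaps of at least 2; it says that the derivative of \<open>q\<^sub>R\<close> in direction \<open>w\<close>
  vanishes, so \<open>w = 0\<close>. After that the remaining coefficients can be compared one by one,
  since the exponents are distinct.\<close>

lemma compare_forms:
  fixes q :: "nat \<Rightarrow> 'n::finite qpoly" and L :: "'n \<Rightarrow> 'n \<Rightarrow> rat"
  assumes l: "\<And>j. l j \<noteq> 0" and d: "d \<ge> 2" and s: "s \<ge> 1" and qR: "q R = diag_form l d ^ s"
    and D_mono: "\<And>i j. i < j \<Longrightarrow> j \<le> R \<Longrightarrow> D i + 2 \<le> D j" and D0: "D 0 \<ge> 2"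
    and N: "N > 0" and a: "a \<noteq> 0"
    and eq: "\<And>u s. s \<noteq> 0 \<Longrightarrow>
      (\<Sum>i\<le>R. \<kappa> i * (s ^ N) ^ (D R - D i) * peval (\<lambda>j. mat_app L u j + s ^ N * b j) (q i)) + \<mu> * (s ^ N) ^ D R
      = a * ((\<Sum>i\<le>R. (s ^ N) ^ (D R - D i) * peval u (q i)) + (s ^ N) ^ D R)"
  shows "b = 0" and "\<mu> = a"
    and "\<And>i u. i \<le> R \<Longrightarrow> \<kappa> i * peval (mat_app L u) (q i) = a * peval u (q i)"
    and "\<And>w. mat_app L w = 0 \<Longrightarrow> w = 0"
proof -
  define lhs where "lhs u = (\<Sum>i\<le>R. monom (\<kappa> i) (D R - D i) * on_line (mat_app L u) b (q i)) + monom \<mu> (D R)" for u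
  define rhs where "rhs u = smult a ((\<Sum>i\<le>R. monom (peval u (q i)) (D R - D i)) + monom 1 (D R))" for u
  have lhs_rhs: "lhs u = rhs u" for u
  proof (rule poly_eqI_powers[OF N])
    fix s :: rat assume "s \<noteq> 0"
    from eq[OF this, of u] show "poly (lhs u) (s ^ N) = poly (rhs u) (s ^ N)"
      by (simp add: lhs_def rhs_def poly_sum poly_monom poly_on_line mult_ac)
  qed
  have DR: "D R \<ge> 2"
    using D0 D_mono[of 0 R] by (cases "R = 0") auto
  have gap: "D R - D i \<ge> 2" if "i < R" for i
    using D_mono[OF that] by simp
  have R_split: "{..R} = insert R {..<R}" by auto
  have top: "\<kappa> R * peval (mat_app L u) (q R) = a * peval u (q R)" for u
  proof -
    have z: "(0 :: rat) ^ (D R - D i) = 0" if "i < R" for i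
      using gap[OF that] by (simp add: power_0_left)
    have "poly (lhs u) 0 = \<kappa> R * peval (mat_app L u) (q R)"
      unfolding lhs_def R_split using DR
      by (simp add: poly_sum poly_monom poly_on_line z cong: sum.cong_simp)
    moreover have "poly (rhs u) 0 = a * peval u (q R)"
      unfolding rhs_def R_split using DR
      by (simp add: poly_sum poly_monom z cong: sum.cong_simp)
    ultimately show ?thesis using lhs_rhs[of u] by simp
  qed
  have zero: "w = 0" if "\<And>j. coeff (on_line (unit_vec j) w (q R)) 1 = 0" for w
  proof
    fix j
    show "w j = 0 j"
      using that[of j] l[of j] d s unfolding qR coeff_1_diag_form_power[OF d] by simp
  qed
  show inj: "w = 0" if w: "mat_app L w = 0" for w
  proof (rule zero)
    fix j
    have "poly (on_line (unit_vec j) w (q R)) t = poly [:peval (unit_vec j) (q R):] t" for t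
      using top[of "\<lambda>i. unit_vec j i + t * w i"] top[of "unit_vec j"] a w
      by (simp add: poly_on_line mat_app_line)
    then have "on_line (unit_vec j) w (q R) = [:peval (unit_vec j) (q R):]"
      by (intro poly_eqI_powers[of 1]) simp_all
    then show "coeff (on_line (unit_vec j) w (q R)) 1 = 0" by simp
  qed
  obtain w where w: "b = mat_app L w"
    using inj_mat_app_surj[OF inj] by blast
  have "w = 0"
  proof (rule zero)
    fix j
    let ?e = "unit_vec j :: 'n \<Rightarrow> rat"
    have "poly (smult (\<kappa> R) (on_line (mat_app L ?e) b (q R))) t = poly (smult a (on_line ?e w (q R))) t" for t
      using top[of "\<lambda>i. ?e i + t * w i"] by (simp add: poly_on_line mat_app_line w)
    then have "smult (\<kappa> R) (on_line (mat_app L ?e) b (q R)) = smult a (on_line ?e w (q R))"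
      by (intro poly_eqI_powers[of 1]) simp_all
    from arg_cong[OF this, of "\<lambda>p. coeff p 1"]
    have "\<kappa> R * coeff (on_line (mat_app L ?e) b (q R)) 1 = a * coeff (on_line ?e w (q R)) 1"
      by (simp only: coeff_smult)
    moreover have "coeff (lhs ?e) 1 = \<kappa> R * coeff (on_line (mat_app L ?e) b (q R)) 1"
    proof -
      have "coeff (monom (\<kappa> i) (D R - D i) * on_line (mat_app L ?e) b (q i)) 1 = 0" if "i < R" for i
        using gap[OF that] by (simp add: coeff_monom_mult)
      then show ?thesis
        unfolding lhs_def R_split using DR by (simp add: coeff_sum monom_0)
    qed
    moreover have "coeff (rhs ?e) 1 = 0"
    proof -
      have "coeff (monom c (D R - D i)) 1 = 0" if "i < R" for i and c :: rat
        using gap[OF that] by simp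
      then show ?thesis
        unfolding rhs_def R_split using DR by (simp add: coeff_sum monom_0)
    qed
    ultimately show "coeff (on_line ?e w (q R)) 1 = 0"
      using lhs_rhs[of ?e] a by simp
  qed
  then show b: "b = 0"
    by (simp add: w mat_app_def fun_eq_iff)
  have const: "on_line x (0 :: 'n \<Rightarrow> rat) p = [:peval x p:]" for x p
  proof (rule poly_eqI_powers[of 1])
    show "poly (on_line x 0 p) (t ^ 1) = poly [:peval x p:] (t ^ 1)" for t
      unfolding poly_on_line by simp
  qed simp
  have D_le: "D i \<le> D R" if "i \<le> R" for i
    using D_mono[of i R] that by (cases "i = R") auto
  have D_pos: "D i \<ge> 2" if "i \<le> R" for i
    using D_mono[of 0 i] D0 that by (cases "i = 0") auto
  have D_inj: "D R - D i = D R - D j \<longleftrightarrow> i = j" if "i \<le> R" "j \<le> R" for i j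
    using D_le that D_mono[of i j] D_mono[of j i] by (cases i j rule: linorder_cases) fastforce+
  have coeff_lhs: "coeff (lhs u) n = (\<Sum>i\<le>R. if D R - D i = n then \<kappa> i * peval (mat_app L u) (q i) else 0)
      + (if D R = n then \<mu> else 0)" for u n
    unfolding lhs_def b const by (auto simp: coeff_sum coeff_monom_mult intro!: sum.cong)
  have coeff_rhs: "coeff (rhs u) n = a * ((\<Sum>i\<le>R. if D R - D i = n then peval u (q i) else 0)
      + (if D R = n then 1 else 0))" for u n
    unfolding rhs_def by (auto simp: coeff_sum intro!: sum.cong)
  show "\<mu> = a"
  proof -
    have "D R - D i \<noteq> D R" if "i \<le> R" for i
      using D_pos[OF that] DR by simp
    then have "(\<Sum>i\<le>R. if D R - D i = D R then f i else 0) = 0" for f :: "nat \<Rightarrow> rat"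
      by (intro sum.neutral) auto
    then have "coeff (lhs 0) (D R) = \<mu>" "coeff (rhs 0) (D R) = a"
      unfolding coeff_lhs coeff_rhs by simp_all
    then show ?thesis using lhs_rhs[of 0] by simp
  qed
  show "\<kappa> i * peval (mat_app L u) (q i) = a * peval u (q i)" if i: "i \<le> R" for i u
  proof -
    have ne: "D R \<noteq> D R - D i"
      using D_pos[OF i] DR by simp
    have "(\<Sum>j\<le>R. if D R - D j = D R - D i then f j else 0) = f i" for f :: "nat \<Rightarrow> rat"
    proof -
      have "(\<Sum>j\<le>R. if D R - D j = D R - D i then f j else 0) = (\<Sum>j\<le>R. if j = i then f j else 0)"
        by (rule sum.cong) (use D_inj i in auto)
      then show ?thesis using i by simp
    qed
    then have "coeff (lhs u) (D R - D i) = \<kappa> i * peval (mat_app L u) (q i)"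
        "coeff (rhs u) (D R - D i) = a * peval u (q i)"
      unfolding coeff_lhs coeff_rhs using ne by simp_all
    then show ?thesis using lhs_rhs[of u] by simp
  qed
qed

subsection \<open>Coordinates\<close>

text \<open>The \<open>v\<^sub>j\<close> separate points because every linear functional is a combination of them. So
  the coordinate map is injective, and it is bijective by dimension; the \<open>b\<^sub>j\<close> are the preimages of
  the unit vectors.\<close>

lemma dual_basis_coordinates:
  fixes scale :: "rat \<Rightarrow> 'm::ab_group_add \<Rightarrow> 'm" and v :: "'n::finite \<Rightarrow> 'm \<Rightarrow> rat"
  assumes vs: "vector_space scale" and dim: "vector_space.dim scale (UNIV :: 'm set) = CARD('n)"
    and dual: "dual_basis scale v"
  obtains b where "\<And>i j. v i (b j) = (if i = j then 1 else 0)"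
    and "\<And>x. x = (\<Sum>j\<in>UNIV. scale (v j x) (b j))"
    and "\<And>j. Vector_Spaces.linear scale (*) (v j)"
proof -
  interpret M: vector_space scale by fact
  obtain B where B: "M.independent B" "UNIV \<subseteq> M.span B" "card B = M.dim UNIV"
    using M.basis_exists[of UNIV] by metis
  have "finite B"
  proof (rule ccontr)
    assume "infinite B"
    then have "CARD('n) = 0" using B(3) dim by simp
    then show False by simp
  qed
  interpret M: finite_dimensional_vector_space scale B
    by unfold_locales (use B \<open>finite B\<close> in auto)
  interpret Q: vector_space "(*) :: rat \<Rightarrow> rat \<Rightarrow> rat"
    by unfold_locales (auto simp: algebra_simps)
  interpret MQ: vector_space_pair scale "(*) :: rat \<Rightarrow> rat \<Rightarrow> rat" ..
  have v: "Vector_Spaces.linear scale (*) (v j)" for j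
  proof -
    have "v j \<in> coord.span (range v)" by (rule coord.span_base) simp
    then show ?thesis using dual by (simp add: dual_basis_def dual_space_def)
  qed
  define c where "c = (\<lambda>x j. v j x)"
  interpret fd: finite_dimensional_vector_space "\<lambda>(c :: rat) (f :: 'n \<Rightarrow> rat) x. c * f x" "range unit_vec"
    by (rule finite_dim_coord)
  have lin: "Vector_Spaces.linear scale (\<lambda>c f x. c * f x) c"
    using v by unfold_locales
      (auto simp: c_def Vector_Spaces.linear_def module_hom_def module_hom_axioms_def)
  interpret c: Vector_Spaces.linear scale "\<lambda>c f x. c * f x" c by (rule lin)
  have "x = 0" if "c x = 0" for x
  proof (rule ccontr)
    assume "x \<noteq> 0"
    then have "M.independent {x}" by simp
    then obtain g where g: "Vector_Spaces.linear scale (*) g" "g x = 1"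
      using MQ.linear_independent_extend[of "{x}" "\<lambda>_. 1"] by auto
    then have "g \<in> coord.span (range v)"
      using dual by (simp add: dual_basis_def dual_space_def)
    then have "g x = 0"
    proof (rule coord.span_induct)
      show "coord.subspace {g. g x = 0}"
        by (auto simp: coord.subspace_def)
      show "f x = 0" if "f \<in> range v" for f
        using that \<open>c x = 0\<close> by (auto simp: c_def fun_eq_iff)
    qed
    then show False using g by simp
  qed
  then have inj: "inj c" by (simp add: c.inj_iff_eq_0)
  interpret P: finite_dimensional_vector_space_pair scale B "\<lambda>(c :: rat) (f :: 'n \<Rightarrow> rat) x. c * f x" "range unit_vec"
    ..
  have "card (range (unit_vec :: 'n \<Rightarrow> _)) = CARD('n)"
    by (rule card_image) (metis injI unit_vec_def zero_neq_one)
  then have "surj c"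
    using P.linear_injective_imp_surjective[OF lin inj] dim fd.dim_UNIV by simp
  define b where "b j = inv_into UNIV c (unit_vec j)" for j
  have b: "c (b j) = unit_vec j" for j
    unfolding b_def by (rule surj_f_inv_f[OF \<open>surj c\<close>])
  show thesis
  proof (rule that)
    show vb: "v i (b j) = (if i = j then 1 else 0)" for i j
      using fun_cong[OF b[of j], of i] by (simp add: c_def unit_vec_def)
    show "x = (\<Sum>j\<in>UNIV. scale (v j x) (b j))" for x
    proof (rule injD[OF inj])
      have "c (\<Sum>j\<in>UNIV. scale (v j x) (b j)) = (\<Sum>j\<in>UNIV. (\<lambda>i. c x j * unit_vec j i))"
        by (simp add: c.sum c.scale b) (simp add: c_def)
      then show "c x = c (\<Sum>j\<in>UNIV. scale (v j x) (b j))"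
        by (simp flip: coord_expand)
    qed
  qed (rule v)
qed

section \<open>The model of a realizable family\<close>

lemma UNIV_even_gen: "(UNIV :: 'n even_gen set) = insert X1 (insert X2 (range V))"
  by (auto intro: even_gen.exhaust)

lemma UNIV_odd_gen: "(UNIV :: odd_gen set) = {Y1, Y2, Y3, Z}"
  by (auto intro: odd_gen.exhaust)

lemma all_odd_gen: "(\<forall>y. P y) \<longleftrightarrow> P Y1 \<and> P Y2 \<and> P Y3 \<and> P Z"
  by (metis odd_gen.exhaust)

instance even_gen :: (finite) finite
  by standard (simp add: UNIV_even_gen)

lemma sum_even_gen: "(\<Sum>e\<in>UNIV. f e) = f X1 + f X2 + (\<Sum>j\<in>UNIV. f (V j))"
  for f :: "'n::finite even_gen \<Rightarrow> 'a::comm_monoid_add"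
proof -
  have "inj (V :: 'n \<Rightarrow> _)" by (rule injI) simp
  then show ?thesis
    unfolding UNIV_even_gen by (simp add: image_iff sum.reindex add.assoc)
qed

lemma odd_gen_less [simp]:
  "Y1 < Y2" "Y1 < Y3" "Y2 < Y3" "\<not> Y2 < Y1" "\<not> Y3 < Y1" "\<not> Y3 < Y2"
  "\<not> Z < Y1" "\<not> Z < Y2" "\<not> Z < Y3" "Y1 < Z" "Y2 < Z" "Y3 < Z"
  by (simp_all add: less_odd_gen_def odd_gen_index_def)

lemma cf_ovar: "cf (ovar y) S = (if S = {y} then 1 else 0)"
  by (simp add: ovar_def cf_odd_prod)

lemma qpoly_single_key:
  fixes p :: "'v qpoly"
  assumes "\<And>m. m \<in> keys p \<Longrightarrow> m = m0"
  shows "p = single m0 (lookup p m0)"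
  by (rule poly_mapping_eqI) (metis assms in_keys_iff lookup_single_eq lookup_single_not_eq)

lemma qpoly_sum_superset:
  fixes p :: "'v qpoly"
  assumes "finite K" "keys p \<subseteq> K"
  shows "p = (\<Sum>m\<in>K. single m (lookup p m))"
proof -
  have "(\<Sum>m\<in>keys p. single m (lookup p m)) = (\<Sum>m\<in>K. single m (lookup p m))"
    by (rule sum.mono_neutral_left) (use assms in \<open>auto simp: in_keys_iff\<close>)
  then show ?thesis
    using qpoly_sum_single[of p] by simp
qed

lemma single_conv_qconst: "single m c = qconst c * single m 1"
  by (simp add: qconst_def mult_single)

lemma qpoly_monomial_factor:
  fixes p :: "'v qpoly"
  assumes "\<And>m. m \<in> keys p \<Longrightarrow> \<exists>n. m = m0 + n"
  shows "\<exists>P. p = single m0 1 * P"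
proof
  have "p = (\<Sum>m\<in>keys p. single m (lookup p m))"
    by (rule qpoly_sum_single)
  also have "\<dots> = (\<Sum>m\<in>keys p. single m0 1 * single (m - m0) (lookup p m))"
  proof (rule sum.cong)
    fix m assume "m \<in> keys p"
    then obtain n where "m = m0 + n" using assms by blast
    then show "single m (lookup p m) = single m0 1 * single (m - m0) (lookup p m)"
      by (simp add: mult_single)
  qed simp
  finally show "p = single m0 1 * (\<Sum>m\<in>keys p. single (m - m0) (lookup p m))"
    by (simp add: sum_distrib_left)
qed

lemma homogeneous_monomial_factor:
  assumes "homogeneous A i (even_emb (single m0 1 * P))"
  shows "homogeneous A (i - mon_deg A m0) (even_emb P)"
  unfolding homogeneous_even_emb
proof
  fix n assume "n \<in> keys P"
  then have "m0 + n \<in> keys (single m0 1 * P)"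
    by (simp add: in_keys_iff lookup_single_mult)
  then have "mon_deg A (m0 + n) = i"
    using assms homogeneous_even_emb by blast
  then show "mon_deg A n = i - mon_deg A m0"
    by (simp add: mon_deg_add)
qed

type_synonym 'n model_cga = "('n even_gen, odd_gen) cga"

locale realizable_model =
  fixes r :: nat and q :: "nat \<Rightarrow> 'n::finite qpoly" and k :: int
  assumes realizable: "realizable r q"
    and k_bound: "int (tdeg (q (r + 1))) < 2 * k + (int (tdeg (q 0)) - 1)"
begin

abbreviation "A \<equiv> model r q k"
abbreviation "d \<equiv> tdeg (q 0)"
abbreviation "D i \<equiv> tdeg (q i)"

abbreviation x1 :: "'n even_gen qpoly" where "x1 \<equiv> qvar X1"
abbreviation x2 :: "'n even_gen qpoly" where "x2 \<equiv> qvar X2"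

abbreviation "dy1 \<equiv> x1 ^ 3 * x2"
abbreviation "dy2 \<equiv> x1 ^ 2 * x2 ^ 2"
abbreviation "dy3 \<equiv> x1 * x2 ^ 3"

subsection \<open>Numerical consequences of realizability\<close>

lemma tdeg_diag_form:
  fixes l :: "'n \<Rightarrow> rat"
  assumes "\<And>j. l j \<noteq> 0" "e \<ge> 1"
  shows "tdeg (diag_form l e) = e"
proof -
  have inj: "single i e = single j e \<longleftrightarrow> i = j" for i j :: 'n
    using assms(2) by (metis lookup_single_eq lookup_single_not_eq not_one_le_zero)
  have form: "diag_form l e = (\<Sum>j\<in>UNIV. single (single j e) (l j))"
    unfolding diag_form_def qvar_power by (simp flip: single_conv_qconst)
  have "lookup (diag_form l e) (single j e) = (\<Sum>i\<in>UNIV. if i = j then l i else 0)" for j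
    unfolding form lookup_sum by (rule sum.cong) (auto simp: lookup_single when_def inj)
  then have "single j e \<in> keys (diag_form l e)" for j
    using assms(1) by (simp add: in_keys_iff)
  moreover have "keys (diag_form l e) \<subseteq> range (\<lambda>j. single j e)"
    unfolding form using keys_sum[of "\<lambda>j. single (single j e) (l j)" UNIV] by auto
  ultimately have "keys (diag_form l e) = range (\<lambda>j. single j e)"
    by blast
  moreover have "mdeg (single j e) = e" for j :: 'n
    using assms(2) by (simp add: mdeg_def)
  ultimately have "mdeg ` keys (diag_form l e) = {e}"
    by (simp add: image_image image_constant_conv)
  then show ?thesis by (simp add: tdeg_def)
qed

lemma diagonal:
  obtains l s where "\<And>j. l j \<noteq> 0" "q 0 = diag_form l d" "d \<ge> 2" "s \<ge> 1" "q (r + 1) = diag_form l d ^ s"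
proof -
  obtain e l where e: "e > 1" and l: "\<forall>j. l j \<noteq> 0" and q0: "q 0 = diag_form l e"
    using realizable unfolding realizable_def diag_form_def by blast
  obtain s where "int s \<ge> int CARD('n)" and qs: "q (r + 1) = q 0 ^ s"
    using realizable unfolding realizable_def by auto
  then have "s \<ge> CARD('n)" by simp
  then have "s \<ge> 1"
    using less_le_trans[OF zero_less_card_finite] by fastforce
  moreover have "d = e"
    unfolding q0 by (rule tdeg_diag_form) (use l e in auto)
  ultimately show thesis
    using that[of l s] e l q0 qs by simp
qed

lemma d_ge_2: "d \<ge> 2"
  by (rule diagonal) simp

lemma D_step: "i \<le> r \<Longrightarrow> D i + 2 \<le> D (i + 1)"
  using realizable by (force simp: realizable_def)

lemma D_gap: "i < j \<Longrightarrow> j \<le> r + 1 \<Longrightarrow> D i + 2 \<le> D j"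
proof (induction j)
  case (Suc j)
  then show ?case using D_step[of j] by (cases "i = j") auto
qed simp

lemma D_le: "i \<le> r + 1 \<Longrightarrow> D i \<le> D (r + 1)"
  using D_gap[of i "r + 1"] by (cases "i = r + 1") auto

lemma k_ge_2: "k \<ge> 2"
  using k_bound D_gap[of 0 "r + 1"] by simp

text \<open>The power of \<open>x\<^sub>1\<close> that makes \<open>q\<^sub>i\<close> homogeneous of the degree of \<open>d z\<close>. For
  \<open>i = 0\<close> it is \<open>10 k - 5\<close>, so that the summand \<open>q\<^sub>0 x\<^sub>1\<^bsup>10k-5\<^esup>\<close> of \<open>d z\<close> is the one of
  index 0 in a uniform sum.\<close>

definition ex1 :: "nat \<Rightarrow> nat"
  where "ex1 i = nat (10 * k + 5 * (int d - 1) - 5 * int (D i))"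

lemma int_ex1: "i \<le> r + 1 \<Longrightarrow> int (ex1 i) = 10 * k + 5 * (int d - 1) - 5 * int (D i)"
  using D_le[of i] k_bound by (simp add: ex1_def)

lemma ex1_pos: "i \<le> r + 1 \<Longrightarrow> ex1 i > 0"
  using D_le[of i] k_bound int_ex1[of i] by simp

lemma form: "i \<le> r + 1 \<Longrightarrow> algebraic_form (D i) (q i)"
  using realizable by (simp add: realizable_def)

abbreviation "emb_q i \<equiv> subst qconst (\<lambda>j. qvar (V j)) (q i)"

definition dz_even :: "'n even_gen qpoly"
  where "dz_even = (\<Sum>i\<le>r + 1. emb_q i * x1 ^ ex1 i) + emb_q 0 * x2 ^ nat (8 * k - 4)
    + x1 ^ nat (10 * k + 5 * (int d - 1)) + x2 ^ nat (8 * k + 4 * (int d - 1))"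

abbreviation "ex_odd \<equiv> nat (10 * k + 5 * (int d - 4))"

lemma model_dz_eq: "model_dz r q k = even_emb dz_even +
    evar X1 ^ ex_odd * (ovar Y1 * ovar Y2 * evar X1 ^ 4 * evar X2 ^ 2
      - ovar Y1 * ovar Y3 * evar X1 ^ 5 * evar X2 + ovar Y2 * ovar Y3 * evar X1 ^ 6)"
proof -
  have e0: "nat (10 * k - 5) = ex1 0" by (simp add: ex1_def)
  have "(\<Sum>i\<le>r + 1. emb_q i * x1 ^ ex1 i) =
      emb_q 0 * x1 ^ ex1 0 + (\<Sum>i=1..r + 1. emb_q i * x1 ^ ex1 i)"
    by (simp add: sum.atLeast_Suc_atMost atMost_atLeast0)
  then show ?thesis
    by (simp add: model_dz_def Let_def dz_even_def e0 even_emb_sum evar_def algebra_simps ex1_def)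
qed

subsection \<open>Homogeneous elements\<close>

lemma edeg_A [simp]: "edeg A X1 = 8" "edeg A X2 = 10" "edeg A (V j) = 40"
  and odeg_A [simp]: "odeg A Y1 = 33" "odeg A Y2 = 35" "odeg A Y3 = 37"
    "odeg A Z = 80 * k + 40 * int d - 41"
  and ediff_A [simp]: "ediff A e = 0"
  and odiff_A [simp]: "odiff A Y1 = evar X1 ^ 3 * evar X2"
    "odiff A Y2 = evar X1 ^ 2 * evar X2 ^ 2" "odiff A Y3 = evar X1 * evar X2 ^ 3"
    "odiff A Z = model_dz r q k"
  by (simp_all add: model_def)

lemma mon_deg_A:
  "mon_deg A m = 8 * int (lookup m X1) + 10 * int (lookup m X2) + 40 * int (\<Sum>j\<in>UNIV. lookup m (V j))"
proof -
  have "mon_deg A m = (\<Sum>e\<in>UNIV. int (lookup m e) * edeg A e)"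
    by (rule mon_deg_superset) auto
  then show ?thesis
    by (simp add: sum_even_gen sum_distrib_left mult.commute)
qed

lemma odd_deg_A:
  "odd_deg A S = (if Y1 \<in> S then 33 else 0) + (if Y2 \<in> S then 35 else 0)
    + (if Y3 \<in> S then 37 else 0) + (if Z \<in> S then 80 * k + 40 * int d - 41 else 0)"
proof -
  have "odd_deg A S = (\<Sum>y\<in>{Y1, Y2, Y3, Z}. if y \<in> S then odeg A y else 0)"
    unfolding odd_deg_def by (subst sum.inter_restrict[symmetric])
      (auto intro!: sum.cong simp flip: UNIV_odd_gen)
  then show ?thesis by simp
qed

lemma homogeneous_emb_q: "i \<le> r + 1 \<Longrightarrow> homogeneous A (40 * int (D i)) (even_emb (emb_q i))"
proof -
  assume i: "i \<le> r + 1"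
  define B :: "('n, odd_gen) free_cdga"
    where "B = \<lparr>edeg = \<lambda>_. 40, odeg = \<lambda>_. 1, ediff = \<lambda>_. 0, odiff = \<lambda>_. 0\<rparr>"
  have "mon_deg B m = 40 * int (mdeg m)" for m
    by (simp add: mon_deg_def B_def mdeg_def sum_distrib_left mult.commute)
  moreover have "homogeneous A (edeg B j) (even_emb (qvar (V j)))" for j
    using homogeneous_evar[of A "V j"] by (simp add: B_def evar_def)
  ultimately show ?thesis
    using homogeneous_subst[of A B "\<lambda>j. qvar (V j)" "q i" "40 * int (D i)"] form[OF i]
    by (simp add: algebraic_form_def)
qed

lemma homogeneous_X1: "homogeneous A (8 * int n) (evar X1 ^ n)"
  and homogeneous_X2: "homogeneous A (10 * int n) (evar X2 ^ n)"
  using homogeneous_power[OF homogeneous_evar[of A X1], of n]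
    homogeneous_power[OF homogeneous_evar[of A X2], of n]
  by (simp_all add: mult.commute)

lemma homogeneous_cong: "homogeneous B i a \<Longrightarrow> i = j \<Longrightarrow> homogeneous B j a"
  by simp

abbreviation "zdeg \<equiv> 80 * k + 40 * int d - 41"

lemma homogeneous_dz_even: "homogeneous A (zdeg + 1) (even_emb dz_even)"
proof -
  have "homogeneous A (zdeg + 1) (even_emb (emb_q i) * evar X1 ^ ex1 i)" if "i \<le> r + 1" for i
    by (rule homogeneous_cong[OF homogeneous_mult[OF homogeneous_emb_q[OF that] homogeneous_X1]])
      (simp add: int_ex1[OF that])
  moreover have "homogeneous A (zdeg + 1) (even_emb (emb_q 0) * evar X2 ^ nat (8 * k - 4))"
    by (rule homogeneous_cong[OF homogeneous_mult[OF homogeneous_emb_q homogeneous_X2]])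
      (use k_ge_2 in simp_all)
  moreover have "homogeneous A (zdeg + 1) (evar X1 ^ nat (10 * k + 5 * (int d - 1)))"
    by (rule homogeneous_cong[OF homogeneous_X1]) (use k_ge_2 in simp)
  moreover have "homogeneous A (zdeg + 1) (evar X2 ^ nat (8 * k + 4 * (int d - 1)))"
    by (rule homogeneous_cong[OF homogeneous_X2]) (use k_ge_2 in simp)
  ultimately show ?thesis
    unfolding dz_even_def even_emb_hom even_emb_sum even_emb_power evar_def[symmetric]
    by (intro homogeneous_add homogeneous_sum) auto
qed

lemma homogeneous_model_dz: "homogeneous A (zdeg + 1) (model_dz r q k)"
proof -
  have yy: "homogeneous A (odeg A y + odeg A y' + 8 * int i + 10 * int j)
      (ovar y * ovar y' * evar X1 ^ i * evar X2 ^ j)" for y y' i j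
    by (intro homogeneous_mult homogeneous_ovar homogeneous_X1 homogeneous_X2)
  have "homogeneous A 120 (ovar Y1 * ovar Y2 * evar X1 ^ 4 * evar X2 ^ 2)"
    using yy[of Y1 Y2 4 2] by simp
  moreover have "homogeneous A 120 (ovar Y1 * ovar Y3 * evar X1 ^ 5 * evar X2)"
    using yy[of Y1 Y3 5 1] by simp
  moreover have "homogeneous A 120 (ovar Y2 * ovar Y3 * evar X1 ^ 6)"
    using yy[of Y2 Y3 6 0] by simp
  ultimately have "homogeneous A 120 (ovar Y1 * ovar Y2 * evar X1 ^ 4 * evar X2 ^ 2
      - ovar Y1 * ovar Y3 * evar X1 ^ 5 * evar X2 + ovar Y2 * ovar Y3 * evar X1 ^ 6)"
    by (intro homogeneous_add homogeneous_diff)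
  from homogeneous_mult[OF homogeneous_X1[of ex_odd] this]
  have "homogeneous A (zdeg + 1) (evar X1 ^ ex_odd * (ovar Y1 * ovar Y2 * evar X1 ^ 4 * evar X2 ^ 2
      - ovar Y1 * ovar Y3 * evar X1 ^ 5 * evar X2 + ovar Y2 * ovar Y3 * evar X1 ^ 6))"
    by (rule homogeneous_cong) (use k_ge_2 d_ge_2 in simp)
  then show ?thesis
    unfolding model_dz_eq by (intro homogeneous_add homogeneous_dz_even)
qed

sublocale graded_cdga A
proof
  show "even (edeg A e)" for e by (cases e) simp_all
  show "odd (odeg A y)" for y by (cases y) simp_all
  show "homogeneous A (edeg A e + 1) (ediff A e)" for e by simp
  show "homogeneous A (odeg A y + 1) (odiff A y)" for y
  proof (cases y)
    case Y1
    then show ?thesis using homogeneous_mult[OF homogeneous_X1[of 3] homogeneous_X2[of 1]] by simp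
  next
    case Y2
    then show ?thesis using homogeneous_mult[OF homogeneous_X1[of 2] homogeneous_X2[of 2]] by simp
  next
    case Y3
    then show ?thesis using homogeneous_mult[OF homogeneous_X1[of 1] homogeneous_X2[of 3]] by simp
  next
    case Z
    then show ?thesis using homogeneous_model_dz by simp
  qed
qed

lemma cdiff_even_emb_A [simp]: "cdiff A (even_emb p) = 0"
  by (simp add: cdiff_even_emb dpoly_def)

lemma cdiff_even_emb_mult_A [simp]: "cdiff A (even_emb p * a) = even_emb p * cdiff A a"
  by (simp add: cdiff_mult invol_evenp)

end

lemma ovar_mult_ovar:
  fixes y y' :: "'o::{finite, linorder}"
  assumes "y < y'"
  shows "ovar y * ovar y' = odd_prod {y, y'}"
proof -
  have e: "{t \<in> {y'}. t < y} = {}" using assms by auto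
  show ?thesis
    using assms by (subst ovar_def[of y'], subst ovar_odd_prod, subst e) auto
qed

lemma y_products:
  "ovar Y1 * ovar Y2 = odd_prod {Y1, Y2}" "ovar Y1 * ovar Y3 = odd_prod {Y1, Y3}"
  "ovar Y2 * ovar Y3 = odd_prod {Y2, Y3}" "ovar Y1 * odd_prod {Y2, Y3} = odd_prod {Y1, Y2, Y3}"
proof -
  have e: "{t \<in> {Y2, Y3}. t < Y1} = {}" by auto
  show "ovar Y1 * odd_prod {Y2, Y3} = odd_prod {Y1, Y2, Y3}"
    by (subst ovar_odd_prod, subst e) simp
qed (simp_all add: ovar_mult_ovar)

context realizable_model
begin

subsection \<open>Elements of low degree\<close>

lemma cf_eq_0I: "(\<And>m. m \<in> keys (cf a S) \<Longrightarrow> False) \<Longrightarrow> cf a S = 0"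
  by (metis in_keys_iff lookup_zero poly_mapping_eqI)

text \<open>The degree of a monomial in \<open>A\<close> depends only on its exponents of \<open>x\<^sub>1\<close> and
  \<open>x\<^sub>2\<close>, on its total exponent in the \<open>v\<^sub>j\<close> and on its odd generators. The shape of the elements
  of a given degree is thus a question about a linear Diophantine equation.\<close>

definition vdeg :: "('n even_gen \<Rightarrow>\<^sub>0 nat) \<Rightarrow> nat"
  where "vdeg m = (\<Sum>j\<in>UNIV. lookup m (V j))"

lemma vdeg_0: "vdeg m = 0 \<Longrightarrow> lookup m (V j) = 0"
  by (simp add: vdeg_def)

lemma homogeneous_key:
  assumes "homogeneous A i a" "m \<in> keys (cf a S)"
  shows "8 * int (lookup m X1) + 10 * int (lookup m X2) + 40 * int (vdeg m) +
    ((if Y1 \<in> S then 33 else 0) + (if Y2 \<in> S then 35 else 0)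
      + (if Y3 \<in> S then 37 else 0) + (if Z \<in> S then zdeg else 0)) = i"
  using assms unfolding homogeneous_iff mon_deg_A odd_deg_A vdeg_def by blast

lemma monomial_eqI:
  fixes m m' :: "'n even_gen \<Rightarrow>\<^sub>0 nat"
  assumes "lookup m X1 = lookup m' X1" "lookup m X2 = lookup m' X2"
    and "\<And>j. lookup m (V j) = lookup m' (V j)"
  shows "m = m'"
  by (rule poly_mapping_eqI) (metis assms even_gen.exhaust)

lemma even_emb_if_component: "(\<And>S. S \<noteq> {} \<Longrightarrow> cf a S = 0) \<Longrightarrow> a = even_emb (cf a {})"
  by (rule cga_eqI) (simp add: cf_even_emb)

lemma zdeg_large: "zdeg \<ge> 199"
  using k_ge_2 d_ge_2 by simp

lemma odd_set_eq: "S = T \<longleftrightarrow> (Y1 \<in> S \<longleftrightarrow> Y1 \<in> T) \<and> (Y2 \<in> S \<longleftrightarrow> Y2 \<in> T) \<and> (Y3 \<in> S \<longleftrightarrow> Y3 \<in> T) \<and> (Z \<in> S \<longleftrightarrow> Z \<in> T)"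
  unfolding set_eq_iff by (rule all_odd_gen)

lemma low_degree_arith:
  fixes w i :: int and \<alpha> \<beta> \<nu> :: nat
  assumes deg: "8 * int \<alpha> + 10 * int \<beta> + 40 * int \<nu> + ((if y1 then 33 else 0) + (if y2 then 35 else 0)
      + (if y3 then 37 else 0) + (if z then w else 0)) = i"
    and w: "w \<ge> 199" and i: "i \<in> {8, 10, 40}"
  shows "\<not> y1 \<and> \<not> y2 \<and> \<not> y3 \<and> \<not> z"
proof -
  have i': "i \<le> 40" "even i" using i by auto
  have z: "\<not> z" using deg w i' by (auto split: if_splits)
  show ?thesis
  proof (rule ccontr)
    assume "\<not> ?thesis"
    then consider "y1" "\<not> y2" "\<not> y3" | "\<not> y1" "y2" "\<not> y3" | "\<not> y1" "\<not> y2" "y3"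
      using z deg i' by (cases y1; cases y2; cases y3; simp)
    then have "odd ((if y1 then 33 else 0) + (if y2 then 35 else 0) + (if y3 then 37 else 0) :: int)"
      by cases simp_all
    moreover have "even (8 * int \<alpha> + 10 * int \<beta> + 40 * int \<nu>)" by simp
    ultimately have "odd i" using deg z by auto
    then show False using i' by simp
  qed
qed

lemma low_degree_component:
  assumes "homogeneous A i a" "i \<in> {8, 10, 40}" "S \<noteq> {}"
  shows "cf a S = 0"
proof (rule cf_eq_0I)
  fix m assume "m \<in> keys (cf a S)"
  from low_degree_arith[OF homogeneous_key[OF assms(1) this] zdeg_large assms(2)] show False
    using assms(3) unfolding odd_set_eq[of S] by simp
qed

lemma degree_single:
  assumes a: "homogeneous A i a" and i: "i \<in> {8, 10, 40}"
    and key: "\<And>m. 8 * int (lookup m X1) + 10 * int (lookup m X2) + 40 * int (vdeg m) = i \<Longrightarrow> m = single e 1"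
  shows "\<exists>c. a = even_emb (qconst c * qvar e)"
proof -
  have "cf a {} = single (single e 1) (lookup (cf a {}) (single e 1))"
    by (rule qpoly_single_key, rule key) (use homogeneous_key[OF a, of _ "{}"] in simp)
  moreover have "a = even_emb (cf a {})"
    by (rule even_emb_if_component, rule low_degree_component[OF a i])
  ultimately show ?thesis
    by (metis qvar_def single_conv_qconst)
qed

lemma degree_8:
  assumes "homogeneous A 8 a"
  shows "\<exists>c. a = even_emb (qconst c * x1)"
proof (rule degree_single[OF assms])
  fix m
  assume *: "8 * int (lookup m X1) + 10 * int (lookup m X2) + 40 * int (vdeg m) = 8"
  then have "lookup m X2 = 0" "vdeg m = 0" by linarith+
  with * show "m = single X1 1"
    by (intro monomial_eqI) (auto simp: lookup_single vdeg_0)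
qed simp

lemma degree_10:
  assumes "homogeneous A 10 a"
  shows "\<exists>c. a = even_emb (qconst c * x2)"
proof (rule degree_single[OF assms])
  fix m
  assume *: "8 * int (lookup m X1) + 10 * int (lookup m X2) + 40 * int (vdeg m) = 10"
  then have "vdeg m = 0" "lookup m X1 \<le> 1" "lookup m X2 \<le> 1" by linarith+
  with * show "m = single X2 1"
    by (intro monomial_eqI) (auto simp: lookup_single vdeg_0 le_Suc_eq)
qed simp

lemma y_degree_arith:
  fixes w i :: int and \<alpha> \<beta> \<nu> :: nat
  assumes "8 * int \<alpha> + 10 * int \<beta> + 40 * int \<nu> + ((if y1 then 33 else 0) + (if y2 then 35 else 0)
      + (if y3 then 37 else 0) + (if z then w else 0)) = i"
    and "w \<ge> 199" "i \<in> {33, 35, 37}"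
  shows "\<alpha> = 0 \<and> \<beta> = 0 \<and> \<nu> = 0 \<and> (y1 \<longleftrightarrow> i = 33) \<and> (y2 \<longleftrightarrow> i = 35) \<and> (y3 \<longleftrightarrow> i = 37) \<and> \<not> z"
proof -
  have z: "\<not> z" using assms by (auto split: if_splits)
  have "y1 \<or> y2 \<or> y3"
  proof (rule ccontr)
    assume "\<not> (y1 \<or> y2 \<or> y3)"
    then have "i = 2 * (4 * int \<alpha> + 5 * int \<beta> + 20 * int \<nu>)"
      using assms(1) z by simp
    then have "even i" by simp
    then show False using assms(3) by auto
  qed
  then have "8 * int \<alpha> + 10 * int \<beta> + 40 * int \<nu> \<le> 4"
    using assms(1,3) z by (auto split: if_splits)
  then have "\<alpha> = 0" "\<beta> = 0" "\<nu> = 0" by linarith+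
  then show ?thesis using assms(1,3) z by (auto split: if_splits)
qed

lemma degree_y:
  assumes a: "homogeneous A (odeg A y) a" and y: "y \<in> {Y1, Y2, Y3}"
  shows "\<exists>c. a = even_emb (qconst c) * ovar y"
proof -
  have key: "S = {y} \<and> m = 0" if "m \<in> keys (cf a S)" for S m
  proof -
    have "S = {y} \<and> lookup m X1 = 0 \<and> lookup m X2 = 0 \<and> vdeg m = 0"
      unfolding odd_set_eq[of S]
      using y_degree_arith[OF homogeneous_key[OF a that] zdeg_large] y by auto
    then show ?thesis
      by (auto intro!: monomial_eqI simp: vdeg_0)
  qed
  have "a = even_emb (qconst (lookup (cf a {y}) 0)) * ovar y"
  proof (rule cga_eqI)
    fix S
    show "cf a S = cf (even_emb (qconst (lookup (cf a {y}) 0)) * ovar y) S"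
    proof (cases "S = {y}")
      case True
      have "cf a {y} = single 0 (lookup (cf a {y}) 0)"
        by (rule qpoly_single_key) (use key in blast)
      then show ?thesis using True by (simp add: cf_ovar qconst_def)
    next
      case False
      then have "cf a S = 0" using key by (intro cf_eq_0I) blast
      then show ?thesis using False by (simp add: cf_ovar)
    qed
  qed
  then show ?thesis ..
qed

definition lin_form :: "('n \<Rightarrow> 'n \<Rightarrow> rat) \<Rightarrow> 'n \<Rightarrow> 'n even_gen qpoly"
  where "lin_form L j = (\<Sum>l\<in>UNIV. qconst (L j l) * qvar (V l))"

definition lin_coeff :: "'n model_cga \<Rightarrow> 'n \<Rightarrow> rat"
  where "lin_coeff a l = lookup (cf a {}) (single (V l) 1)"

lemma degree_40:
  assumes a: "homogeneous A 40 a"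
  shows "\<exists>b c. a = even_emb (qconst b * x1 ^ 5 + qconst c * x2 ^ 4
    + (\<Sum>l\<in>UNIV. qconst (lin_coeff a l) * qvar (V l)))"
proof -
  let ?p = "cf a {}"
  let ?K = "insert (single X1 5) (insert (single X2 4) (range (\<lambda>l. single (V l) 1)))"
  have "keys ?p \<subseteq> ?K"
  proof
    fix m assume "m \<in> keys ?p"
    from homogeneous_key[OF a this]
    have *: "8 * int (lookup m X1) + 10 * int (lookup m X2) + 40 * int (vdeg m) = 40"
      by simp
    then have "lookup m X2 \<le> 4" by linarith
    then have "lookup m X2 = 0 \<or> lookup m X2 = 1 \<or> lookup m X2 = 2 \<or> lookup m X2 = 3 \<or> lookup m X2 = 4"
      by linarith
    with * have "(lookup m X1 = 5 \<and> lookup m X2 = 0 \<and> vdeg m = 0)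
      \<or> (lookup m X1 = 0 \<and> lookup m X2 = 4 \<and> vdeg m = 0)
      \<or> (lookup m X1 = 0 \<and> lookup m X2 = 0 \<and> vdeg m = 1)"
      by (elim disjE; simp; presburger)
    then consider "lookup m X1 = 5 \<and> lookup m X2 = 0 \<and> vdeg m = 0"
      | "lookup m X1 = 0 \<and> lookup m X2 = 4 \<and> vdeg m = 0"
      | "lookup m X1 = 0 \<and> lookup m X2 = 0 \<and> vdeg m = 1"
      by blast
    then show "m \<in> ?K"
    proof cases
      case 1
      then have "m = single X1 5" by (intro monomial_eqI) (auto simp: lookup_single vdeg_0)
      then show ?thesis by simp
    next
      case 2
      then have "m = single X2 4" by (intro monomial_eqI) (auto simp: lookup_single vdeg_0)
      then show ?thesis by simp
    next
      case 3
      then obtain l where l: "lookup m (V l) = 1" "\<And>j. j \<noteq> l \<Longrightarrow> lookup m (V j) = 0"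
        by (auto simp: vdeg_def sum_eq_Suc0_iff)
      have "m = single (V l) 1"
        using 3 l by (intro monomial_eqI) (auto simp: lookup_single when_def)
      then show ?thesis by simp
    qed
  qed
  then have p: "?p = (\<Sum>m\<in>?K. single m (lookup ?p m))"
    by (intro qpoly_sum_superset) auto
  have ne: "single X1 5 \<noteq> single X2 (4 :: nat)" "single X1 5 \<noteq> single (V l) (1 :: nat)"
    "single X2 4 \<noteq> single (V l) (1 :: nat)" for l :: 'n
    by (metis even_gen.distinct lookup_single_eq lookup_single_not_eq zero_neq_numeral)+
  have inj: "inj (\<lambda>l :: 'n. single (V l) (1 :: nat))"
    by (rule injI) (metis even_gen.inject lookup_single_eq lookup_single_not_eq zero_neq_one)
  have "?p = single (single X1 5) (lookup ?p (single X1 5)) + single (single X2 4) (lookup ?p (single X2 4))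
      + (\<Sum>l\<in>UNIV. single (single (V l) 1) (lookup ?p (single (V l) 1)))"
    by (subst p) (simp add: ne image_iff sum.reindex[OF inj] add.assoc del: One_nat_def)
  also have "\<dots> = qconst (lookup ?p (single X1 5)) * x1 ^ 5 + qconst (lookup ?p (single X2 4)) * x2 ^ 4
      + (\<Sum>l\<in>UNIV. qconst (lin_coeff a l) * qvar (V l))"
    unfolding qvar_power by (simp only: qvar_def lin_coeff_def flip: single_conv_qconst)
  finally have p': "?p = \<dots>" .
  have "a = even_emb ?p"
    by (rule even_emb_if_component, rule low_degree_component[OF a]) simp_all
  from trans[OF this arg_cong[OF p', of even_emb]] show ?thesis by blast
qed

text \<open>The smallest natural number in a residue class; it turns the congruences for the
  exponents of \<open>x\<^sub>1\<close> modulo 5 and of \<open>x\<^sub>2\<close> modulo 4 into divisibility by monomials.\<close>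

lemma residue_le:
  fixes c N x :: nat and u :: int
  assumes "int x = int N * u + int c" "c < N"
  shows "c \<le> x"
proof -
  have "int x mod int N = int c"
    using assms by simp
  then show ?thesis
    by (metis mod_less_eq_dividend of_nat_mod of_nat_eq_iff)
qed

text \<open>Since the degree of \<open>z\<close> is odd, every other monomial of that degree has one or three of
  the \<open>y\<^sub>i\<close>. Read modulo 40, the equation for the degree fixes the exponent of \<open>x\<^sub>1\<close> modulo 5
  and that of \<open>x\<^sub>2\<close> modulo 4, which gives the monomial factors of the coefficients of
  \<open>y\<^sub>2\<close> and \<open>y\<^sub>3\<close>.\<close>

lemma degree_z:
  assumes a: "homogeneous A zdeg a"
  shows "\<exists>c B A1 A2 A3. a = even_emb (qconst c) * ovar Z + even_emb A1 * ovar Y1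
      + even_emb (x1 ^ 3 * x2 ^ 2 * A2) * ovar Y2
      + even_emb (x1 ^ 4 * x2 * A3) * ovar Y3
      + even_emb B * (ovar Y1 * (ovar Y2 * ovar Y3)) \<and> cf a {Z} = qconst c"
proof -
  have key: "(S = {Z} \<and> m = 0) \<or> S = {Y1} \<or> (S = {Y2} \<and> lookup m X1 \<ge> 3 \<and> lookup m X2 \<ge> 2)
      \<or> (S = {Y3} \<and> lookup m X1 \<ge> 4 \<and> lookup m X2 \<ge> 1) \<or> S = {Y1, Y2, Y3}"
    if m: "m \<in> keys (cf a S)" for S m
  proof -
    note deg = homogeneous_key[OF a m]
    show ?thesis
    proof (cases "Z \<in> S")
      case True
      have "lookup m X1 = 0 \<and> lookup m X2 = 0 \<and> vdeg m = 0 \<and> Y1 \<notin> S \<and> Y2 \<notin> S \<and> Y3 \<notin> S"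
        using deg True by (cases "Y1 \<in> S"; cases "Y2 \<in> S"; cases "Y3 \<in> S"; simp)
      then have "S = {Z} \<and> m = 0"
        unfolding odd_set_eq[of S] using True by (auto intro!: monomial_eqI simp: vdeg_0)
      then show ?thesis by simp
    next
      case False
      define t where "t = 2 * k + int d - int (vdeg m)"
      have deg': "8 * int (lookup m X1) + 10 * int (lookup m X2) + ((if Y1 \<in> S then 33 else 0) + (if Y2 \<in> S then 35 else 0)
          + (if Y3 \<in> S then 37 else 0)) = 40 * t - 41"
        using deg False by (simp add: t_def)
      consider "Y1 \<in> S \<and> Y2 \<notin> S \<and> Y3 \<notin> S" | "Y1 \<notin> S \<and> Y2 \<in> S \<and> Y3 \<notin> S"
        | "Y1 \<notin> S \<and> Y2 \<notin> S \<and> Y3 \<in> S" | "Y1 \<in> S \<and> Y2 \<in> S \<and> Y3 \<in> S"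
      proof -
        have "((if Y1 \<in> S then 33 else 0) + (if Y2 \<in> S then 35 else 0) + (if Y3 \<in> S then 37 else 0) :: int)
            = 2 * (20 * t - 21 - 4 * int (lookup m X1) - 5 * int (lookup m X2)) + 1"
          using deg' by simp
        then have "odd ((if Y1 \<in> S then 33 else 0) + (if Y2 \<in> S then 35 else 0)
            + (if Y3 \<in> S then 37 else 0) :: int)"
          by simp
        then show ?thesis
          using that by (cases "Y1 \<in> S"; cases "Y2 \<in> S"; cases "Y3 \<in> S"; simp)
      qed
      then show ?thesis
      proof cases
        case 1
        then show ?thesis unfolding odd_set_eq[of S] using False by simp
      next
        case 2
        then have "4 * int (lookup m X1) + 5 * int (lookup m X2) = 20 * t - 38"
          using deg' by simp
        then have e2: "int (lookup m X2) = int 4 * (5 * t - int (lookup m X1) - int (lookup m X2) - 10) + int 2"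
          and e1: "int (lookup m X1) = int 5 * (int (lookup m X1) + int (lookup m X2) - 4 * t + 7) + int 3"
          by simp_all
        then have "lookup m X1 \<ge> 3 \<and> lookup m X2 \<ge> 2"
          using residue_le[OF e1] residue_le[OF e2] by simp
        then show ?thesis unfolding odd_set_eq[of S] using 2 False by simp
      next
        case 3
        then have "4 * int (lookup m X1) + 5 * int (lookup m X2) = 20 * t - 39"
          using deg' by simp
        then have e2: "int (lookup m X2) = int 4 * (5 * t - int (lookup m X1) - int (lookup m X2) - 10) + int 1"
          and e1: "int (lookup m X1) = int 5 * (int (lookup m X1) + int (lookup m X2) - 4 * t + 7) + int 4"
          by simp_all
        then have "lookup m X1 \<ge> 4 \<and> lookup m X2 \<ge> 1"
          using residue_le[OF e1] residue_le[OF e2] by simp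
        then show ?thesis unfolding odd_set_eq[of S] using 3 False by simp
      next
        case 4
        then show ?thesis unfolding odd_set_eq[of S] using False by simp
      qed
    qed
  qed
  have factor: "\<exists>P. p = x1 ^ i * x2 ^ j * P"
    if "\<And>m. m \<in> keys p \<Longrightarrow> lookup m X1 \<ge> i \<and> lookup m X2 \<ge> j" for p :: "'n even_gen qpoly" and i j
  proof -
    let ?m0 = "single X1 i + single X2 j :: 'n even_gen \<Rightarrow>\<^sub>0 nat"
    have "\<exists>P. p = single ?m0 1 * P"
    proof (rule qpoly_monomial_factor)
      fix m assume "m \<in> keys p"
      then have "m = ?m0 + (m - ?m0)"
        using that[of m] by (intro monomial_eqI) (auto simp: lookup_add lookup_minus lookup_single)
      then show "\<exists>n. m = ?m0 + n" ..
    qed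
    moreover have "single ?m0 1 = x1 ^ i * x2 ^ j"
      by (simp add: qvar_power mult_single)
    ultimately show ?thesis by simp
  qed
  have "\<exists>A2. cf a {Y2} = x1 ^ 3 * x2 ^ 2 * A2"
    by (rule factor) (use key[of _ "{Y2}"] in auto)
  then obtain A2 where A2: "cf a {Y2} = x1 ^ 3 * x2 ^ 2 * A2" ..
  have "\<exists>A3. cf a {Y3} = x1 ^ 4 * x2 ^ 1 * A3"
    by (rule factor) (use key[of _ "{Y3}"] in auto)
  then obtain A3 where A3: "cf a {Y3} = x1 ^ 4 * x2 * A3" by auto
  define c where "c = lookup (cf a {Z}) 0"
  have "cf a {Z} = single 0 c"
    unfolding c_def by (rule qpoly_single_key) (use key[of _ "{Z}"] in auto)
  then have c: "cf a {Z} = qconst c" by (simp add: qconst_def)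
  have zero: "cf a S = 0" if "S \<notin> {{Z}, {Y1}, {Y2}, {Y3}, {Y1, Y2, Y3}}" for S
    by (rule cf_eq_0I) (use key that in blast)
  have "a = even_emb (cf a {Z}) * ovar Z + even_emb (cf a {Y1}) * ovar Y1 + even_emb (cf a {Y2}) * ovar Y2
      + even_emb (cf a {Y3}) * ovar Y3 + even_emb (cf a {Y1, Y2, Y3}) * (ovar Y1 * (ovar Y2 * ovar Y3))"
  proof (rule cga_eqI)
    fix S
    have yyy: "cf (ovar Y1 * (ovar Y2 * ovar Y3) :: 'n model_cga) S = (if S = {Y1, Y2, Y3} then 1 else 0)"
      by (simp add: y_products cf_odd_prod)
    show "cf a S = cf (even_emb (cf a {Z}) * ovar Z + even_emb (cf a {Y1}) * ovar Y1 + even_emb (cf a {Y2}) * ovar Y2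
      + even_emb (cf a {Y3}) * ovar Y3 + even_emb (cf a {Y1, Y2, Y3}) * (ovar Y1 * (ovar Y2 * ovar Y3))) S"
    proof (cases "S \<in> {{Z}, {Y1}, {Y2}, {Y3}, {Y1, Y2, Y3}}")
      case True
      then show ?thesis by (auto simp: cf_ovar yyy odd_set_eq[of "{_}"] odd_set_eq[of "{_, _, _}"])
    next
      case False
      then show ?thesis by (auto simp: cf_ovar yyy zero[OF False])
    qed
  qed
  then show ?thesis
    unfolding A2 A3 c using c by blast
qed

end

text \<open>With \<open>t = a\<^sub>2 / a\<^sub>1\<close> the first equation gives \<open>a\<^sub>1 = t\<^sup>5\<close> and \<open>a\<^sub>2 = t\<^sup>6\<close>. The second
  one becomes \<open>t\<^sup>n = 1\<close>, whose only rational solution is \<open>t = 1\<close> as \<open>n\<close> is odd.\<close>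

lemma rigid_scalars:
  fixes a1 a2 :: rat
  assumes "a1 \<noteq> 0" "a2 \<noteq> 0" and 6: "a1 ^ 6 = a2 ^ 5" and n: "a1 ^ (5 * n) = a2 ^ (4 * n)" and "odd n"
  shows "a1 = 1" "a2 = 1"
proof -
  define t where "t = a2 / a1"
  have a1: "a1 = t ^ 5"
  proof -
    have "t ^ 5 * a1 ^ 5 = a1 * a1 ^ 5"
      using assms(1) 6 by (simp add: t_def power_divide flip: power_Suc)
    then show ?thesis using assms(1) by simp
  qed
  have a2: "a2 = t ^ 6"
  proof -
    have "a2 = t * a1" using assms(1) by (simp add: t_def)
    also have "\<dots> = t * t ^ 5" by (simp only: a1[symmetric])
    finally show ?thesis by (simp flip: power_Suc)
  qed
  have t: "t \<noteq> 0" using assms by (simp add: t_def)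
  have "t ^ (5 * (5 * n)) = t ^ (6 * (4 * n))"
    using n unfolding a1 a2 by (simp add: power_mult)
  moreover have "5 * (5 * n) = n + 6 * (4 * n)" by simp
  ultimately have "t ^ n * t ^ (6 * (4 * n)) = t ^ (6 * (4 * n))"
    by (metis power_add)
  then have tn: "t ^ n = 1" using t by simp
  have "\<not> t < 0"
    using tn \<open>odd n\<close> power_less_zero_eq[of t n] by simp
  then have "t = 1"
    using tn \<open>odd n\<close> by (intro power_eq_imp_eq_base[of t n 1]) (auto simp: odd_pos)
  then show "a1 = 1" "a2 = 1" using a1 a2 by simp_all
qed

lemma even_emb_mult_swap: "(even_emb p * a) * (even_emb p' * b) = even_emb (p * p') * (a * b)"
proof -
  have "(even_emb p * a) * (even_emb p' * b) = even_emb p * (a * even_emb p') * b"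
    by (simp only: mult.assoc)
  then show ?thesis
    by (simp only: even_emb_commute[of a] even_emb_hom mult.assoc)
qed

lemma mult_even_emb_mult: "a * (even_emb p * b) = even_emb p * (a * b)"
  using even_emb_mult_swap[of 1 a p b] by simp

lemma peval_unit_vec_diag_form:
  assumes "e \<ge> 1"
  shows "peval (unit_vec j) (diag_form l e) = l j"
proof -
  have "peval (unit_vec j) (diag_form l e) = (\<Sum>i\<in>UNIV. if i = j then l j else 0)"
    unfolding diag_form_def peval_sum
    by (rule sum.cong) (use assms in \<open>auto simp: unit_vec_def power_0_left\<close>)
  then show ?thesis by simp
qed

context realizable_model
begin

subsection \<open>Automorphisms\<close>

lemma odiff_even [simp]:
  "odiff A Y1 = even_emb dy1" "odiff A Y2 = even_emb dy2"
  "odiff A Y3 = even_emb dy3"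
  by (simp_all add: evar_def)

lemma model_dz_components: "model_dz r q k = even_emb dz_even
    + even_emb (x1 ^ ex_odd * (x1 ^ 4 * x2 ^ 2)) * odd_prod {Y1, Y2}
    - even_emb (x1 ^ ex_odd * (x1 ^ 5 * x2)) * odd_prod {Y1, Y3}
    + even_emb (x1 ^ ex_odd * x1 ^ 6) * odd_prod {Y2, Y3}"
proof -
  have t: "a * evar X1 ^ i * evar X2 ^ j = even_emb (x1 ^ i * x2 ^ j) * a"
    for a :: "'n model_cga" and i j
    unfolding evar_def even_emb_power[symmetric]
    by (rule cga_eqI, simp only: cf_mult_even_emb cf_even_emb_mult, simp only: mult_ac)
  have x: "evar X1 ^ ex_odd = (even_emb (x1 ^ ex_odd) :: 'n model_cga)"
    by (simp add: evar_def)
  show ?thesis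
    unfolding model_dz_eq x using t[of "ovar Y1 * ovar Y2" 4 2] t[of "ovar Y1 * ovar Y3" 5 1]
      t[of "ovar Y2 * ovar Y3" 6 0]
    by (simp add: y_products distrib_left right_diff_distrib mult.assoc)
qed

lemma cdiff_y123: "cdiff A (ovar Y1 * (ovar Y2 * ovar Y3)) =
    even_emb dy1 * odd_prod {Y2, Y3} - even_emb dy2 * odd_prod {Y1, Y3}
    + even_emb dy3 * odd_prod {Y1, Y2}"
proof -
  have d: "cdiff A (odd_prod {Y2, Y3}) = even_emb dy2 * ovar Y3
      - even_emb dy3 * ovar Y2"
    unfolding y_products(3)[symmetric] cdiff_ovar_mult cdiff_ovar odiff_even
    by (simp only: even_emb_commute[of "ovar _"])
  have "cdiff A (ovar Y1 * odd_prod {Y2, Y3}) = even_emb dy1 * odd_prod {Y2, Y3}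
      - (even_emb dy2 * odd_prod {Y1, Y3} - even_emb dy3 * odd_prod {Y1, Y2})"
    by (simp only: cdiff_ovar_mult cdiff_ovar odiff_even)
      (simp only: d right_diff_distrib mult_even_emb_mult y_products)
  then show ?thesis
    unfolding y_products(3) by (simp only: diff_diff_eq2 diff_add_eq)
qed

lemma cdiff_zdeg: "cdiff A (even_emb c * ovar Z + even_emb A1 * ovar Y1 + even_emb A2 * ovar Y2
      + even_emb A3 * ovar Y3 + even_emb B * (ovar Y1 * (ovar Y2 * ovar Y3))) =
    even_emb c * model_dz r q k + even_emb (A1 * dy1
      + A2 * dy2 + A3 * dy3)
    + even_emb B * (even_emb dy1 * odd_prod {Y2, Y3}
      - even_emb dy2 * odd_prod {Y1, Y3} + even_emb dy3 * odd_prod {Y1, Y2})"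
  by (simp only: cdiff_add cdiff_even_emb_mult_A cdiff_y123 cdiff_ovar odiff_even odiff_A(4) even_emb_hom add.assoc)

lemma peval_dz_even: "peval x dz_even = (\<Sum>i\<le>r + 1. peval (\<lambda>j. x (V j)) (q i) * x X1 ^ ex1 i)
    + peval (\<lambda>j. x (V j)) (q 0) * x X2 ^ nat (8 * k - 4)
    + x X1 ^ nat (10 * k + 5 * (int d - 1)) + x X2 ^ nat (8 * k + 4 * (int d - 1))"
  by (simp add: dz_even_def peval_sum peval_subst)

definition mat :: "('n model_cga \<Rightarrow> 'n model_cga) \<Rightarrow> 'n \<Rightarrow> 'n \<Rightarrow> rat"
  where "mat \<phi> j = lin_coeff (\<phi> (evar (V j)))"

text \<open>Injectivity of \<open>\<phi>\<close> enters through \<open>\<phi> x\<^sub>1 \<noteq> 0\<close> and \<open>\<phi> x\<^sub>2 \<noteq> 0\<close>. The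
  coefficient \<open>a\<close> of \<open>z\<close> in \<open>\<phi> z\<close> is then nonzero because it is a monomial in the scalars
  \<open>a\<^sub>1\<close>, \<open>a\<^sub>2\<close> of \<open>x\<^sub>1\<close>, \<open>x\<^sub>2\<close>. Comparing forms at \<open>x\<^sub>2 = 0\<close> and at \<open>x\<^sub>1 = 0\<close> expresses
  \<open>a\<close> as a power of \<open>a\<^sub>1\<close> and of \<open>a\<^sub>2\<close>; moreover \<open>q\<^sub>0\<close> occurs in both comparisons, with
  the factors \<open>a\<^sub>1\<^bsup>10k-5\<^esup>\<close> and \<open>a\<^sub>2\<^bsup>8k-4\<^esup>\<close>, which must therefore be equal.\<close>

theorem automorphism_normal_form:
  assumes hom: "cdga_hom A A \<phi>" and inj: "inj \<phi>"
  shows "\<phi> (evar X1) = evar X1" and "\<phi> (evar X2) = evar X2"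
    and "\<phi> (evar (V j)) = even_emb (lin_form (mat \<phi>) j)"
    and "y \<noteq> Z \<Longrightarrow> \<phi> (ovar y) = ovar y" and "cf (\<phi> (ovar Z)) {Z} = 1"
    and "i \<le> r + 1 \<Longrightarrow> peval (mat_app (mat \<phi>) u) (q i) = peval u (q i)"
    and "mat_app (mat \<phi>) w = 0 \<Longrightarrow> w = 0"
proof -
  interpret \<phi>: alg_hom \<phi> using hom by (simp add: cdga_hom_iff)
  have deg: "homogeneous A i a \<Longrightarrow> homogeneous A i (\<phi> a)" for i a
    using hom by (simp add: cdga_hom_iff)
  have chain: "\<phi> (cdiff A a) = cdiff A (\<phi> a)" for a
    using hom by (simp add: cdga_hom_iff)
  obtain a1 where a1: "\<phi> (evar X1) = even_emb (qconst a1 * x1)"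
    using degree_8[OF deg[OF homogeneous_evar[of A X1, unfolded edeg_A]]] by blast
  obtain a2 where a2: "\<phi> (evar X2) = even_emb (qconst a2 * x2)"
    using degree_10[OF deg[OF homogeneous_evar[of A X2, unfolded edeg_A]]] by blast
  have "\<forall>j. \<exists>b c. \<phi> (evar (V j)) = even_emb (qconst b * x1 ^ 5 + qconst c * x2 ^ 4
      + (\<Sum>l\<in>UNIV. qconst (mat \<phi> j l) * qvar (V l)))"
    using degree_40[OF deg[OF homogeneous_evar[of A "V _", unfolded edeg_A]]] by (simp only: mat_def) blast
  from this[unfolded choice_iff, folded lin_form_def] obtain b c where bc: "\<And>j. \<phi> (evar (V j)) = even_emb (qconst (b j) * x1 ^ 5 + qconst (c j) * x2 ^ 4
      + lin_form (mat \<phi>) j)"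
    by blast
  define g where "g e = (case e of X1 \<Rightarrow> qconst a1 * x1 | X2 \<Rightarrow> qconst a2 * x2
      | V j \<Rightarrow> qconst (b j) * x1 ^ 5 + qconst (c j) * x2 ^ 4 + lin_form (mat \<phi>) j)" for e
  have \<phi>g: "\<phi> (evar e) = even_emb (g e)" for e
    by (cases e) (simp_all only: g_def even_gen.case a1 a2 bc)
  have emb: "\<phi> (even_emb p) = even_emb (subst qconst g p)" for p
    by (rule \<phi>.even_emb) (rule \<phi>g)
  have "\<exists>c. \<phi> (ovar y) = even_emb (qconst c) * ovar y" if "y \<noteq> Z" for y
    using that by (intro degree_y deg homogeneous_ovar) (cases y, simp_all)
  then have "\<forall>y. \<exists>c. y \<noteq> Z \<longrightarrow> \<phi> (ovar y) = even_emb (qconst c) * ovar y" by blast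
  from this[unfolded choice_iff] obtain cy where cy: "\<And>y. y \<noteq> Z \<Longrightarrow> \<phi> (ovar y) = even_emb (qconst (cy y)) * ovar y"
    by blast
  have dcy: "peval (\<lambda>_. 1) (subst qconst g p) = cy y * peval (\<lambda>_. 1) p" if "y \<noteq> Z" "odiff A y = even_emb p" for y p
  proof -
    have "even_emb (subst qconst g p) = (even_emb (qconst (cy y) * p) :: 'n model_cga)"
      using chain[of "ovar y"] that by (simp add: cdiff_ovar emb cy)
    then have "subst qconst g p = qconst (cy y) * p" by (simp only: even_emb_inject)
    then show ?thesis by simp
  qed
  have c1: "cy Y1 = a1 ^ 3 * a2" and c2: "cy Y2 = a1 ^ 2 * a2 ^ 2" and c3: "cy Y3 = a1 * a2 ^ 3"
    using dcy[OF _ odiff_even(1)] dcy[OF _ odiff_even(2)] dcy[OF _ odiff_even(3)] by (simp_all add: g_def)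
  obtain a B A1 A2 A3 where z: "\<phi> (ovar Z) = even_emb (qconst a) * ovar Z + even_emb A1 * ovar Y1
      + even_emb (x1 ^ 3 * x2 ^ 2 * A2) * ovar Y2 + even_emb (x1 ^ 4 * x2 * A3) * ovar Y3
      + even_emb B * (ovar Y1 * (ovar Y2 * ovar Y3))" and az: "cf (\<phi> (ovar Z)) {Z} = qconst a"
    using degree_z[OF deg[OF homogeneous_ovar[of A Z, unfolded odeg_A]]] by blast
  have yy: "\<phi> (odd_prod {y, y'}) = even_emb (qconst (cy y) * qconst (cy y')) * odd_prod {y, y'}"
    if "y < y'" "y \<noteq> Z" "y' \<noteq> Z" for y y'
    using that by (simp only: ovar_mult_ovar[symmetric] \<phi>.mult cy even_emb_mult_swap simp_thms)
  \<comment> \<open>Both sides of \<open>\<phi> (d z) = d (\<phi> z)\<close>, with \<open>\<phi>\<close> carried out on the left.\<close>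
  have main: "even_emb (subst qconst g dz_even)
      + even_emb (subst qconst g (x1 ^ ex_odd * (x1 ^ 4 * x2 ^ 2)))
        * (even_emb (qconst (cy Y1) * qconst (cy Y2)) * odd_prod {Y1, Y2})
      - even_emb (subst qconst g (x1 ^ ex_odd * (x1 ^ 5 * x2)))
        * (even_emb (qconst (cy Y1) * qconst (cy Y3)) * odd_prod {Y1, Y3})
      + even_emb (subst qconst g (x1 ^ ex_odd * x1 ^ 6))
        * (even_emb (qconst (cy Y2) * qconst (cy Y3)) * odd_prod {Y2, Y3})
    = cdiff A (\<phi> (ovar Z))"
    unfolding chain[symmetric] cdiff_ovar odiff_A(4) model_dz_components
      \<phi>.add \<phi>.diff \<phi>.mult emb by (simp only: yy odd_gen_less odd_gen.distinct simp_thms)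
  have dist: "{Y2, Y3} \<noteq> {Y1, Y2}" "{Y2, Y3} \<noteq> {Y1, Y3}" "{} \<noteq> {y, y'}" for y y' :: odd_gen
    by auto
  \<comment> \<open>The coefficient at \<open>y\<^sub>2 y\<^sub>3\<close>. The contribution of \<open>y\<^sub>1 y\<^sub>2 y\<^sub>3\<close> to it is divisible by
    \<open>x\<^sub>2\<close> and disappears at \<open>x\<^sub>1 = 1\<close>, \<open>x\<^sub>2 = 0\<close>.\<close>
  have "cf (cdiff A (\<phi> (ovar Z))) {Y2, Y3} = qconst a * (x1 ^ ex_odd * x1 ^ 6) + B * dy1"
    unfolding z cdiff_zdeg model_dz_components using dist by (simp add: cf_even_emb cf_odd_prod del: even_emb_hom even_emb_power)
  moreover have "cf (cdiff A (\<phi> (ovar Z))) {Y2, Y3}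
      = qconst (cy Y2) * qconst (cy Y3) * subst qconst g (x1 ^ ex_odd * x1 ^ 6)"
    unfolding main[symmetric] using dist by (simp add: cf_even_emb cf_odd_prod mult_ac del: even_emb_hom even_emb_power)
  ultimately have "peval (\<lambda>e. if e = X1 then 1 else 0) (qconst a * (x1 ^ ex_odd * x1 ^ 6) + B * dy1)
      = peval (\<lambda>e. if e = X1 then 1 else 0) (qconst (cy Y2) * qconst (cy Y3) * subst qconst g (x1 ^ ex_odd * x1 ^ 6))"
    by simp
  then have a_odd: "a = a1 ^ (ex_odd + 9) * a2 ^ 5"
    by (simp add: peval_subst g_def c2 c3 power_add) (simp add: eval_nat_numeral)
  have even: "subst qconst g dz_even = qconst a * dz_even + (A1 * dy1
      + (x1 ^ 3 * x2 ^ 2 * A2) * dy2 + (x1 ^ 4 * x2 * A3) * dy3)"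
  proof -
    have "cf (cdiff A (\<phi> (ovar Z))) {} = qconst a * dz_even + (A1 * dy1
      + (x1 ^ 3 * x2 ^ 2 * A2) * dy2 + (x1 ^ 4 * x2 * A3) * dy3)"
      unfolding z cdiff_zdeg model_dz_components using dist by (simp add: cf_even_emb cf_odd_prod del: even_emb_hom even_emb_power)
    moreover have "cf (cdiff A (\<phi> (ovar Z))) {} = subst qconst g dz_even"
      unfolding main[symmetric] using dist by (simp add: cf_even_emb cf_odd_prod del: even_emb_hom even_emb_power)
    ultimately show ?thesis by simp
  qed
  have ne: "qvar e \<noteq> (0 :: 'n even_gen qpoly)" for e
  proof
    assume "qvar e = (0 :: 'n even_gen qpoly)"
    then have "peval (\<lambda>_. 1) (qvar e) = peval (\<lambda>_. 1) (0 :: 'n even_gen qpoly)" by simp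
    then show False by simp
  qed
  have evar_ne: "\<phi> (evar e) \<noteq> 0" for e
  proof
    assume "\<phi> (evar e) = 0"
    then have "\<phi> (evar e) = \<phi> 0" by (simp add: \<phi>.zero)
    then have "evar e = (0 :: 'n model_cga)" using inj by (simp add: inj_eq)
    then have "even_emb (qvar e) = (even_emb 0 :: 'n model_cga)" by (simp add: evar_def)
    then show False using ne[of e] by (simp only: even_emb_inject)
  qed
  have a12: "a1 \<noteq> 0" "a2 \<noteq> 0"
    using evar_ne[of X1] evar_ne[of X2] by (auto simp: a1 a2)
  then have a: "a \<noteq> 0" using a_odd by simp
  obtain l s where l: "\<And>j. l j \<noteq> 0" and q0: "q 0 = diag_form l d" and s: "s \<ge> 1"
    and qR: "q (r + 1) = diag_form l d ^ s"
    using diagonal by metis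
  define E where "E = nat (10 * k + 5 * (int d - 1))"
  define F where "F = nat (8 * k + 4 * (int d - 1))"
  define m where "m = nat (8 * k - 4)"
  have E: "E = ex1 i + 5 * D i" if "i \<le> r + 1" for i
    using int_ex1[OF that] by (simp add: E_def)
  have F: "F = m + 4 * d"
    using k_ge_2 by (simp add: F_def m_def)
  have m: "m > 0" using k_ge_2 by (simp add: m_def)
  have pos: "E > 0" "F > 0" using F m E[of 0] ex1_pos[of 0] by simp_all
  have zeros: "0 ^ m = (0 :: rat)" "0 ^ E = (0 :: rat)" "0 ^ F = (0 :: rat)"
    using m pos by simp_all
  \<comment> \<open>Where \<open>x\<^sub>1 x\<^sub>2 = 0\<close>, all \<open>d y\<^sub>i\<close> vanish and so does everything unknown about \<open>\<phi> z\<close>.\<close>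
  have eval: "(\<Sum>i\<le>r + 1. peval (\<lambda>j. b j * x X1 ^ 5 + c j * x X2 ^ 4 + mat_app (mat \<phi>) (\<lambda>l. x (V l)) j) (q i) * (a1 * x X1) ^ ex1 i)
      + peval (\<lambda>j. b j * x X1 ^ 5 + c j * x X2 ^ 4 + mat_app (mat \<phi>) (\<lambda>l. x (V l)) j) (q 0) * (a2 * x X2) ^ m
      + (a1 * x X1) ^ E + (a2 * x X2) ^ F
    = a * ((\<Sum>i\<le>r + 1. peval (\<lambda>j. x (V j)) (q i) * x X1 ^ ex1 i)
      + peval (\<lambda>j. x (V j)) (q 0) * x X2 ^ m + x X1 ^ E + x X2 ^ F)"
    if "x X1 * x X2 = 0" for x
  proof -
    have gx: "peval x (g (V j)) = b j * x X1 ^ 5 + c j * x X2 ^ 4 + mat_app (mat \<phi>) (\<lambda>l. x (V l)) j" for j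
      by (simp add: g_def lin_form_def peval_sum mat_app_def)
    have "peval x (A1 * dy1
      + (x1 ^ 3 * x2 ^ 2 * A2) * dy2 + (x1 ^ 4 * x2 * A3) * dy3) = 0"
      using that by auto
    then have "peval x (subst qconst g dz_even) = a * peval x dz_even"
      unfolding even by simp
    then show ?thesis
      unfolding peval_subst peval_dz_even gx by (simp add: g_def m_def E_def F_def)
  qed
  have d2: "d \<ge> 2" by (rule d_ge_2)
  \<comment> \<open>The case \<open>x\<^sub>2 = 0\<close>, divided by the lowest power of \<open>x\<^sub>1\<close>, which belongs to the form of
    highest degree. The quotients are powers of \<open>x\<^sub>1\<^sup>5\<close>.\<close>
  have X1: "(\<Sum>i\<le>r + 1. a1 ^ ex1 i * (t ^ 5) ^ (D (r + 1) - D i)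
        * peval (\<lambda>j. mat_app (mat \<phi>) u j + t ^ 5 * b j) (q i)) + a1 ^ E * (t ^ 5) ^ D (r + 1)
      = a * ((\<Sum>i\<le>r + 1. (t ^ 5) ^ (D (r + 1) - D i) * peval u (q i)) + (t ^ 5) ^ D (r + 1))" (is "?l = ?r")
    if t: "t \<noteq> 0" for u t
  proof -
    have ex: "t ^ ex1 i = t ^ ex1 (r + 1) * (t ^ 5) ^ (D (r + 1) - D i)" if "i \<le> r + 1" for i
    proof -
      have "ex1 i = ex1 (r + 1) + 5 * (D (r + 1) - D i)"
        using E[OF that] E[of "r + 1"] D_le[OF that] by simp
      then show ?thesis by (simp add: power_add power_mult)
    qed
    have tE: "t ^ E = t ^ ex1 (r + 1) * (t ^ 5) ^ D (r + 1)"
      unfolding E[OF order_refl] by (simp add: power_add power_mult)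
    define x where "x = (\<lambda>e. case e of X1 \<Rightarrow> t | X2 \<Rightarrow> 0 | V j \<Rightarrow> u j)"
    have "(\<Sum>i\<le>r + 1. peval (\<lambda>j. b j * t ^ 5 + mat_app (mat \<phi>) u j) (q i) * (a1 * t) ^ ex1 i) + (a1 * t) ^ E
        = a * ((\<Sum>i\<le>r + 1. peval u (q i) * t ^ ex1 i) + t ^ E)"
      using eval[of x] by (simp add: x_def zeros)
    moreover have "(\<Sum>i\<le>r + 1. peval (\<lambda>j. b j * t ^ 5 + mat_app (mat \<phi>) u j) (q i) * (a1 * t) ^ ex1 i) =
        t ^ ex1 (r + 1) * (\<Sum>i\<le>r + 1. a1 ^ ex1 i * (t ^ 5) ^ (D (r + 1) - D i)
        * peval (\<lambda>j. mat_app (mat \<phi>) u j + t ^ 5 * b j) (q i))"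
      unfolding sum_distrib_left
    proof (rule sum.cong)
      fix i assume "i \<in> {..r + 1}"
      then have i: "i \<le> r + 1" by simp
      show "peval (\<lambda>j. b j * t ^ 5 + mat_app (mat \<phi>) u j) (q i) * (a1 * t) ^ ex1 i =
          t ^ ex1 (r + 1) * (a1 ^ ex1 i * (t ^ 5) ^ (D (r + 1) - D i)
          * peval (\<lambda>j. mat_app (mat \<phi>) u j + t ^ 5 * b j) (q i))"
        unfolding power_mult_distrib ex[OF i] by (simp only: mult_ac add.commute)
    qed simp
    moreover have "(\<Sum>i\<le>r + 1. peval u (q i) * t ^ ex1 i) =
        t ^ ex1 (r + 1) * (\<Sum>i\<le>r + 1. (t ^ 5) ^ (D (r + 1) - D i) * peval u (q i))"
      unfolding sum_distrib_left
    proof (rule sum.cong)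
      fix i assume "i \<in> {..r + 1}"
      then have i: "i \<le> r + 1" by simp
      show "peval u (q i) * t ^ ex1 i = t ^ ex1 (r + 1) * ((t ^ 5) ^ (D (r + 1) - D i) * peval u (q i))"
        unfolding ex[OF i] by (simp only: mult_ac)
    qed simp
    ultimately have scaled: "t ^ ex1 (r + 1) * ?l = t ^ ex1 (r + 1) * ?r"
      by (simp only: power_mult_distrib tE distrib_left mult_ac)
    show ?thesis
      by (rule mult_left_cancel[THEN iffD1, OF _ scaled]) (use t in simp)
  qed
  \<comment> \<open>The case \<open>x\<^sub>1 = 0\<close>, where \<open>q\<^sub>0\<close> is the only form left, divided by \<open>x\<^sub>2\<^bsup>8k-4\<^esup>\<close>.\<close>
  have X2: "(\<Sum>i\<le>(0 :: nat). a2 ^ m * (t ^ 4) ^ (d - d)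
        * peval (\<lambda>j. mat_app (mat \<phi>) u j + t ^ 4 * c j) (q i)) + a2 ^ F * (t ^ 4) ^ d
      = a * ((\<Sum>i\<le>(0 :: nat). (t ^ 4) ^ (d - d) * peval u (q i)) + (t ^ 4) ^ d)"
    if t: "t \<noteq> 0" for u t
  proof -
    have tF: "t ^ F = t ^ m * (t ^ 4) ^ d"
      unfolding F by (simp add: power_add power_mult)
    define x where "x = (\<lambda>e. case e of X1 \<Rightarrow> 0 | X2 \<Rightarrow> t | V j \<Rightarrow> u j)"
    have z: "0 ^ ex1 i = (0 :: rat)" if "i \<le> r + 1" for i
      using ex1_pos[OF that] by simp
    have "peval (\<lambda>j. c j * t ^ 4 + mat_app (mat \<phi>) u j) (q 0) * (a2 * t) ^ m + (a2 * t) ^ F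
        = a * (peval u (q 0) * t ^ m + t ^ F)"
      using eval[of x] by (simp add: x_def z zeros cong: sum.cong_simp)
    then have scaled: "t ^ m * (a2 ^ m * peval (\<lambda>j. mat_app (mat \<phi>) u j + t ^ 4 * c j) (q 0) + a2 ^ F * (t ^ 4) ^ d)
        = t ^ m * (a * (peval u (q 0) + (t ^ 4) ^ d))"
      by (simp only: power_mult_distrib tF distrib_left mult_ac add.commute[of "mat_app _ _ _"])
    have "a2 ^ m * peval (\<lambda>j. mat_app (mat \<phi>) u j + t ^ 4 * c j) (q 0) + a2 ^ F * (t ^ 4) ^ d
        = a * (peval u (q 0) + (t ^ 4) ^ d)"
      by (rule mult_left_cancel[THEN iffD1, OF _ scaled]) (use t in simp)
    then show ?thesis by simp
  qed
  have five: "(5 :: nat) > 0" "(4 :: nat) > 0" by simp_all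
  note cmp1 = compare_forms[where q = q and R = "r + 1" and D = D and N = 5 and a = a
      and \<kappa> = "\<lambda>i. a1 ^ ex1 i" and \<mu> = "a1 ^ E" and b = b and L = "mat \<phi>",
      OF l d2 s qR D_gap d2 five(1) a X1]
  have q0': "q 0 = diag_form l d ^ 1" using q0 by simp
  note cmp2 = compare_forms[where q = q and R = 0 and D = "\<lambda>_. d" and N = 4 and a = a
      and \<kappa> = "\<lambda>i. a2 ^ m" and \<mu> = "a2 ^ F" and b = c and L = "mat \<phi>" and s = 1,
      OF l d2 order_refl q0' _ d2 five(2) a X2]
  have b: "b = 0" by (rule cmp1(1))
  have c: "c = 0" by (rule cmp2(1)) simp_all
  have aE: "a1 ^ E = a" by (rule cmp1(2))
  have aF: "a2 ^ F = a" by (rule cmp2(2)) simp_all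
  have forms: "a1 ^ ex1 i * peval (mat_app (mat \<phi>) u) (q i) = a * peval u (q i)" if "i \<le> r + 1" for i u
    using cmp1(3) that by blast
  have form0: "a2 ^ m * peval (mat_app (mat \<phi>) u) (q 0) = a * peval u (q 0)" for u
    by (rule cmp2(3)) simp_all
  show "mat_app (mat \<phi>) w = 0 \<Longrightarrow> w = 0" by (rule cmp1(4))
  \<comment> \<open>A unit vector shows that \<open>q\<^sub>0\<close> is not the zero function.\<close>
  define j where "j = (SOME j :: 'n. True)"
  have "peval (unit_vec j) (q 0) = l j"
    by (subst q0) (rule peval_unit_vec_diag_form, use d2 in simp)
  then have q0_ne: "peval (unit_vec j) (q 0) \<noteq> 0" using l by simp
  then have Lq0_ne: "peval (mat_app (mat \<phi>) (unit_vec j)) (q 0) \<noteq> 0"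
    using form0[of "unit_vec j"] a by auto
  have "a1 ^ ex1 0 * peval (mat_app (mat \<phi>) (unit_vec j)) (q 0) = a2 ^ m * peval (mat_app (mat \<phi>) (unit_vec j)) (q 0)"
    using form0[of "unit_vec j"] forms[of 0 "unit_vec j"] by simp
  then have am: "a1 ^ ex1 0 = a2 ^ m"
    by (rule mult_right_cancel[THEN iffD1, OF Lq0_ne])
  \<comment> \<open>The odd number \<open>n = 2 k - 1\<close> is the common factor of the exponents \<open>10 k - 5\<close> and
    \<open>8 k - 4\<close>.\<close>
  define n where "n = nat (2 * k - 1)"
  have "odd n" using k_ge_2 by (simp add: n_def even_nat_iff)
  have n: "ex1 0 = 5 * n" "m = 4 * n"
    using k_ge_2 by (simp_all add: n_def m_def ex1_def)
  have "E = ex_odd + 9 + 6"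
    using k_ge_2 d2 by (simp add: E_def)
  then have "a1 ^ (ex_odd + 9) * a1 ^ 6 = a1 ^ (ex_odd + 9) * a2 ^ 5"
    using aE a_odd by (metis power_add)
  then have "a1 ^ 6 = a2 ^ 5" using a12 by simp
  from rigid_scalars[OF a12 this am[unfolded n] \<open>odd n\<close>] have one: "a1 = 1" "a2 = 1" .
  then have a1: "a = 1" using aE by simp
  show "\<phi> (evar X1) = evar X1" "\<phi> (evar X2) = evar X2"
    by (simp_all only: \<phi>g g_def even_gen.case one) (simp_all add: evar_def)
  show "\<phi> (evar (V j)) = even_emb (lin_form (mat \<phi>) j)" for j
    by (simp add: bc b c)
  show "\<phi> (ovar y) = ovar y" if "y \<noteq> Z" for y
  proof -
    have "cy y = 1" using that c1 c2 c3 one by (cases y) simp_all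
    then show ?thesis using cy[OF that] by simp
  qed
  show "cf (\<phi> (ovar Z)) {Z} = 1" using az a1 by simp
  show "peval (mat_app (mat \<phi>) u) (q i) = peval u (q i)" if "i \<le> r + 1" for i u
    using forms[OF that] one a1 by simp
qed

end

context realizable_model
begin

subsection \<open>Exactness in the degree of \<open>z\<close>\<close>

lemma monomial_cancel:
  assumes "x1 ^ i * x2 ^ j * p = x1 ^ i * x2 ^ j * (p' :: 'n even_gen qpoly)"
  shows "p = p'"
proof -
  have "x1 ^ i * x2 ^ j = single (single X1 i + single X2 j :: 'n even_gen \<Rightarrow>\<^sub>0 nat) 1"
    by (simp add: qvar_power mult_single)
  then show ?thesis
    using single_mult_cancel assms by metis
qed

lemma cdiff_y13: "cdiff A (ovar Y1 * ovar Y3) =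
    even_emb dy1 * ovar Y3 - even_emb dy3 * ovar Y1"
  and cdiff_y12: "cdiff A (ovar Y1 * ovar Y2) =
    even_emb dy1 * ovar Y2 - even_emb dy2 * ovar Y1"
  unfolding cdiff_ovar_mult cdiff_ovar odiff_even
  by (simp_all only: even_emb_commute[of "ovar _"])

text \<open>The coefficient of \<open>y\<^sub>1 y\<^sub>2 y\<^sub>3\<close> in a cocycle vanishes, as it appears multiplied by
  \<open>x\<^sub>1\<^sup>3 x\<^sub>2\<close> at \<open>y\<^sub>2 y\<^sub>3\<close>. The coefficients \<open>A\<^sub>1\<close>, \<open>x\<^sub>1\<^sup>3 x\<^sub>2\<^sup>2 A\<^sub>2\<close>, \<open>x\<^sub>1\<^sup>4 x\<^sub>2 A\<^sub>3\<close> of the \<open>y\<^sub>i\<close> satisfy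
  one linear relation, which can be divided by \<open>x\<^sub>1\<^sup>3 x\<^sub>2\<close> and then determines \<open>A\<^sub>1\<close>. The
  monomial factors forced by the degree are just large enough for \<open>A\<^sub>3 x\<^sub>1 y\<^sub>1 y\<^sub>3 + A\<^sub>2 x\<^sub>2 y\<^sub>1 y\<^sub>2\<close>
  to be a primitive. Without them the syzygies of \<open>x\<^sub>1\<^sup>3 x\<^sub>2\<close>, \<open>x\<^sub>1\<^sup>2 x\<^sub>2\<^sup>2\<close>,
  \<open>x\<^sub>1 x\<^sub>2\<^sup>3\<close> would give cocycles that are not exact.\<close>

theorem zdeg_exact:
  assumes hom: "homogeneous A zdeg \<delta>" and Z: "cf \<delta> {Z} = 0" and closed: "cdiff A \<delta> = 0"
  shows "\<exists>\<beta>. homogeneous A (zdeg - 1) \<beta> \<and> cdiff A \<beta> = \<delta>"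
proof -
  obtain c B A1 A2 A3 where \<delta>: "\<delta> = even_emb (qconst c) * ovar Z + even_emb A1 * ovar Y1
      + even_emb (x1 ^ 3 * x2 ^ 2 * A2) * ovar Y2 + even_emb (x1 ^ 4 * x2 * A3) * ovar Y3
      + even_emb B * (ovar Y1 * (ovar Y2 * ovar Y3))" and c: "cf \<delta> {Z} = qconst c"
    using degree_z[OF hom] by blast
  have c0: "qconst c = (0 :: 'n even_gen qpoly)" using c Z by simp
  have dist: "{Y2, Y3} \<noteq> {Y1, Y2}" "{Y2, Y3} \<noteq> {Y1, Y3}" "{} \<noteq> {y, y'}" "{y} \<noteq> {Y1, Y2, Y3}" for y y' :: odd_gen
    by auto
  have "cf (cdiff A \<delta>) {Y2, Y3} = x1 ^ 3 * x2 ^ 1 * B"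
    unfolding \<delta> cdiff_zdeg c0 using dist by (simp add: cf_even_emb cf_odd_prod mult_ac del: even_emb_hom(4) even_emb_power)
  then have "B = 0"
    using monomial_cancel[of 3 1 B 0] closed by simp
  have "cf (cdiff A \<delta>) {} = A1 * dy1
      + x1 ^ 3 * x2 ^ 2 * A2 * dy2
      + x1 ^ 4 * x2 * A3 * dy3"
    unfolding \<delta> cdiff_zdeg c0 using dist by (simp add: cf_even_emb cf_odd_prod del: even_emb_hom(3,4) even_emb_power)
  also have "\<dots> = x1 ^ 3 * x2 ^ 1 * (A1 + x1 ^ 2 * x2 ^ 3 * (A2 + A3))"
    by (simp add: eval_nat_numeral algebra_simps)
  finally have "A1 + x1 ^ 2 * x2 ^ 3 * (A2 + A3) = 0"
    using monomial_cancel[of 3 1 _ 0] closed by simp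
  then have A1: "A1 = - (x1 ^ 2 * x2 ^ 3 * (A2 + A3))"
    by (simp only: eq_neg_iff_add_eq_0)
  have \<delta>': "\<delta> = even_emb A1 * ovar Y1 + even_emb (x1 ^ 3 * x2 ^ 2 * A2) * ovar Y2
      + even_emb (x1 ^ 4 * x2 * A3) * ovar Y3"
    unfolding \<delta> c0 \<open>B = 0\<close> by simp
  define \<beta> where "\<beta> = even_emb (x1 * A3) * (ovar Y1 * ovar Y3) + even_emb (x2 * A2) * (ovar Y1 * ovar Y2)"
  have "cdiff A \<beta> = even_emb (x1 * A3) * (even_emb dy1 * ovar Y3 - even_emb dy3 * ovar Y1)
      + even_emb (x2 * A2) * (even_emb dy1 * ovar Y2 - even_emb dy2 * ovar Y1)"
    unfolding \<beta>_def cdiff_add cdiff_even_emb_mult_A cdiff_y12 cdiff_y13 ..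
  also have "\<dots> = \<delta>"
    unfolding \<delta>' A1
    by (rule cga_eqI, simp only: cf_add cf_diff cf_even_emb_mult) (simp add: eval_nat_numeral algebra_simps)
  finally have d\<beta>: "cdiff A \<beta> = \<delta>" .
  have comp: "homogeneous A (zdeg - odeg A y) (even_emb (cf \<delta> {y}))" for y
    using hom unfolding homogeneous_iff[of A zdeg] homogeneous_even_emb by (force simp: odd_deg_def)
  have mono: "x1 ^ i * x2 ^ j = single (single X1 i + single X2 j :: 'n even_gen \<Rightarrow>\<^sub>0 nat) 1" for i j
    by (simp add: qvar_power mult_single)
  have "cf \<delta> {Y2} = single (single X1 3 + single X2 2) 1 * A2" "cf \<delta> {Y3} = single (single X1 4 + single X2 1) 1 * A3"
    using mono[of 3 2] mono[of 4 1] unfolding \<delta>' by (simp_all add: cf_ovar del: even_emb_hom even_emb_power)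
  with comp[of Y2] comp[of Y3] have
    "homogeneous A (zdeg - 35) (even_emb (single (single X1 3 + single X2 2) 1 * A2))"
    "homogeneous A (zdeg - 37) (even_emb (single (single X1 4 + single X2 1) 1 * A3))" by simp_all
  from this[THEN homogeneous_monomial_factor]
  have A2: "homogeneous A (zdeg - 79) (even_emb A2)" and A3: "homogeneous A (zdeg - 79) (even_emb A3)"
    by (simp_all add: mon_deg_add)
  have "homogeneous A (zdeg - 1) (even_emb (x1 * A3) * (ovar Y1 * ovar Y3))"
    using homogeneous_mult[OF homogeneous_mult[OF homogeneous_evar[of A X1] A3]
        homogeneous_mult[OF homogeneous_ovar[of A Y1] homogeneous_ovar[of A Y3]]]
    by (simp add: evar_def)
  moreover have "homogeneous A (zdeg - 1) (even_emb (x2 * A2) * (ovar Y1 * ovar Y2))"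
    using homogeneous_mult[OF homogeneous_mult[OF homogeneous_evar[of A X2] A2]
        homogeneous_mult[OF homogeneous_ovar[of A Y1] homogeneous_ovar[of A Y2]]]
    by (simp add: evar_def)
  ultimately have "homogeneous A (zdeg - 1) \<beta>"
    unfolding \<beta>_def by (rule homogeneous_add)
  with d\<beta> show ?thesis by blast
qed

subsection \<open>Homotopy classes of automorphisms\<close>

text \<open>\<open>d z\<close> does not involve \<open>z\<close>.\<close>

lemma model_dz_cong:
  fixes \<phi> \<psi> :: "'n model_cga \<Rightarrow> ('f, 'p::{finite, linorder}) cga"
  assumes "alg_hom \<phi>" "alg_hom \<psi>" and e: "\<And>e. \<phi> (evar e) = \<psi> (evar e)"
    and y: "\<And>y. y \<noteq> Z \<Longrightarrow> \<phi> (ovar y) = \<psi> (ovar y)"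
  shows "\<phi> (model_dz r q k) = \<psi> (model_dz r q k)"
proof -
  interpret \<phi>: alg_hom \<phi> by fact
  interpret \<psi>: alg_hom \<psi> by fact
  have emb: "\<phi> (even_emb p) = \<psi> (even_emb p)" for p
  proof (induction p rule: qpoly_induct)
    case (var e p)
    then show ?case using e[of e] by (simp add: \<phi>.mult \<psi>.mult evar_def)
  qed (simp_all add: \<phi>.const \<psi>.const \<phi>.add \<psi>.add)
  show ?thesis
    unfolding model_dz_components y_products[symmetric] \<phi>.hom \<psi>.hom
    by (simp only: emb y odd_gen.distinct simp_thms)
qed

text \<open>By the normal form \<open>\<phi>\<close> and \<open>\<psi>\<close> differ at \<open>z\<close> only, by a cocycle \<open>\<delta> = d \<beta>\<close>. The
  homotopy is constant on the other generators and sends \<open>z\<close> to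
  \<open>\<phi> z + t \<delta> + \<beta> dt\<close>. Here \<open>d (t \<delta>) = dt \<delta>\<close> and \<open>d (\<beta> dt) = \<delta> dt\<close> cancel, since \<open>\<delta>\<close>
  is odd.\<close>

lemma homotopic_if_mat_eq:
  assumes \<phi>: "\<phi> \<in> cdga_aut A" and \<psi>: "\<psi> \<in> cdga_aut A" and mat: "mat \<phi> = mat \<psi>"
  shows "homotopic A \<phi> \<psi>"
proof -
  have hom: "cdga_hom A A \<phi>" "cdga_hom A A \<psi>" and inj: "inj \<phi>" "inj \<psi>"
    using \<phi> \<psi> by (simp_all add: cdga_aut_def bij_is_inj)
  note \<phi>n = automorphism_normal_form[OF hom(1) inj(1)] and \<psi>n = automorphism_normal_form[OF hom(2) inj(2)]
  have alg: "alg_hom \<phi>" "alg_hom \<psi>" using hom by (simp_all add: cdga_hom_iff)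
  have evar: "\<phi> (evar e) = \<psi> (evar e)" for e
    by (cases e) (simp_all add: \<phi>n(1-3) \<psi>n(1-3) mat)
  have ovar: "\<phi> (ovar y) = ovar y" "\<psi> (ovar y) = ovar y" if "y \<noteq> Z" for y
    using \<phi>n(4) \<psi>n(4) that by blast+
  have z: "cdiff A (\<phi> (ovar Z)) = \<phi> (model_dz r q k)" "cdiff A (\<psi> (ovar Z)) = \<psi> (model_dz r q k)"
    using hom unfolding cdga_hom_iff cdiff_ovar[of Z, unfolded odiff_A(4), symmetric] by simp_all
  have zhom: "homogeneous A zdeg (\<phi> (ovar Z))" "homogeneous A zdeg (\<psi> (ovar Z))"
    using hom homogeneous_ovar[of A Z] by (simp_all add: cdga_hom_iff)
  define \<delta> where "\<delta> = \<psi> (ovar Z) - \<phi> (ovar Z)"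
  have \<delta>: "homogeneous A zdeg \<delta>" "cf \<delta> {Z} = 0"
    using zhom \<phi>n(5) \<psi>n(5) by (simp_all add: \<delta>_def homogeneous_diff)
  have d\<delta>: "cdiff A \<delta> = 0"
    using model_dz_cong[OF alg(2,1)] evar ovar by (simp add: \<delta>_def cdiff_diff z)
  obtain \<beta> where \<beta>: "homogeneous A (zdeg - 1) \<beta>" and d\<beta>: "cdiff A \<beta> = \<delta>"
    using zdeg_exact[OF \<delta> d\<delta>] by blast
  interpret C: graded_cdga "cyl A"
    by (rule graded_cdga_cyl) (rule graded_cdga_axioms)
  interpret emb: alg_hom "cyl_emb :: 'n model_cga \<Rightarrow> _"
    by (rule alg_hom_cyl_emb)
  define g where "g e = cf (\<phi> (evar e)) {}" for e
  have g: "\<phi> (evar e) = even_emb (g e)" for e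
    by (cases e) (simp_all only: g_def \<phi>n(1-3), simp_all add: cf_even_emb evar_def)
  define G where "G e = subst qconst (\<lambda>e. qvar (Some e)) (g e)" for e
  have G: "even_emb (G e) = cyl_emb (\<phi> (evar e))" for e
    by (simp add: G_def g cyl_emb_even_emb)
  define h where "h y = (if y = Z then cyl_emb (\<phi> (ovar Z)) + evar None * cyl_emb \<delta> + cyl_emb \<beta> * ovar None
      else ovar (Some y))" for y
  have hdeg: "homogeneous (cyl A) (odeg A y) (h y)" for y
  proof (cases "y = Z")
    case True
    have "homogeneous (cyl A) (0 + zdeg) (evar None * cyl_emb \<delta>)"
      using homogeneous_evar[of "cyl A" None]
      by (intro homogeneous_mult homogeneous_cyl_emb \<delta>) (simp add: cyl_def)
    moreover have "homogeneous (cyl A) (zdeg - 1 + 1) (cyl_emb \<beta> * ovar None)"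
      using homogeneous_ovar[of "cyl A" None]
      by (intro homogeneous_mult homogeneous_cyl_emb \<beta>) (simp add: cyl_def)
    ultimately show ?thesis
      using homogeneous_cyl_emb[OF zhom(1)] True by (simp add: h_def homogeneous_add)
  next
    case False
    then show ?thesis
      using homogeneous_ovar[of "cyl A" "Some y"] by (simp add: h_def cyl_def)
  qed
  have gdeg: "homogeneous (cyl A) (edeg A e) (even_emb (G e))" for e
    unfolding G using hom(1) by (intro homogeneous_cyl_emb) (simp add: cdga_hom_iff homogeneous_evar)
  have odd: "oddp (h y)" for y
    using C.homogeneous_oddp[OF hdeg] odd_odeg by blast
  have algH: "alg_hom (ext_hom G h)" by (rule alg_hom_ext_hom) (rule odd)
  have H_evar: "ext_hom G h (evar e) = cyl_emb (\<phi> (evar e))" for e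
    by (simp add: ext_hom_evar[where h = h, OF odd] G)
  have H_ovar: "ext_hom G h (ovar y) = h y" for y
    by (rule ext_hom_ovar) (rule odd)
  have alge: "alg_hom (cyl_emb \<circ> \<phi>)" by (rule alg_hom_comp[OF alg(1) alg_hom_cyl_emb])
  have "cdga_hom A (cyl A) (ext_hom G h)"
  proof (rule cdga_hom_ext_hom[OF graded_cdga_axioms C.graded_cdga_axioms gdeg hdeg])
    have "alg_hom \<phi>" by (rule alg)
    fix e
    have "cdiff A (\<phi> (evar e)) = 0" by (simp add: g)
    then show "ext_hom G h (ediff A e) = cdiff (cyl A) (even_emb (G e))"
      unfolding G cyl_emb_cdiff[OF graded_cdga_axioms, symmetric]
      by (simp add: emb.zero alg_hom.zero[OF algH])
  next
    fix y
    show "ext_hom G h (odiff A y) = cdiff (cyl A) (h y)"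
    proof (cases "y = Z")
      case False
      then obtain p where p: "odiff A y = even_emb p"
        by (cases y; use odiff_even in blast)
      have "cdiff A (ovar y) = \<phi> (cdiff A (ovar y))"
        using hom(1) ovar(1)[OF False] by (simp add: cdga_hom_iff)
      then have "\<phi> (even_emb p) = even_emb p"
        by (simp add: cdiff_ovar p)
      moreover have "ext_hom G h (even_emb p) = cyl_emb (\<phi> (even_emb p))"
      proof -
        have "\<phi> (even_emb p) = even_emb (subst qconst g p)"
          by (rule alg_hom.even_emb[OF alg(1)]) (rule g)
        moreover have "subst qconst G p = subst qconst (\<lambda>e. qvar (Some e)) (subst qconst g p)"
          unfolding qconst.subst_subst G_def ..
        ultimately show ?thesis
          by (simp add: ext_hom_even_emb[where h = h, OF odd] cyl_emb_even_emb)
      qed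
      ultimately have "ext_hom G h (odiff A y) = cyl_emb (cdiff A (ovar y))"
        by (simp add: p cdiff_ovar)
      then show ?thesis
        using False by (simp add: h_def cyl_emb_cdiff[OF graded_cdga_axioms])
    next
      case True
      have "ext_hom G h (model_dz r q k) = (cyl_emb \<circ> \<phi>) (model_dz r q k)"
        by (rule model_dz_cong[OF algH alge]) (simp_all add: H_evar H_ovar h_def ovar)
      then have 1: "ext_hom G h (odiff A y) = cdiff (cyl A) (cyl_emb (\<phi> (ovar Z)))"
        using True by (simp add: z flip: cyl_emb_cdiff[OF graded_cdga_axioms])
      have "oddp (cyl_emb \<delta>)" "evenp (cyl_emb \<beta>)"
        by (rule C.homogeneous_oddp[OF homogeneous_cyl_emb[OF \<delta>(1)]], simp)
          (rule C.homogeneous_evenp[OF homogeneous_cyl_emb[OF \<beta>]], simp)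
      have "cdiff (cyl A) (evar None * cyl_emb \<delta>) = ovar None * cyl_emb \<delta>"
        unfolding C.cdiff_mult C.cdiff_evar cyl_emb_cdiff[OF graded_cdga_axioms, symmetric] d\<delta>
        by (simp add: emb.zero cyl_def)
      moreover have "cdiff (cyl A) (cyl_emb \<beta> * ovar None) = cyl_emb \<delta> * ovar None"
        unfolding C.cdiff_mult C.cdiff_ovar cyl_emb_cdiff[OF graded_cdga_axioms, symmetric] d\<beta>
        by (simp add: cyl_def)
      moreover have "cyl_emb \<delta> * ovar None = - (ovar None * cyl_emb \<delta>)"
        by (rule oddp_anticommute[OF oddp_ovar \<open>oddp (cyl_emb \<delta>)\<close>])
      ultimately have "cdiff (cyl A) (h Z) = cdiff (cyl A) (cyl_emb (\<phi> (ovar Z)))"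
        by (simp add: h_def C.cdiff_add)
      then show ?thesis using 1 True by simp
    qed
  qed
  moreover have "cyl_at 0 \<circ> ext_hom G h = \<phi>"
  proof (rule alg_hom_eqI[OF alg_hom_comp[OF algH alg_hom_cyl_at] alg(1)])
    interpret at: alg_hom "cyl_at 0 :: _ \<Rightarrow> 'n model_cga" by (rule alg_hom_cyl_at)
    show "(cyl_at 0 \<circ> ext_hom G h) (evar e) = \<phi> (evar e)" for e by (simp add: H_evar)
    show "(cyl_at 0 \<circ> ext_hom G h) (ovar y) = \<phi> (ovar y)" for y
      by (simp add: H_ovar h_def at.add at.mult ovar)
  qed
  moreover have "cyl_at 1 \<circ> ext_hom G h = \<psi>"
  proof (rule alg_hom_eqI[OF alg_hom_comp[OF algH alg_hom_cyl_at] alg(2)])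
    interpret at: alg_hom "cyl_at 1 :: _ \<Rightarrow> 'n model_cga" by (rule alg_hom_cyl_at)
    show "(cyl_at 1 \<circ> ext_hom G h) (evar e) = \<psi> (evar e)" for e by (simp add: H_evar evar)
    show "(cyl_at 1 \<circ> ext_hom G h) (ovar y) = \<psi> (ovar y)" for y
      by (simp add: H_ovar h_def at.add at.mult ovar \<delta>_def)
  qed
  ultimately show ?thesis
    unfolding homotopic_def by blast
qed

lemma sum_option: "(\<Sum>e\<in>UNIV. f e) = f None + (\<Sum>e\<in>UNIV. f (Some e))"
  for f :: "'x::finite option \<Rightarrow> 'a::comm_monoid_add"
  by (simp add: UNIV_option_conv sum.reindex)

text \<open>In the even degree 40 odd generators would occur in pairs. Two of the \<open>y\<^sub>i\<close> are too large,
  and \<open>dt\<close> with one \<open>y\<^sub>i\<close> leaves degree 6, 4 or 2, in which there is nothing.\<close>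

lemma cyl_degree_40:
  assumes a: "homogeneous (cyl A) 40 a" and "S \<noteq> {}"
  shows "cf a S = 0"
proof (rule cf_eq_0I)
  fix m assume m: "m \<in> keys (cf a S)"
  let ?y = "\<lambda>y. Some y \<in> S"
  define \<alpha> \<beta> \<nu> where "\<alpha> = lookup m (Some X1)" and "\<beta> = lookup m (Some X2)"
    and "\<nu> = (\<Sum>j\<in>UNIV. lookup m (Some (V j)))"
  define o' where "o' = ((if ?y Y1 then 33 else 0) + (if ?y Y2 then 35 else 0) + (if ?y Y3 then 37 else 0)
      + (if ?y Z then zdeg else 0))"
  have "mon_deg (cyl A) m = (\<Sum>e\<in>UNIV. int (lookup m e) * edeg (cyl A) e)"
    by (rule mon_deg_superset) auto
  then have md: "mon_deg (cyl A) m = 8 * int \<alpha> + 10 * int \<beta> + 40 * int \<nu>"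
    by (simp add: sum_option sum_even_gen cyl_def \<alpha>_def \<beta>_def \<nu>_def sum_distrib_left mult.commute)
  have "odd_deg (cyl A) S = (\<Sum>y\<in>UNIV. if y \<in> S then odeg (cyl A) y else 0)"
    unfolding odd_deg_def by (simp add: sum.If_cases)
  then have od: "odd_deg (cyl A) S = (if None \<in> S then 1 else 0) + o'"
    by (simp add: sum_option UNIV_odd_gen cyl_def o'_def)
  have deg: "8 * int \<alpha> + 10 * int \<beta> + 40 * int \<nu> + ((if None \<in> S then 1 else 0) + o') = 40"
    using a m unfolding homogeneous_iff md[symmetric] od[symmetric] by blast
  have nz: "\<not> ?y Z"
    using deg zdeg_large by (auto simp: o'_def split: if_splits)
  show False
  proof (cases "None \<in> S")
    case False
    have "8 * int \<alpha> + 10 * int \<beta> + 40 * int \<nu> + o' = 40" using deg False by simp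
    from low_degree_arith[OF this[unfolded o'_def] zdeg_large]
    have none: "\<not> ?y Y1 \<and> \<not> ?y Y2 \<and> \<not> ?y Y3 \<and> \<not> ?y Z" by simp
    obtain x where x: "x \<in> S" using \<open>S \<noteq> {}\<close> by blast
    with False obtain y where "x = Some y" by (cases x) auto
    then show False using x none by (cases y) auto
  next
    case True
    have e: "2 * (4 * int \<alpha> + 5 * int \<beta> + 20 * int \<nu>) + o' = 39" using deg True by simp
    have "odd o'"
    proof
      assume "even o'"
      then have "even (2 * (4 * int \<alpha> + 5 * int \<beta> + 20 * int \<nu>) + o')" by simp
      then show False unfolding e by simp
    qed
    then have o': "o' \<ge> 33" "o' \<noteq> 39"
      using nz unfolding o'_def by (cases "?y Y1"; cases "?y Y2"; cases "?y Y3"; simp)+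
    then have "8 * int \<alpha> + 10 * int \<beta> + 40 * int \<nu> \<le> 6" using e by simp
    then have "\<alpha> = 0" "\<beta> = 0" "\<nu> = 0" by linarith+
    then show False using e o' by simp
  qed
qed

text \<open>Along a homotopy the image of \<open>v\<^sub>j\<close> is a cocycle of degree 40 and hence independent of
  \<open>t\<close>.\<close>

lemma mat_eq_if_homotopic:
  assumes "homotopic A \<phi> \<psi>"
  shows "mat \<phi> = mat \<psi>"
proof -
  obtain H where H: "cdga_hom A (cyl A) H" and ends: "cyl_at 0 \<circ> H = \<phi>" "cyl_at 1 \<circ> H = \<psi>"
    using assms by (auto simp: homotopic_def)
  interpret C: graded_cdga "cyl A"
    by (rule graded_cdga_cyl) (rule graded_cdga_axioms)
  have "cf (\<phi> (evar (V j))) {} = cf (\<psi> (evar (V j))) {}" for j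
  proof -
    define P where "P = cf (H (evar (V j))) {}"
    have "homogeneous (cyl A) 40 (H (evar (V j)))"
      using H homogeneous_evar[of A "V j"] by (simp add: cdga_hom_iff)
    then have a: "H (evar (V j)) = even_emb P"
      unfolding P_def by (intro cga_eqI) (simp add: cf_even_emb cyl_degree_40)
    have "cdiff (cyl A) (H (evar (V j))) = 0"
    proof -
      have "H (cdiff A (evar (V j))) = cdiff (cyl A) (H (evar (V j)))" "alg_hom H"
        using H by (simp_all add: cdga_hom_iff)
      then show ?thesis by (simp add: cdiff_evar alg_hom.zero)
    qed
    then have "C.dpoly P = 0" by (simp add: a C.cdiff_even_emb)
    moreover have "C.dpoly P = even_emb (pdiff None P) * ovar None"
      unfolding C.dpoly_def sum_option by (simp add: cyl_def alg_hom.zero[OF alg_hom_cyl_emb])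
    ultimately have "cf (even_emb (pdiff None P) * (ovar None :: ('n even_gen option, odd_gen option) cga)) {None} = 0"
      by simp
    then have "pdiff None P = 0" by (simp add: cf_ovar)
    then have "None \<notin> indets P"
      using pdiff_eq_0_keys[of None P] by (auto simp: indets_def in_keys_iff)
    have at: "subst qconst (case_option (qconst 0) qvar) P = subst qconst (case_option (qconst 1) qvar) P"
    proof (rule subst_cong_indets)
      fix e assume "e \<in> indets P"
      with \<open>None \<notin> indets P\<close> obtain e' where "e = Some e'" by (cases e) auto
      then show "case_option (qconst 0) qvar e = case_option (qconst 1) qvar e" by simp
    qed
    have "cf (cyl_at c (H (evar (V j)))) {} = subst qconst (case_option (qconst c) qvar) P" for c
      by (simp add: cf_cyl_at P_def)
    then show ?thesis
      unfolding ends[symmetric] comp_apply using at by simp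
  qed
  then show ?thesis
    by (simp add: mat_def lin_coeff_def fun_eq_iff)
qed

subsection \<open>Automorphisms from orthogonal matrices\<close>

lemma lin_coeff_comb: "lin_coeff (even_emb (\<Sum>l\<in>UNIV. qconst (c l) * lin_form L l)) m = (\<Sum>l\<in>UNIV. c l * L l m)"
proof -
  have inj: "single (V l) (1 :: nat) = single (V m) 1 \<longleftrightarrow> l = m" for l m :: 'n
    by (metis even_gen.inject lookup_single_eq lookup_single_not_eq zero_neq_one)
  have "lookup (lin_form L l) (single (V m) 1) = (\<Sum>i\<in>UNIV. if i = m then L l i else 0)" for l
    unfolding lin_form_def lookup_sum lookup_qconst_mult
    by (rule sum.cong) (auto simp: qvar_def lookup_single when_def inj simp del: One_nat_def)
  then show ?thesis
    by (simp add: lin_coeff_def cf_even_emb lookup_sum lookup_qconst_mult)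
qed

lemma lin_coeff_lin_form: "lin_coeff (even_emb (lin_form L j)) m = L j m"
proof -
  have "lin_form L j = (\<Sum>l\<in>UNIV. if l = j then lin_form L j else 0)" by simp
  also have "\<dots> = (\<Sum>l\<in>UNIV. qconst (if l = j then 1 else 0) * lin_form L l)"
    by (rule sum.cong) auto
  finally have "lin_coeff (even_emb (lin_form L j)) m = (\<Sum>l\<in>UNIV. (if l = j then 1 else 0) * L l m)"
    by (simp only: lin_coeff_comb)
  also have "\<dots> = (\<Sum>l\<in>UNIV. if l = j then L l m else 0)"
    by (rule sum.cong) auto
  finally show ?thesis by simp
qed

text \<open>The order is reversed because matrices act on coordinates, which are the generators
  \<open>v\<^sub>j\<close> evaluated at a point.\<close>

lemma mat_comp:
  assumes "cdga_hom A A \<phi>" "inj \<phi>" "cdga_hom A A \<psi>" "inj \<psi>"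
  shows "mat_app (mat (\<phi> \<circ> \<psi>)) u = mat_app (mat \<psi>) (mat_app (mat \<phi>) u)"
proof -
  interpret \<phi>: alg_hom \<phi> using assms(1) by (simp add: cdga_hom_iff)
  have "mat (\<phi> \<circ> \<psi>) j m = (\<Sum>l\<in>UNIV. mat \<psi> j l * mat \<phi> l m)" for j m
  proof -
    have "\<phi> (even_emb (lin_form (mat \<psi>) j)) = (\<Sum>l\<in>UNIV. even_emb (qconst (mat \<psi> j l)) * \<phi> (evar (V l)))"
      by (simp add: lin_form_def even_emb_sum \<phi>.sum \<phi>.mult \<phi>.const evar_def)
    also have "\<dots> = even_emb (\<Sum>l\<in>UNIV. qconst (mat \<psi> j l) * lin_form (mat \<phi>) l)"
      by (simp add: automorphism_normal_form(3)[OF assms(1,2)] even_emb_sum)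
    finally show ?thesis
      using lin_coeff_comb by (simp add: mat_def[of "\<phi> \<circ> \<psi>"] automorphism_normal_form(3)[OF assms(3,4)])
  qed
  then show ?thesis
    by (intro ext) (simp add: mat_app_def sum_distrib_left sum_distrib_right mult.assoc, rule sum.swap)
qed

definition lin_hom :: "('n \<Rightarrow> 'n \<Rightarrow> rat) \<Rightarrow> 'n model_cga \<Rightarrow> 'n model_cga"
  where "lin_hom L = ext_hom (\<lambda>e. case e of X1 \<Rightarrow> x1 | X2 \<Rightarrow> x2 | V j \<Rightarrow> lin_form L j) ovar"

lemma alg_hom_lin_hom: "alg_hom (lin_hom L)"
  unfolding lin_hom_def by (rule alg_hom_ext_hom) simp

lemma lin_hom_evar: "lin_hom L (evar X1) = evar X1" "lin_hom L (evar X2) = evar X2"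
  "lin_hom L (evar (V j)) = even_emb (lin_form L j)"
  and lin_hom_ovar: "lin_hom L (ovar y) = ovar y"
  by (simp_all add: lin_hom_def ext_hom_evar ext_hom_ovar evar_def[of X1] evar_def[of X2])
    (simp_all add: evar_def ext_hom_even_emb)

lemma mat_lin_hom: "mat (lin_hom L) = L"
  by (simp add: mat_def lin_hom_evar lin_coeff_lin_form fun_eq_iff)

lemma homogeneous_lin_form: "homogeneous A 40 (even_emb (lin_form L j))"
  unfolding lin_form_def even_emb_sum even_emb_hom
  using homogeneous_evar[of A "V _"] unfolding evar_def
  by (intro homogeneous_sum homogeneous_even_emb_qconst_mult) simp

lemma cdga_hom_lin_hom:
  assumes L: "\<And>i u. i \<le> r + 1 \<Longrightarrow> peval (mat_app L u) (q i) = peval u (q i)"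
  shows "cdga_hom A A (lin_hom L)"
  unfolding lin_hom_def
proof (rule cdga_hom_ext_hom[OF graded_cdga_axioms graded_cdga_axioms], fold lin_hom_def)
  let ?g = "\<lambda>e. case e of X1 \<Rightarrow> x1 | X2 \<Rightarrow> x2 | V j \<Rightarrow> lin_form L j"
  show "homogeneous A (edeg A e) (even_emb (?g e))" for e
    using homogeneous_evar[of A e] homogeneous_lin_form by (cases e) (simp_all add: evar_def)
  show "homogeneous A (odeg A y) (ovar y)" for y by (rule homogeneous_ovar)
  interpret lin: alg_hom "lin_hom L" by (rule alg_hom_lin_hom)
  show "lin_hom L (ediff A e) = cdiff A (even_emb (?g e))" for e
    by (simp add: lin.zero)
  have emb: "lin_hom L (even_emb p) = even_emb (subst qconst ?g p)" for p
    by (simp add: lin_hom_def ext_hom_even_emb)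
  have "subst qconst ?g dz_even = dz_even"
  proof (rule qpoly_eqI_peval)
    fix u
    have "(\<lambda>j. peval u (lin_form L j)) = mat_app L (\<lambda>j. u (V j))"
      by (simp add: fun_eq_iff lin_form_def mat_app_def peval_sum)
    then show "peval u (subst qconst ?g dz_even) = peval u dz_even"
      unfolding peval_subst peval_dz_even by (simp add: L cong: sum.cong_simp)
  qed
  then have "lin_hom L (even_emb dz_even) = even_emb dz_even" by (simp add: emb)
  then have "lin_hom L (model_dz r q k) = model_dz r q k"
    unfolding model_dz_eq lin.hom lin_hom_evar lin_hom_ovar by simp
  then show "lin_hom L (odiff A y) = cdiff A (ovar y)" for y
    by (cases y) (simp_all add: cdiff_ovar lin.hom lin_hom_evar del: odiff_even)
qed

lemma lin_hom_inverse:
  assumes "\<And>u. mat_app L' (mat_app L u) = u"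
  shows "lin_hom L \<circ> lin_hom L' = id"
proof (rule alg_hom_eqI)
  show "alg_hom (lin_hom L \<circ> lin_hom L')"
    by (rule alg_hom_comp) (rule alg_hom_lin_hom)+
  show "alg_hom (id :: 'n model_cga \<Rightarrow> _)" by unfold_locales simp_all
  interpret lin: alg_hom "lin_hom L" by (rule alg_hom_lin_hom)
  show "(lin_hom L \<circ> lin_hom L') (evar e) = id (evar e)" for e
  proof (cases e)
    case (V j)
    have "lin_hom L (even_emb (lin_form L' j)) = even_emb (\<Sum>l\<in>UNIV. qconst (L' j l) * lin_form L l)"
      by (simp add: lin_form_def[of L'] even_emb_sum lin.sum lin.mult lin.const lin_hom_evar flip: evar_def)
    also have "(\<Sum>l\<in>UNIV. qconst (L' j l) * lin_form L l) = qvar (V j)"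
    proof (rule qpoly_eqI_peval)
      fix u
      have "mat_app L' (mat_app L (\<lambda>j. u (V j))) j = u (V j)" by (simp add: assms)
      then show "peval u (\<Sum>l\<in>UNIV. qconst (L' j l) * lin_form L l) = peval u (qvar (V j))"
        by (simp add: mat_app_def lin_form_def peval_sum)
    qed
    finally show ?thesis by (simp add: V lin_hom_evar) (simp add: evar_def)
  qed (simp_all add: lin_hom_evar)
  show "(lin_hom L \<circ> lin_hom L') (ovar y) = id (ovar y)" for y
    by (simp add: lin_hom_ovar)
qed

end

section \<open>The group of self-equivalences\<close>

text \<open>The first isomorphism theorem, for a set of maps that is closed under composition but not
  yet known to be a group. The fibres of \<open>\<Psi>\<close> correspond to the elements of \<open>G\<close>, and the group laws
  of the quotient are transported from \<open>G\<close>. For automorphisms of a cdga this avoids showing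
  separately that the inverse of a degree-preserving bijection preserves degrees.\<close>

lemma quotient_by_kernel:
  fixes G :: "('g, 'b) monoid_scheme" and C :: "('x \<Rightarrow> 'x) set" and \<Psi> :: "('x \<Rightarrow> 'x) \<Rightarrow> 'g"
  assumes G: "group G" and id: "id \<in> C" and comp: "\<And>\<phi> \<psi>. \<phi> \<in> C \<Longrightarrow> \<psi> \<in> C \<Longrightarrow> \<phi> \<circ> \<psi> \<in> C"
    and \<Psi>: "\<And>\<phi>. \<phi> \<in> C \<Longrightarrow> \<Psi> \<phi> \<in> carrier G"
    and mult: "\<And>\<phi> \<psi>. \<phi> \<in> C \<Longrightarrow> \<psi> \<in> C \<Longrightarrow> \<Psi> (\<phi> \<circ> \<psi>) = \<Psi> \<phi> \<otimes>\<^bsub>G\<^esub> \<Psi> \<psi>"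
    and surj: "\<And>x. x \<in> carrier G \<Longrightarrow> \<exists>\<phi>\<in>C. \<Psi> \<phi> = x"
    and R: "R = {(\<phi>, \<psi>). \<phi> \<in> C \<and> \<psi> \<in> C \<and> \<Psi> \<phi> = \<Psi> \<psi>}"
    and E: "E = \<lparr>carrier = C // R, monoid.mult = (\<lambda>X Y. \<Union>\<phi>\<in>X. \<Union>\<psi>\<in>Y. R `` {\<phi> \<circ> \<psi>}), one = R `` {id}\<rparr>"
  shows "group E \<and> E \<cong> G"
proof -
  interpret G: group G by fact
  define fib where "fib x = {\<phi> \<in> C. \<Psi> \<phi> = x}" for x
  have cls: "R `` {\<phi>} = fib (\<Psi> \<phi>)" if "\<phi> \<in> C" for \<phi>
    using that by (auto simp: R fib_def)
  have ne: "fib x \<noteq> {}" if "x \<in> carrier G" for x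
    using surj[OF that] by (auto simp: fib_def)
  have "fib ` carrier G = carrier E"
  proof
    show "fib ` carrier G \<subseteq> carrier E"
    proof
      fix X assume "X \<in> fib ` carrier G"
      then obtain x where x: "x \<in> carrier G" "X = fib x" by blast
      obtain \<phi> where \<phi>: "\<phi> \<in> C" "\<Psi> \<phi> = x" using surj[OF x(1)] by blast
      have "R `` {\<phi>} \<in> C // R" using \<phi>(1) by (rule quotientI)
      then show "X \<in> carrier E" using cls[OF \<phi>(1)] \<phi>(2) x(2) by (simp add: E)
    qed
    show "carrier E \<subseteq> fib ` carrier G"
    proof
      fix X assume "X \<in> carrier E"
      then obtain \<phi> where "\<phi> \<in> C" "X = R `` {\<phi>}" by (auto simp: E elim: quotientE)
      then show "X \<in> fib ` carrier G" using cls \<Psi> by auto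
    qed
  qed
  moreover have "inj_on fib (carrier G)"
  proof (rule inj_onI)
    fix x y assume "x \<in> carrier G" "fib x = fib y"
    then obtain \<phi> where "\<phi> \<in> fib x" "\<phi> \<in> fib y" using ne by blast
    then show "x = y" by (simp add: fib_def)
  qed
  ultimately have bij: "bij_betw fib (carrier G) (carrier E)"
    by (simp add: bij_betw_def)
  have "fib (x \<otimes>\<^bsub>G\<^esub> y) = fib x \<otimes>\<^bsub>E\<^esub> fib y" if x: "x \<in> carrier G" and y: "y \<in> carrier G" for x y
  proof -
    have "R `` {\<phi> \<circ> \<psi>} = fib (x \<otimes>\<^bsub>G\<^esub> y)" if "\<phi> \<in> fib x" "\<psi> \<in> fib y" for \<phi> \<psi>
      using that cls comp mult by (auto simp: fib_def)
    then have "(\<Union>\<phi>\<in>fib x. \<Union>\<psi>\<in>fib y. R `` {\<phi> \<circ> \<psi>}) = (\<Union>\<phi>\<in>fib x. \<Union>\<psi>\<in>fib y. fib (x \<otimes>\<^bsub>G\<^esub> y))"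
      by simp
    then show ?thesis using ne[OF x] ne[OF y] by (simp add: E)
  qed
  then have iso: "fib \<in> iso G E"
    using bij bij_betwE[OF bij] by (intro isoI homI) blast+
  have "\<Psi> id = \<one>\<^bsub>G\<^esub>"
    using mult[OF id id] \<Psi>[OF id] by (simp add: G.l_cancel_one')
  then have "\<one>\<^bsub>E\<^esub> = fib \<one>\<^bsub>G\<^esub>"
    using cls[OF id] by (simp add: E)
  then have "E\<lparr>one := fib \<one>\<^bsub>G\<^esub>\<rparr> = E" by (simp add: E)
  then have "group E"
    using G.iso_imp_img_group[OF iso] by simp
  moreover have "E \<cong> G"
    using G.iso_set_sym[OF iso] by (auto simp: is_iso_def)
  ultimately show ?thesis by blast
qed

lemma comp_cdga_aut: "\<phi> \<in> cdga_aut A \<Longrightarrow> \<psi> \<in> cdga_aut A \<Longrightarrow> \<phi> \<circ> \<psi> \<in> cdga_aut A"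
  by (simp add: cdga_aut_def cdga_hom_def bij_comp)

lemma id_cdga_aut: "id \<in> cdga_aut A"
  by (simp add: cdga_aut_def cdga_hom_def)

lemma group_orthogonal_group:
  assumes "vector_space scale"
  shows "group (orthogonal_group scale v r q)"
proof (rule groupI)
  interpret vector_space scale by fact
  interpret pair: vector_space_pair scale scale ..
  let ?G = "orthogonal_group scale v r q"
  show "x \<otimes>\<^bsub>?G\<^esub> y \<in> carrier ?G" if "x \<in> carrier ?G" "y \<in> carrier ?G" for x y
  proof -
    have "Vector_Spaces.linear scale scale x" "Vector_Spaces.linear scale scale y"
      using that by (auto simp: orthogonal_group_def)
    then have "Vector_Spaces.linear scale scale (x \<circ> y)"
      using Vector_Spaces.linear_compose by blast
    then show ?thesis
      using that by (auto simp: orthogonal_group_def bij_comp simp flip: comp_assoc)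
  qed
  show "\<one>\<^bsub>?G\<^esub> \<in> carrier ?G"
    by (simp add: orthogonal_group_def linear_id)
  show "x \<otimes>\<^bsub>?G\<^esub> y \<otimes>\<^bsub>?G\<^esub> z = x \<otimes>\<^bsub>?G\<^esub> (y \<otimes>\<^bsub>?G\<^esub> z)" for x y z
    by (simp add: orthogonal_group_def comp_assoc)
  show "\<one>\<^bsub>?G\<^esub> \<otimes>\<^bsub>?G\<^esub> x = x" for x
    by (simp add: orthogonal_group_def)
  show "\<exists>y\<in>carrier ?G. y \<otimes>\<^bsub>?G\<^esub> x = \<one>\<^bsub>?G\<^esub>" if "x \<in> carrier ?G" for x
  proof
    have x: "Vector_Spaces.linear scale scale x" "bij x"
      and q: "\<And>i. i \<le> r + 1 \<Longrightarrow> poly_fun v (q i) \<circ> x = poly_fun v (q i)"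
      using that by (auto simp: orthogonal_group_def)
    let ?y = "inv_into UNIV x"
    interpret x: Vector_Spaces.linear scale scale x by (rule x)
    have xy: "x (?y a) = a" for a using x(2) by (simp add: bij_is_surj surj_f_inv_f)
    have yx: "?y \<circ> x = id" using x(2) by (simp add: bij_is_inj)
    have "Vector_Spaces.linear scale scale ?y"
    proof unfold_locales
      show "?y (a + b) = ?y a + ?y b" for a b
        by (rule injD[OF bij_is_inj[OF x(2)]]) (simp add: x.add xy)
      show "?y (scale c a) = scale c (?y a)" for c a
        by (rule injD[OF bij_is_inj[OF x(2)]]) (simp add: x.scale xy)
    qed
    moreover have "poly_fun v (q i) \<circ> ?y = poly_fun v (q i)" if "i \<le> r + 1" for i
    proof
      fix a
      have "(poly_fun v (q i) \<circ> x) (?y a) = poly_fun v (q i) (?y a)" by (simp only: q[OF that])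
      then show "(poly_fun v (q i) \<circ> ?y) a = poly_fun v (q i) a" by (simp add: xy)
    qed
    moreover have "bij ?y" using x(2) by (rule bij_imp_bij_inv)
    ultimately show "?y \<in> carrier ?G" by (simp add: orthogonal_group_def)
    show "?y \<otimes>\<^bsub>?G\<^esub> x = \<one>\<^bsub>?G\<^esub>" by (simp add: orthogonal_group_def yx)
  qed
qed

theorem theorem3p2:
  fixes scale :: "rat \<Rightarrow> 'm::ab_group_add \<Rightarrow> 'm"
    and v :: "'n::finite \<Rightarrow> 'm \<Rightarrow> rat"
    and q :: "nat \<Rightarrow> 'n qpoly"
    and r d :: nat
    and k :: int
  assumes "vector_space scale"
    and "vector_space.dim scale (UNIV :: 'm set) = CARD('n)"
    and "dual_basis scale v"
    and "realizable r q"
    and "d = tdeg (q 0)" and "d \<ge> 2"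
    and "int (tdeg (q (r + 1))) < 2 * k + (int d - 1)"
  shows "group (self_equivalences (model r q k)) \<and>
    self_equivalences (model r q k) \<cong> orthogonal_group scale v r q"
proof -
  interpret realizable_model r q k
    using assms by unfold_locales simp_all
  interpret M: vector_space scale by fact
  obtain b where vb: "\<And>i j. v i (b j) = (if i = j then 1 else 0)"
    and expand: "\<And>x. x = (\<Sum>j\<in>UNIV. scale (v j x) (b j))"
    and v: "\<And>j. Vector_Spaces.linear scale (*) (v j)"
    using dual_basis_coordinates[OF assms(1-3)] by metis
  define G where "G = orthogonal_group scale v r q"
  interpret G: group G
    unfolding G_def by (rule group_orthogonal_group) fact
  define crd where "crd x = (\<lambda>j. v j x)" for x
  define pt where "pt u = (\<Sum>j\<in>UNIV. scale (u j) (b j))" for u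
  have v_lin: "v j (x + y) = v j x + v j y" "v j (scale c x) = c * v j x" "v j (\<Sum>i\<in>I. f i) = (\<Sum>i\<in>I. v j (f i))"
    for j x y c and I :: "'n set" and f
  proof -
    have "module_hom scale (*) (v j)" using v[of j] by (simp add: Vector_Spaces.linear_def)
    then show "v j (x + y) = v j x + v j y" "v j (scale c x) = c * v j x" "v j (\<Sum>i\<in>I. f i) = (\<Sum>i\<in>I. v j (f i))"
      by (rule module_hom.add, rule module_hom.scale, rule module_hom.sum)
  qed
  have crd_pt: "crd (pt u) = u" for u
    by (rule ext) (simp add: crd_def pt_def v_lin vb if_distrib[of "(*) _"] cong: if_cong)
  have pt_crd: "pt (crd x) = x" for x
    unfolding pt_def crd_def by (rule expand[symmetric])
  have pt_add: "pt (u + w) = pt u + pt w" and pt_scale: "pt (\<lambda>j. c * u j) = scale c (pt u)" for u w c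
    by (simp_all add: pt_def M.scale_left_distrib sum.distrib M.scale_sum_right)
  have poly_fun: "poly_fun v p x = peval (crd x) p" for p x
    by (simp add: poly_fun_def peval_def crd_def)
  define lin_map where "lin_map L x = pt (mat_app L (crd x))" for L x
  have crd_lin_map: "crd (lin_map L x) = mat_app L (crd x)" for L x
    by (simp add: lin_map_def crd_pt)
  have lin_map_eq: "lin_map L = lin_map L' \<longleftrightarrow> L = L'" for L L'
  proof
    assume eq: "lin_map L = lin_map L'"
    have "L j l = L' j l" for j l
    proof -
      have "mat_app L (unit_vec l) = mat_app L' (unit_vec l)"
        using fun_cong[OF eq, of "pt (unit_vec l)"] crd_lin_map[of L] crd_lin_map[of L'] by (metis crd_pt)
      from fun_cong[OF this, of j] show ?thesis
        by (simp add: mat_app_def unit_vec_def if_distrib[of "(*) _"] cong: if_cong)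
    qed
    then show "L = L'" by blast
  qed simp
  have carrierI: "lin_map L \<in> carrier G"
    if inj: "\<And>w. mat_app L w = 0 \<Longrightarrow> w = 0" and q: "\<And>i u. i \<le> r + 1 \<Longrightarrow> peval (mat_app L u) (q i) = peval u (q i)" for L
  proof -
    have crd_lin: "crd (x + y) = crd x + crd y" "crd (scale c x) = (\<lambda>j. c * crd x j)" for x y c
      by (simp_all add: crd_def v_lin fun_eq_iff)
    have app_lin: "mat_app L (u + w) = mat_app L u + mat_app L w" "mat_app L (\<lambda>j. c * u j) = (\<lambda>j. c * mat_app L u j)" for u w c
      by (simp_all add: mat_app_def fun_eq_iff algebra_simps sum.distrib sum_distrib_left)
    have lin: "Vector_Spaces.linear scale scale (lin_map L)"
      by unfold_locales (simp_all add: lin_map_def crd_lin app_lin pt_add pt_scale)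
    interpret lin: Vector_Spaces.linear scale scale "lin_map L" by (rule lin)
    have "x = 0" if "lin_map L x = 0" for x
    proof -
      have "crd 0 = 0" using crd_lin(2)[of 0 0] by (simp add: fun_eq_iff)
      then have "mat_app L (crd x) = 0" using crd_lin_map[of L x] that by simp
      then have "crd x = crd 0" using inj \<open>crd 0 = 0\<close> by simp
      then show "x = 0" by (metis pt_crd)
    qed
    then have "inj (lin_map L)" by (simp add: lin.inj_iff_eq_0)
    moreover have "surj (lin_map L)"
    proof (rule surjI)
      fix x
      show "lin_map L (pt (SOME w. crd x = mat_app L w)) = x"
        using someI_ex[OF inj_mat_app_surj[where L = L and b = "crd x", OF inj]] pt_crd[of x] by (simp add: lin_map_def crd_pt)
    qed
    ultimately show ?thesis
      using lin q by (auto simp: G_def orthogonal_group_def bij_def poly_fun crd_lin_map fun_eq_iff)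
  qed
  have carrierE: "\<exists>L. f = lin_map L \<and> (\<forall>i\<le>r + 1. \<forall>u. peval (mat_app L u) (q i) = peval u (q i))" if f: "f \<in> carrier G" for f
  proof -
    have lin: "Vector_Spaces.linear scale scale f" and q: "\<And>i. i \<le> r + 1 \<Longrightarrow> poly_fun v (q i) \<circ> f = poly_fun v (q i)"
      using f by (auto simp: G_def orthogonal_group_def)
    interpret f: Vector_Spaces.linear scale scale f by (rule lin)
    define L where "L j l = v j (f (b l))" for j l
    have "crd (f x) = mat_app L (crd x)" for x
    proof
      fix j
      have "v j (f x) = v j (f (\<Sum>l\<in>UNIV. scale (v l x) (b l)))" by (simp only: expand[symmetric])
      then show "crd (f x) j = mat_app L (crd x) j"
        by (simp add: f.sum f.scale v_lin crd_def mat_app_def L_def mult.commute)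
    qed
    then have fL: "f = lin_map L"
      by (metis ext lin_map_def pt_crd)
    moreover have "peval (mat_app L u) (q i) = peval u (q i)" if "i \<le> r + 1" for i u
      using fun_cong[OF q[OF that], of "pt u"] by (simp add: poly_fun fL crd_lin_map crd_pt)
    ultimately show ?thesis by blast
  qed
  have aut: "cdga_hom A A \<phi> \<and> inj \<phi>" if "\<phi> \<in> cdga_aut A" for \<phi>
    using that by (auto simp: cdga_aut_def bij_is_inj)
  have mat_carrier: "lin_map (mat \<phi>) \<in> carrier G" if "\<phi> \<in> cdga_aut A" for \<phi>
    using automorphism_normal_form(6,7) aut[OF that] by (intro carrierI) blast+
  \<comment> \<open>The matrix of \<open>\<phi>\<close> depends on \<open>\<phi>\<close> contravariantly; the inverse turns this into a
    homomorphism.\<close>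
  define \<Psi> where "\<Psi> \<phi> = inv\<^bsub>G\<^esub> (lin_map (mat \<phi>))" for \<phi>
  have homotopy: "homotopy_rel A = {(\<phi>, \<psi>). \<phi> \<in> cdga_aut A \<and> \<psi> \<in> cdga_aut A \<and> \<Psi> \<phi> = \<Psi> \<psi>}"
  proof -
    have "homotopic A \<phi> \<psi> \<longleftrightarrow> \<Psi> \<phi> = \<Psi> \<psi>" if "\<phi> \<in> cdga_aut A" "\<psi> \<in> cdga_aut A" for \<phi> \<psi>
    proof -
      have "\<Psi> \<phi> = \<Psi> \<psi> \<longleftrightarrow> mat \<phi> = mat \<psi>"
        unfolding \<Psi>_def using mat_carrier that lin_map_eq by (metis G.inv_inv)
      then show ?thesis
        using homotopic_if_mat_eq[OF that] mat_eq_if_homotopic by blast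
    qed
    then show ?thesis by (auto simp: homotopy_rel_def)
  qed
  show ?thesis
    unfolding G_def[symmetric]
  proof (rule quotient_by_kernel[where \<Psi> = \<Psi>, OF G.group_axioms id_cdga_aut comp_cdga_aut _ _ _ homotopy])
    show "\<Psi> \<phi> \<in> carrier G" if "\<phi> \<in> cdga_aut A" for \<phi>
      unfolding \<Psi>_def using mat_carrier[OF that] by simp
    show "\<Psi> (\<phi> \<circ> \<psi>) = \<Psi> \<phi> \<otimes>\<^bsub>G\<^esub> \<Psi> \<psi>" if \<phi>: "\<phi> \<in> cdga_aut A" and \<psi>: "\<psi> \<in> cdga_aut A" for \<phi> \<psi>
    proof -
      have "lin_map (mat (\<phi> \<circ> \<psi>)) = lin_map (mat \<psi>) \<circ> lin_map (mat \<phi>)"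
      proof
        have "mat_app (mat (\<phi> \<circ> \<psi>)) u = mat_app (mat \<psi>) (mat_app (mat \<phi>) u)" for u
          using mat_comp aut[OF \<phi>] aut[OF \<psi>] by blast
        then show "lin_map (mat (\<phi> \<circ> \<psi>)) x = (lin_map (mat \<psi>) \<circ> lin_map (mat \<phi>)) x" for x
          by (simp add: lin_map_def crd_pt)
      qed
      also have "\<dots> = lin_map (mat \<psi>) \<otimes>\<^bsub>G\<^esub> lin_map (mat \<phi>)"
        by (simp add: G_def orthogonal_group_def)
      finally show ?thesis
        unfolding \<Psi>_def using mat_carrier[OF \<phi>] mat_carrier[OF \<psi>] by (simp add: G.inv_mult_group)
    qed
    show "\<exists>\<phi>\<in>cdga_aut A. \<Psi> \<phi> = f" if f: "f \<in> carrier G" for f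
    proof -
      obtain L where L: "inv\<^bsub>G\<^esub> f = lin_map L" "\<And>i u. i \<le> r + 1 \<Longrightarrow> peval (mat_app L u) (q i) = peval u (q i)"
        using carrierE[OF G.inv_closed[OF f]] by blast
      obtain L' where L': "f = lin_map L'"
        using carrierE[OF f] by blast
      have "lin_map L \<circ> lin_map L' = id" "lin_map L' \<circ> lin_map L = id"
        using G.l_inv[OF f] G.r_inv[OF f] unfolding L(1) L'[symmetric]
        by (simp_all add: G_def orthogonal_group_def)
      then have LL': "mat_app L (mat_app L' u) = u" "mat_app L' (mat_app L u) = u" for u
        using crd_lin_map crd_pt by (metis comp_apply id_apply)+
      have "lin_hom L' \<circ> lin_hom L = id" "lin_hom L \<circ> lin_hom L' = id"
        by (rule lin_hom_inverse, rule LL')+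
      then have "bij (lin_hom L)" by (rule o_bij)
      then have "lin_hom L \<in> cdga_aut A"
        using cdga_hom_lin_hom[OF L(2)] by (simp add: cdga_aut_def)
      moreover have "\<Psi> (lin_hom L) = f"
        unfolding \<Psi>_def mat_lin_hom L(1)[symmetric] using f by simp
      ultimately show ?thesis by blast
    qed
    show "self_equivalences A = \<lparr>carrier = cdga_aut A // homotopy_rel A,
        monoid.mult = \<lambda>X Y. \<Union>\<phi>\<in>X. \<Union>\<psi>\<in>Y. homotopy_rel A `` {\<phi> \<circ> \<psi>}, one = homotopy_rel A `` {id}\<rparr>"
      by (rule self_equivalences_def)
  qed
qed

end
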